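(* Let $(s_k)_{k\ge0}$ be a bounded sequence of integers with $s_0=-1$, $s_1=1$, $s_k\ge1$ for $k\ge1$, and put $$\sigma=\frac{1}{\limsup_{k\to\infty}[s_{k+1};s_k,\dots,s_1]}.$$ Let $(w_i)_{i\ge0}$ be an admissible Sturmian sequence in $\mathcal{M}$ (relative to $(s_k)$) with multiplicative growth, with $\|w_i\|\to\infty$, and with a non-symmetric matrix $N$; let $(y_i)_{i\ge-2}$ be the associated sequence of symmetric matrices and $\delta\ge0$ the real number with $|\det w_i|\asymp\|w_i\|^\delta$. Assume that $\delta<\frac{\sigma}{1+\sigma}$ and that the content of $y_i$ is bounded independently of $i$. Let $\xi$ be the real number such that $(y_i)$ converges in $\mathbb{P}^2(\mathbb{R})$ to the class of $(1,\xi,\xi^2)$, and let $\underline\psi_j,\overline\psi_j$ be the parametric exponents attached to $u=(1,\xi,\xi^2)$. Then $$\underline\psi_1=\frac{\sigma}{(2-\delta)(1+\sigma)},\qquad \overline\psi_1=\frac{1}{(1-\delta)(1+\sigma)+2},\qquad \overline\psi_2=\frac{1}{2+\sigma},$$ $$\underline\psi_3=\frac{(1-\delta)(1+\sigma)}{1+2(1-\delta)(1+\sigma)},\qquad \frac{1-\delta}{2-\delta}\le\overline\psi_3\le\max\Big(\frac{1-\delta}{2-\delta},\frac{1}{2-\delta+\sigma}\Big).$$ In particular, if $\delta\le h(\sigma)$ with $$h(\sigma)=\frac{\sigma}{2}+1-\sqrt{\Big(\frac{\sigma}{2}\Big)^2+1}\;\le\;\frac{\sigma}{1+\sigma},$$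 then $\overline\psi_3=\frac{1-\delta}{2-\delta}$.
   Context: $[a_0;a_1,\dots]$ denotes a continued fraction. Put $t_k=s_0+\dots+s_k$. $\mathcal{M}$ is the monoid of $2\times2$ integer matrices with non-zero determinant; $\|w\|$ is the maximum of the absolute values of the entries of $w$. A Sturmian sequence in $\mathcal{M}$ relative to $(s_k)$ is a sequence $(w_i)_{i\ge0}$ in $\mathcal{M}$ with $w_{i+1}=w_i^{s_{i+1}}w_{i-1}$ for $i\ge1$. It is admissible if there is $N\in\mathcal{M}$ such that $w_1N$, $w_0{}^tN$, $w_1w_0{}^tN$ are symmetric. It has multiplicative growth if there are $c_1,c_2>0$ with $c_1\|w_k\|\,\|w_k^{l-1}w_{k-1}\|\le\|w_k^lw_{k-1}\|\le c_2\|w_k\|\,\|w_k^{l-1}w_{k-1}\|$ for all $k\ge1$, $1\le l\le s_{k+1}+1$. Put $N_k=N$ for $k$ even, $N_k={}^tN$ for $k$ odd, $y_{-2}=w_0{}^tN$, $y_{-1}=w_1N$, $y_{t_k+l}=w_k^{l+1}w_{k-1}N_k$ for $k\ge1$, $0\le l<s_{k+1}$. These are symmetric matrices, identified with points of $\mathbb{Z}^3$ through $(x_0,x_1,x_2)\leftrightarrow\begin{pmatrix} x_0 & x_1 \\ x_1 & x_2 \end{pmatrix}$; the content of an integer point is the gcd of its coordinates. $a_i\asymp b_i$ means that $a_i/b_i$ is bounded above and below by positive constants for $i$ large. Under the hypotheses the number $\delta$ and the limit $(1,\xi,\xi^2)$ exist, and $1,\xi,\xi^2$ are linearly independent over $\mathbb{Q}$.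 Parametric exponents. With $\|\cdot\|$ the Euclidean norm on $\mathbb{R}^3$ and $x\cdot u$ the standard scalar product, let $\mathcal{C}_u(e^q)=\{x\in\mathbb{R}^3:\|x\|\le1,\ |x\cdot u|\le e^{-q}\}$ for $q\ge0$. For $j=1,2,3$, let $\lambda_j(q)$ be the $j$-th successive minimum of $\mathcal{C}_u(e^q)$ with respect to $\mathbb{Z}^3$, $L_j(q)=\log\lambda_j(q)$, $\overline\psi_j=\limsup_{q\to\infty}L_j(q)/q$ and $\underline\psi_j=\liminf_{q\to\infty}L_j(q)/q$. *)

theory Defs
  imports "HOL-Analysis.Analysis" "HOL-Library.Landau_Symbols"
begin

definition mat_monoid :: "(int^2^2) set" where
  "mat_monoid = {A. det A \<noteq> 0}"

definition max_norm :: "int^2^2 \<Rightarrow> int" where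
  "max_norm A = Max {\<bar>A $ i $ j\<bar> | i j. True}"

text \<open>The class operations \<open>*\<close> and \<open>^\<close> on vectors of vectors act entrywise, so powers for the
  matrix product \<open>**\<close> are introduced separately.\<close>

primrec mat_pow :: "int^2^2 \<Rightarrow> nat \<Rightarrow> int^2^2" where
  "mat_pow A 0 = mat 1"
| "mat_pow A (Suc n) = A ** mat_pow A n"

definition symmetric_mat :: "int^2^2 \<Rightarrow> bool" where
  "symmetric_mat A \<longleftrightarrow> transpose A = A"

definition sturmian_seq :: "(nat \<Rightarrow> int) \<Rightarrow> (nat \<Rightarrow> int^2^2) \<Rightarrow> bool" where
  "sturmian_seq s w \<longleftrightarrow> (\<forall>i. w i \<in> mat_monoid) \<and>
     (\<forall>i\<ge>1. w (i + 1) = mat_pow (w i) (nat (s (i + 1))) ** w (i - 1))"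

text \<open>A sequence is admissible if some \<open>N\<close> satisfies the following condition. The matrix is kept as
  a parameter because the symmetric matrices attached to the sequence depend on its choice.\<close>

definition admissible_with :: "(nat \<Rightarrow> int^2^2) \<Rightarrow> int^2^2 \<Rightarrow> bool" where
  "admissible_with w N \<longleftrightarrow> N \<in> mat_monoid \<and> symmetric_mat (w 1 ** N) \<and>
     symmetric_mat (w 0 ** transpose N) \<and> symmetric_mat (w 1 ** w 0 ** transpose N)"

definition mult_growth :: "(nat \<Rightarrow> int) \<Rightarrow> (nat \<Rightarrow> int^2^2) \<Rightarrow> bool" where
  "mult_growth s w \<longleftrightarrow> (\<exists>c1 c2 :: real. c1 > 0 \<and> c2 > 0 \<and>
     (\<forall>k l :: nat. k \<ge> 1 \<and> 1 \<le> l \<and> int l \<le> s (k + 1) + 1 \<longrightarrow>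
        (let a = real_of_int (max_norm (w k)) *
                 real_of_int (max_norm (mat_pow (w k) (l - 1) ** w (k - 1)));
             b = real_of_int (max_norm (mat_pow (w k) l ** w (k - 1)))
         in c1 * a \<le> b \<and> b \<le> c2 * a)))"

definition partial_sum :: "(nat \<Rightarrow> int) \<Rightarrow> nat \<Rightarrow> int" where
  "partial_sum s k = (\<Sum>j\<le>k. s j)"

definition alt_transpose :: "int^2^2 \<Rightarrow> nat \<Rightarrow> int^2^2" where
  "alt_transpose N k = (if even k then N else transpose N)"

text \<open>When \<open>s 0 = -1\<close>, \<open>s 1 = 1\<close> and \<open>s k \<ge> 1\<close> for \<open>k \<ge> 1\<close>, every index \<open>i \<ge> 0\<close> can be written
  in exactly one way as \<open>partial_sum s k + l\<close> with \<open>k \<ge> 1\<close> and \<open>0 \<le> l < s (k + 1)\<close>. The predicate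
  therefore determines \<open>y i\<close> for all \<open>i \<ge> -2\<close>; the values at \<open>i < -2\<close> are irrelevant.\<close>

definition symmetric_seq ::
    "(nat \<Rightarrow> int) \<Rightarrow> (nat \<Rightarrow> int^2^2) \<Rightarrow> int^2^2 \<Rightarrow> (int \<Rightarrow> int^2^2) \<Rightarrow> bool" where
  "symmetric_seq s w N y \<longleftrightarrow> y (-2) = w 0 ** transpose N \<and> y (-1) = w 1 ** N \<and>
     (\<forall>k l :: nat. k \<ge> 1 \<and> int l < s (k + 1) \<longrightarrow>
        y (partial_sum s k + int l) = mat_pow (w k) (l + 1) ** w (k - 1) ** alt_transpose N k)"

definition sym_content :: "int^2^2 \<Rightarrow> int" where
  "sym_content A = gcd (A $ 1 $ 1) (gcd (A $ 1 $ 2) (A $ 2 $ 2))"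

definition sym_point :: "int^2^2 \<Rightarrow> real^3" where
  "sym_point A = vector [of_int (A $ 1 $ 1), of_int (A $ 1 $ 2), of_int (A $ 2 $ 2)]"

fun cfrac :: "int list \<Rightarrow> real" where
  "cfrac [] = 0"
| "cfrac [a] = of_int a"
| "cfrac (a # b # xs) = of_int a + 1 / cfrac (b # xs)"

text \<open>The list below is \<open>[s (k+1), s k, \<dots>, s 1]\<close>.\<close>

definition sturm_sigma :: "(nat \<Rightarrow> int) \<Rightarrow> real" where
  "sturm_sigma s =
     1 / real_of_ereal (limsup (\<lambda>k. ereal (cfrac (rev (map s [1..<k + 2])))))"

definition h_fun :: "real \<Rightarrow> real" where
  "h_fun \<sigma> = \<sigma> / 2 + 1 - sqrt ((\<sigma> / 2)\<^sup>2 + 1)"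

text \<open>Points are the lines through the origin of \<open>real^3\<close>, with the quotient topology from the
  non-zero vectors.\<close>

definition proj_class :: "real^3 \<Rightarrow> (real^3) set" where
  "proj_class x = span {x}"

definition proj_plane :: "(real^3) set topology" where
  "proj_plane = topology (\<lambda>U. U \<subseteq> proj_class ` (- {0}) \<and> open {x. x \<noteq> 0 \<and> proj_class x \<in> U})"

lemma openin_proj_plane:
  "openin proj_plane U \<longleftrightarrow>
     U \<subseteq> proj_class ` (- {0}) \<and> open {x. x \<noteq> 0 \<and> proj_class x \<in> U}"
proof -
  have "istopology (\<lambda>U. U \<subseteq> proj_class ` (- {0}) \<and> open {x. x \<noteq> 0 \<and> proj_class x \<in> U})"
    unfolding istopology_def
  proof (intro conjI allI impI)
    fix S T
    assume "S \<subseteq> proj_class ` (- {0}) \<and> open {x. x \<noteq> 0 \<and> proj_class x \<in> S}"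
      and "T \<subseteq> proj_class ` (- {0}) \<and> open {x. x \<noteq> 0 \<and> proj_class x \<in> T}"
    moreover have "{x. x \<noteq> 0 \<and> proj_class x \<in> S \<inter> T} =
        {x. x \<noteq> 0 \<and> proj_class x \<in> S} \<inter> {x. x \<noteq> 0 \<and> proj_class x \<in> T}"
      by blast
    ultimately show "S \<inter> T \<subseteq> proj_class ` (- {0})"
      and "open {x. x \<noteq> 0 \<and> proj_class x \<in> S \<inter> T}"
      by (auto intro: open_Int)
  next
    fix K
    assume *: "\<forall>S\<in>K. S \<subseteq> proj_class ` (- {0}) \<and> open {x. x \<noteq> 0 \<and> proj_class x \<in> S}"
    then show "\<Union>K \<subseteq> proj_class ` (- {0})"
      by blast
    have "{x. x \<noteq> 0 \<and> proj_class x \<in> \<Union>K} = (\<Union>S\<in>K. {x. x \<noteq> 0 \<and> proj_class x \<in> S})"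
      by blast
    with * show "open {x. x \<noteq> 0 \<and> proj_class x \<in> \<Union>K}"
      by (auto intro: open_UN)
  qed
  then show ?thesis
    by (simp add: proj_plane_def)
qed

lemma topspace_proj_plane: "topspace proj_plane = proj_class ` (- {0})"
proof
  show "topspace proj_plane \<subseteq> proj_class ` (- {0})"
    using openin_proj_plane openin_topspace by blast
  have "{x. x \<noteq> 0 \<and> proj_class x \<in> proj_class ` (- {0})} = - {0}"
    by auto
  then have "openin proj_plane (proj_class ` (- {0}))"
    by (simp add: openin_proj_plane open_Compl)
  then show "proj_class ` (- {0}) \<subseteq> topspace proj_plane"
    by (rule openin_subset)
qed

definition int_lattice :: "(real^3) set" where
  "int_lattice = {x. \<forall>i. x $ i \<in> \<int>}"

definition conv_body :: "real^3 \<Rightarrow> real \<Rightarrow> (real^3) set" where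
  "conv_body u Q = {x. norm x \<le> 1 \<and> \<bar>x \<bullet> u\<bar> \<le> 1 / Q}"

definition succ_min :: "nat \<Rightarrow> (real^3) set \<Rightarrow> (real^3) set \<Rightarrow> real" where
  "succ_min j C \<Lambda> =
     Inf {r. r > 0 \<and> (\<exists>B. B \<subseteq> (*\<^sub>R) r ` C \<inter> \<Lambda> \<and> independent B \<and> card B = j)}"

definition log_min :: "real^3 \<Rightarrow> nat \<Rightarrow> real \<Rightarrow> real" where
  "log_min u j q = ln (succ_min j (conv_body u (exp q)) int_lattice)"

definition psi_upper :: "real^3 \<Rightarrow> nat \<Rightarrow> ereal" where
  "psi_upper u j = Limsup at_top (\<lambda>q. ereal (log_min u j q / q))"

definition psi_lower :: "real^3 \<Rightarrow> nat \<Rightarrow> ereal" where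
  "psi_lower u j = Liminf at_top (\<lambda>q. ereal (log_min u j q / q))"

end

theory Submission
  imports Defs
begin

text \<open>
  Write \<open>w_k = [[a, b], [c, d]]\<close>. A symmetric matrix \<open>Y\<close> makes \<open>w_k Y\<close> symmetric exactly when it is
  orthogonal to the integer point \<open>z_k = (-c, a - d, b)\<close>, and all the \<open>y_i\<close> built from one \<open>w_k\<close> are of
  this kind. The points \<open>z_k\<close> give the first two minima: \<open>\<parallel>z_k\<parallel>\<close> is comparable to \<open>\<parallel>w_k\<parallel>\<close> and
  \<open>|z_k \<cdot> u|\<close> to \<open>\<parallel>w_k\<parallel> (\<parallel>w_k\<parallel> \<parallel>w_(k+1)\<parallel>) powr (\<delta> - 2)\<close>, while \<open>z_k \<times> z_(k+1)\<close> is a bounded multiple of one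
  of the \<open>y_i\<close>. The \<open>y_i\<close> in turn bound the minima from below: an integer point \<open>z\<close> has \<open>|z \<cdot> y_i| \<ge> 1\<close>
  unless it is orthogonal to \<open>y_i\<close>, and in that case bounded content makes \<open>z \<times> z_k\<close> a multiple of \<open>y_i\<close>
  that is not too small, so that \<open>z\<close> is long and \<open>|z \<cdot> y_(i+1)|\<close> is at least a constant times \<open>|det y_i|\<close>.
  Together with Minkowski's second theorem these bounds determine \<open>L_1\<close>, \<open>L_2\<close> and \<open>L_3\<close> well enough on
  the intervals between consecutive values of \<open>(2 - \<delta>) log \<parallel>w_k w_(k+1)\<parallel>\<close>, and there all extremal quotients
  \<open>L_j(q) / q\<close> are monotone functions of \<open>log \<parallel>w_k\<parallel> / log \<parallel>w_(k+1)\<parallel>\<close>, whose lower limit is \<open>\<sigma>\<close>.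
\<close>

text \<open>Only the quotients \<open>L_j(q) / q\<close> matter, so every estimate is kept up to one
  additive constant, and lattice vectors have to be minimal only up to a bounded factor. Beyond
  giving \<open>\<delta> < 1\<close>, the hypothesis on \<open>\<delta>\<close> enters in one form:
  for large \<open>k\<close>,
  \<open>\<delta> * (\<omega>_k + \<omega>_(k+1)) \<le> \<omega>_k\<close>, where
  \<open>\<omega>_k = log \<parallel>w_k\<parallel>\<close>. It keeps integer points not orthogonal
  to the first \<open>y_i\<close> of a block from competing for the first minimum, which then
  follows the dual points alone. The obstacle is an upper bound for \<open>L_3\<close>: it comes
  only from subtracting lower bounds for \<open>L_1\<close> and \<open>L_2\<close> from
  \<open>q\<close>. These are sharp at certain corners; between two corners only monotonicity is
  available, and this produces the second term of the maximum. Boundedness of \<open>s\<close>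
  serves twice: it keeps the constants uniform along the powers inside a block, and it makes the
  recursion of the continued fractions contracting, so that the ratios of the
  \<open>\<omega>_k\<close> can be compared with them.\<close>

unbundle cross3_syntax

section \<open>Upper and lower limits along a sequence of intervals\<close>

lemma Limsup_ratio_leI:
  fixes f :: "'a \<Rightarrow> real"
  assumes "\<And>e. e > 0 \<Longrightarrow> eventually (\<lambda>q. f q \<le> a + e) F"
  shows "Limsup F (\<lambda>q. ereal (f q)) \<le> ereal a"
  unfolding Limsup_le_iff
proof (intro allI impI)
  fix y assume "ereal a < y"
  then obtain z where z: "ereal a < ereal z" "ereal z < y"
    using ereal_dense2 by blast
  have "eventually (\<lambda>q. f q \<le> a + (z - a)) F"
    using z by (intro assms) simp
  then show "eventually (\<lambda>q. ereal (f q) < y) F"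
  proof eventually_elim
    case (elim q)
    then have "ereal (f q) \<le> ereal z" by simp
    then show ?case using z(2) by (rule le_less_trans)
  qed
qed

lemma Limsup_ratio_geI:
  fixes f :: "'a \<Rightarrow> real"
  assumes "\<And>e. e > 0 \<Longrightarrow> frequently (\<lambda>q. f q \<ge> a - e) F"
  shows "ereal a \<le> Limsup F (\<lambda>q. ereal (f q))"
proof (rule ccontr)
  assume "\<not> ?thesis"
  then have "Limsup F (\<lambda>q. ereal (f q)) < ereal a" by simp
  then obtain z where z: "Limsup F (\<lambda>q. ereal (f q)) < ereal z" "ereal z < ereal a"
    using ereal_dense2 by blast
  have "eventually (\<lambda>q. ereal (f q) < ereal z) F"
    using z(1) by (rule Limsup_lessD)
  then have "eventually (\<lambda>q. \<not> (a - (a - z) \<le> f q)) F"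
    by eventually_elim simp
  moreover have "frequently (\<lambda>q. f q \<ge> a - (a - z)) F"
    using z(2) by (intro assms) simp
  ultimately show False by (simp add: frequently_def)
qed

text \<open>\<open>T\<close> may oscillate, so the tile is found from the least
  \<open>n \<ge> K\<close> with \<open>q < T n\<close>: it is not \<open>K\<close>, and its
  predecessor fails the condition.\<close>

lemma exists_tile:
  fixes T :: "nat \<Rightarrow> real"
  assumes "filterlim T at_top sequentially" "T K \<le> q"
  shows "\<exists>k\<ge>K. T k \<le> q \<and> q \<le> T (Suc k)"
proof -
  have "eventually (\<lambda>n. q < T n) sequentially"
    using assms(1) by (simp add: filterlim_at_top_dense)
  then obtain n0 where "\<forall>n\<ge>n0. q < T n" by (auto simp: eventually_sequentially)
  then have ex: "\<exists>n. n \<ge> K \<and> q < T n" by (meson le_cases order_refl)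
  define n where "n = (LEAST n. n \<ge> K \<and> q < T n)"
  have n: "n \<ge> K" "q < T n" using LeastI_ex[OF ex] by (auto simp: n_def)
  then have "n \<noteq> K" using assms(2) by auto
  then have "n - 1 \<ge> K" "n - 1 < n" using n by auto
  then have "T (n - 1) \<le> q"
    using not_less_Least[of "n - 1" "\<lambda>n. n \<ge> K \<and> q < T n"] unfolding n_def by fastforce
  then show ?thesis using \<open>n - 1 \<ge> K\<close> \<open>n - 1 < n\<close> n
    by (intro exI[of _ "n - 1"]) auto
qed

text \<open>Since \<open>t\<close> eventually stays above \<open>\<sigma> - e\<close> and
  \<open>g\<close> is bounded by \<open>g \<sigma>\<close> to the right of \<open>\<sigma>\<close>,
  continuity gives \<open>g (t j) \<le> g \<sigma> + e / 2\<close>; the constant \<open>C\<close> is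
  lost on division by \<open>q\<close>. The index \<open>j \<ge> k\<close> is left free because the
  later part of a tile may be governed by the ratio with index \<open>k + 1\<close>.\<close>

lemma Limsup_le_along_tiles:
  fixes L g :: "real \<Rightarrow> real" and t T :: "nat \<Rightarrow> real"
  assumes T: "filterlim T at_top sequentially"
    and t_ev: "\<And>e. e > 0 \<Longrightarrow> eventually (\<lambda>k. t k > \<sigma> - e) sequentially"
    and "isCont g \<sigma>" and mono: "\<And>x. x \<ge> \<sigma> \<Longrightarrow> g x \<le> g \<sigma>"
    and up: "\<And>k q. k \<ge> K \<Longrightarrow> T k \<le> q \<Longrightarrow> q \<le> T (Suc k) \<Longrightarrow> \<exists>j\<ge>k. L q \<le> g (t j) * q + C"
  shows "Limsup at_top (\<lambda>q. ereal (L q / q)) \<le> ereal (g \<sigma>)"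
proof (rule Limsup_ratio_leI)
  fix e :: real assume e: "e > 0"
  then obtain d where d: "d > 0" "\<And>x. \<bar>x - \<sigma>\<bar> < d \<Longrightarrow> \<bar>g x - g \<sigma>\<bar> < e / 2"
    using \<open>isCont g \<sigma>\<close> unfolding continuous_at_eps_delta dist_real_def
    by (metis half_gt_zero)
  obtain K1 where K1: "\<And>k. k \<ge> K1 \<Longrightarrow> t k > \<sigma> - d"
    using t_ev[OF d(1)] by (auto simp: eventually_sequentially)
  \<comment> \<open>Beyond \<open>A\<close> the error \<open>C / q\<close> is at most
    \<open>e / 2\<close>.\<close>
  define A where "A = \<bar>C\<bar> * (2 / e) + 1"
  have "0 \<le> \<bar>C\<bar> * (2 / e)" using e by simp
  then have A: "A > 0" unfolding A_def by linarith
  have CA: "\<bar>C\<bar> / q \<le> e / 2" if "q \<ge> A" for q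
  proof -
    have "q > 0" using that A by linarith
    moreover have "\<bar>C\<bar> * (2 / e) \<le> q" using that by (simp add: A_def)
    ultimately show ?thesis using e by (simp add: pos_divide_le_eq mult.commute)
  qed
  show "eventually (\<lambda>q. L q / q \<le> g \<sigma> + e) at_top"
    unfolding eventually_at_top_linorder
  proof (intro exI[of _ "max A (T (max K K1))"] allI impI)
    fix q assume q: "max A (T (max K K1)) \<le> q"
    then obtain k where k: "k \<ge> max K K1" "T k \<le> q" "q \<le> T (Suc k)"
      using exists_tile[OF T] by fastforce
    then obtain j where j: "j \<ge> k" "L q \<le> g (t j) * q + C" using up by fastforce
    have "g (t j) \<le> g \<sigma> + e / 2"
    proof (cases "t j \<ge> \<sigma>")
      case True then show ?thesis using mono[of "t j"] e by simp
    next
      case False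
      then have "\<bar>t j - \<sigma>\<bar> < d" using K1[of j] k j by auto
      then show ?thesis using d(2)[of "t j"] by linarith
    qed
    moreover have qp: "q > 0" using q A by auto
    ultimately have "g (t j) * q \<le> (g \<sigma> + e / 2) * q"
      by (intro mult_right_mono) auto
    then have "L q \<le> (g \<sigma> + e / 2) * q + C"
      using j(2) by simp
    then have "L q / q \<le> (g \<sigma> + e / 2) + C / q" using qp by (simp add: field_simps)
    also have "C / q \<le> \<bar>C\<bar> / q" using qp by (simp add: divide_right_mono)
    also have "\<dots> \<le> e / 2" using CA q by auto
    finally show "L q / q \<le> g \<sigma> + e" by simp
  qed
qed

text \<open>Infinitely many \<open>t k\<close> lie close to \<open>\<sigma>\<close>:
  \<open>t_ev\<close> bounds them from below and \<open>t_freq\<close> from above. At the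
  corresponding \<open>p k\<close> the quotient is close to \<open>g \<sigma>\<close> by
  continuity.\<close>

lemma Limsup_ge_along_seq:
  fixes L g :: "real \<Rightarrow> real" and t :: "nat \<Rightarrow> real"
  assumes t_ev: "\<And>e. e > 0 \<Longrightarrow> eventually (\<lambda>k. t k > \<sigma> - e) sequentially"
    and t_freq: "\<And>e. e > 0 \<Longrightarrow> frequently (\<lambda>k. t k < \<sigma> + e) sequentially"
    and "isCont g \<sigma>" and p: "filterlim p at_top sequentially"
    and lo: "\<And>k. k \<ge> K \<Longrightarrow> L (p k) \<ge> g (t k) * p k - C"
  shows "Limsup at_top (\<lambda>q. ereal (L q / q)) \<ge> ereal (g \<sigma>)"
proof (rule Limsup_ratio_geI)
  fix e :: real assume e: "e > 0"
  then obtain d where d: "d > 0" "\<And>x. \<bar>x - \<sigma>\<bar> < d \<Longrightarrow> \<bar>g x - g \<sigma>\<bar> < e / 2"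
    using \<open>isCont g \<sigma>\<close> unfolding continuous_at_eps_delta dist_real_def
    by (metis half_gt_zero)
  obtain K1 where K1: "\<And>k. k \<ge> K1 \<Longrightarrow> t k > \<sigma> - d"
    using t_ev[OF d(1)] by (auto simp: eventually_sequentially)
  define A where "A = \<bar>C\<bar> * (2 / e) + 1"
  have "0 \<le> \<bar>C\<bar> * (2 / e)" using e by simp
  then have A: "A > 0" unfolding A_def by linarith
  have CA: "\<bar>C\<bar> / q \<le> e / 2" if "q \<ge> A" for q
  proof -
    have "q > 0" using that A by linarith
    moreover have "\<bar>C\<bar> * (2 / e) \<le> q" using that by (simp add: A_def)
    ultimately show ?thesis using e by (simp add: pos_divide_le_eq mult.commute)
  qed
  show "frequently (\<lambda>q. L q / q \<ge> g \<sigma> - e) at_top"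
    unfolding frequently_def
  proof
    assume "eventually (\<lambda>q. \<not> g \<sigma> - e \<le> L q / q) at_top"
    then obtain Q where Q: "\<And>q. q \<ge> Q \<Longrightarrow> \<not> g \<sigma> - e \<le> L q / q"
      by (auto simp: eventually_at_top_linorder)
    have "eventually (\<lambda>k. p k \<ge> max A Q) sequentially"
      using p unfolding filterlim_at_top by blast
    then have "eventually (\<lambda>k. \<not> t k < \<sigma> + d) sequentially"
      using eventually_ge_at_top[of "max K K1"]
    proof eventually_elim
      case (elim k)
      show ?case
      proof
        assume "t k < \<sigma> + d"
        then have "\<bar>t k - \<sigma>\<bar> < d" using K1[of k] elim by auto
        then have "g (t k) \<ge> g \<sigma> - e / 2" using d(2)[of "t k"] by linarith
        moreover have qp: "p k > 0" using elim A by auto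
        ultimately have "(g \<sigma> - e / 2) * p k \<le> g (t k) * p k"
          by (intro mult_right_mono) auto
        then have "L (p k) \<ge> (g \<sigma> - e / 2) * p k - C"
          using lo[of k] elim by simp
        then have "((g \<sigma> - e / 2) * p k - C) / p k \<le> L (p k) / p k"
          using qp by (intro divide_right_mono) auto
        moreover have "((g \<sigma> - e / 2) * p k - C) / p k = (g \<sigma> - e / 2) - C / p k"
          using qp by (simp add: diff_divide_distrib)
        moreover have "C / p k \<le> \<bar>C\<bar> / p k" using qp by (simp add: divide_right_mono)
        moreover have "\<bar>C\<bar> / p k \<le> e / 2" using CA elim by auto
        ultimately have "g \<sigma> - e \<le> L (p k) / p k" by linarith
        then show False using Q elim by auto
      qed
    qed
    then show False using t_freq[OF d(1)] by (simp add: frequently_def)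
  qed
qed

lemma Limsup_along_tiles:
  fixes L g :: "real \<Rightarrow> real" and t T :: "nat \<Rightarrow> real"
  assumes T: "filterlim T at_top sequentially"
    and t_ev: "\<And>e. e > 0 \<Longrightarrow> eventually (\<lambda>k. t k > \<sigma> - e) sequentially"
    and t_freq: "\<And>e. e > 0 \<Longrightarrow> frequently (\<lambda>k. t k < \<sigma> + e) sequentially"
    and "isCont g \<sigma>" and mono: "\<And>x. x \<ge> \<sigma> \<Longrightarrow> g x \<le> g \<sigma>"
    and up: "\<And>k q. k \<ge> K \<Longrightarrow> T k \<le> q \<Longrightarrow> q \<le> T (Suc k) \<Longrightarrow> \<exists>j\<ge>k. L q \<le> g (t j) * q + C"
    and p: "filterlim p at_top sequentially"
    and lo: "\<And>k. k \<ge> K \<Longrightarrow> L (p k) \<ge> g (t k) * p k - C"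
  shows "Limsup at_top (\<lambda>q. ereal (L q / q)) = ereal (g \<sigma>)"
proof (rule antisym)
  show "Limsup at_top (\<lambda>q. ereal (L q / q)) \<le> ereal (g \<sigma>)"
    by (rule Limsup_le_along_tiles[OF T t_ev \<open>isCont g \<sigma>\<close> mono up])
  show "Limsup at_top (\<lambda>q. ereal (L q / q)) \<ge> ereal (g \<sigma>)"
    by (rule Limsup_ge_along_seq[OF t_ev t_freq \<open>isCont g \<sigma>\<close> p lo])
qed

lemma Liminf_along_tiles:
  fixes L g :: "real \<Rightarrow> real" and t T :: "nat \<Rightarrow> real"
  assumes T: "filterlim T at_top sequentially"
    and t_ev: "\<And>e. e > 0 \<Longrightarrow> eventually (\<lambda>k. t k > \<sigma> - e) sequentially"
    and t_freq: "\<And>e. e > 0 \<Longrightarrow> frequently (\<lambda>k. t k < \<sigma> + e) sequentially"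
    and "isCont g \<sigma>" and mono: "\<And>x. x \<ge> \<sigma> \<Longrightarrow> g x \<ge> g \<sigma>"
    and lo: "\<And>k q. k \<ge> K \<Longrightarrow> T k \<le> q \<Longrightarrow> q \<le> T (Suc k) \<Longrightarrow> \<exists>j\<ge>k. L q \<ge> g (t j) * q - C"
    and p: "filterlim p at_top sequentially"
    and up: "\<And>k. k \<ge> K \<Longrightarrow> L (p k) \<le> g (t k) * p k + C"
  shows "Liminf at_top (\<lambda>q. ereal (L q / q)) = ereal (g \<sigma>)"
proof -
  have "Limsup at_top (\<lambda>q. ereal (- L q / q)) = ereal (- g \<sigma>)"
  proof (rule Limsup_along_tiles[where K = K and C = C and g = "\<lambda>x. - g x" and p = p
          and L = "\<lambda>q. - L q", OF T t_ev t_freq])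
    show "isCont (\<lambda>x. - g x) \<sigma>" using \<open>isCont g \<sigma>\<close> by (rule isCont_minus)
    show "\<exists>j\<ge>k. - L q \<le> - g (t j) * q + C" if k: "K \<le> k" "T k \<le> q" "q \<le> T (Suc k)" for k q
    proof -
      obtain j where "j \<ge> k" "L q \<ge> g (t j) * q - C" using lo[OF k] by blast
      then show ?thesis by (intro exI[of _ j]) simp
    qed
    show "- g (t k) * p k - C \<le> - L (p k)" if "K \<le> k" for k
      using up[OF that] by simp
  qed (use mono p in auto)
  then have "Limsup at_top (\<lambda>q. - ereal (L q / q)) = - ereal (g \<sigma>)"
    by simp
  then show ?thesis
    by (simp add: ereal_Limsup_uminus del: uminus_ereal.simps)
qed

section \<open>Exponents of a system with the shape of a Sturmian profile\<close>

text \<open>The left side is the line of slope \<open>a\<close> through \<open>(p, c)\<close>, the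
  right side the ray from the origin through the same point; the sign condition decides which of
  them is higher at \<open>q\<close>. This turns a piecewise linear bound for \<open>L\<close> into
  a bound for \<open>L q / q\<close> by its value at a corner.\<close>

lemma chord_le:
  fixes a c p q :: real
  assumes "0 < p" "(q - p) * (a * p - c) \<le> 0"
  shows "a * (q - p) + c \<le> c / p * q"
  using assms by (simp add: field_simps)

lemma chord_ge:
  fixes a c p q :: real
  assumes "0 < p" "(q - p) * (a * p - c) \<ge> 0"
  shows "a * (q - p) + c \<ge> c / p * q"
  using assms by (simp add: field_simps)

text \<open>Here \<open>\<omega> k\<close> stands for \<open>log \<parallel>w_k\<parallel>\<close> and \<open>real l * \<omega> (k + 1) + \<omega> k\<close> for the logarithm of the norm of
  \<open>w_(k+1)^l w_k\<close>; everything is only required up to the additive constant \<open>C\<close>.\<close>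
locale sturmian_profile =
  fixes L1 L2 L3 :: "real \<Rightarrow> real" and \<omega> :: "nat \<Rightarrow> real" and n :: "nat \<Rightarrow> nat"
    and \<delta> C \<sigma> :: real and K :: nat
  assumes C: "C \<ge> 0" and \<delta>: "0 \<le> \<delta>" "\<delta> < 1" and \<sigma>: "0 < \<sigma>"
    and \<omega>_lim: "filterlim \<omega> at_top sequentially"
    and \<omega>_pos: "\<And>k. k \<ge> K \<Longrightarrow> \<omega> k > 0"
    and \<omega>_mono: "\<And>k. k \<ge> K \<Longrightarrow> \<omega> k \<le> \<omega> (Suc k)"
    and \<omega>_rec: "\<And>k. k \<ge> K \<Longrightarrow> \<bar>\<omega> (k + 2) - (n (k + 2) * \<omega> (k + 1) + \<omega> k)\<bar> \<le> C"
    and n_pos: "\<And>k. k \<ge> K \<Longrightarrow> n k \<ge> 1"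
    and \<delta>_X: "\<And>k. k \<ge> K \<Longrightarrow> \<delta> * (\<omega> k + \<omega> (Suc k)) \<le> \<omega> k"
    and t_ev: "\<And>e. e > 0 \<Longrightarrow> eventually (\<lambda>k. \<omega> k / \<omega> (Suc k) > \<sigma> - e) sequentially"
    and t_freq: "\<And>e. e > 0 \<Longrightarrow> frequently (\<lambda>k. \<omega> k / \<omega> (Suc k) < \<sigma> + e) sequentially"
    and L_ord: "\<And>q. q \<ge> 0 \<Longrightarrow> L1 q \<le> L2 q" "\<And>q. q \<ge> 0 \<Longrightarrow> L2 q \<le> L3 q"
    and L_sum: "\<And>q. q \<ge> 0 \<Longrightarrow> \<bar>L1 q + L2 q + L3 q - q\<bar> \<le> C"
    and L2_mono: "\<And>p q. 0 \<le> p \<Longrightarrow> p \<le> q \<Longrightarrow> L2 p \<le> L2 q"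
    and L3_mono: "\<And>p q. 0 \<le> p \<Longrightarrow> p \<le> q \<Longrightarrow> L3 p \<le> L3 q"
    and L1_le: "\<And>k q. k \<ge> K \<Longrightarrow> q \<ge> 0 \<Longrightarrow>
      L1 q \<le> max (\<omega> k) (q + \<omega> k - (2 - \<delta>) * (\<omega> k + \<omega> (Suc k))) + C"
    and L2_le: "\<And>k q. k \<ge> K \<Longrightarrow> q \<ge> 0 \<Longrightarrow>
      L2 q \<le> max (max (\<omega> k) (q + \<omega> k - (2 - \<delta>) * (\<omega> k + \<omega> (Suc k))))
        (max (\<omega> (k + 1)) (q + \<omega> (k + 1) - (2 - \<delta>) * (\<omega> (k + 1) + \<omega> (k + 2)))) + C"
    and L1_ge: "\<And>k q. k \<ge> K \<Longrightarrow> q \<ge> 0 \<Longrightarrow>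
      min (min ((1 - \<delta>) * (\<omega> k + \<omega> (Suc k))) (q - (\<omega> k + \<omega> (Suc k))))
        (min (\<omega> (k + 1)) (max (\<omega> k) (q + \<omega> k - (2 - \<delta>) * (\<omega> k + \<omega> (Suc k))))) - C \<le> L1 q"
    and L2_ge1: "\<And>k q l x. k \<ge> K \<Longrightarrow> q \<ge> 0 \<Longrightarrow> 1 \<le> l \<Longrightarrow> l \<le> n (k + 2) \<Longrightarrow>
      x = real l * \<omega> (k + 1) + \<omega> k \<Longrightarrow>
      min ((1 - \<delta>) * x) (min (q - x) (\<delta> * x + q - x - \<omega> (k + 1))) - C \<le> L2 q"
    and L2_ge2: "\<And>k q l x. k \<ge> K \<Longrightarrow> q \<ge> 0 \<Longrightarrow> 1 \<le> l \<Longrightarrow> l \<le> n (k + 2) \<Longrightarrow>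
      x = real l * \<omega> (k + 1) + \<omega> k \<Longrightarrow>
      min x (min (q - x - \<omega> (k + 1)) ((1 - \<delta>) * (x + \<omega> (k + 1)))) - C \<le> L2 q"
    and L3_ge: "\<And>k q. k \<ge> K \<Longrightarrow> q \<ge> 0 \<Longrightarrow>
      min ((1 - \<delta>) * (\<omega> k + \<omega> (Suc k))) (q - (\<omega> k + \<omega> (Suc k))) - C \<le> L3 q"
begin

text \<open>\<open>X k\<close> is the logarithmic size of a product of two consecutive matrices, and
  \<open>T k\<close> is the parameter at which the trajectory of the \<open>k\<close>-th dual point
  starts to grow with slope 1.\<close>

definition X :: "nat \<Rightarrow> real" where "X k = \<omega> k + \<omega> (Suc k)"
definition T :: "nat \<Rightarrow> real" where "T k = (2 - \<delta>) * X k"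
definition t :: "nat \<Rightarrow> real" where "t k = \<omega> k / \<omega> (Suc k)"

text \<open>The place where the trajectory of the \<open>k\<close>-th dual point meets that of the next one.\<close>
definition Q :: "nat \<Rightarrow> real" where "Q k = T k + \<omega> (Suc k) - \<omega> k"

lemma \<omega>_pos_Suc: "k \<ge> K \<Longrightarrow> \<omega> (Suc k) > 0"
  using \<omega>_pos[of "Suc k"] by simp

lemma X_pos: "k \<ge> K \<Longrightarrow> X k > 0"
  using \<omega>_pos[of k] \<omega>_pos_Suc[of k] by (simp add: X_def)

lemma T_ge_X: "k \<ge> K \<Longrightarrow> X k \<le> T k"
  using X_pos[of k] \<delta> by (simp add: T_def)

lemma T_pos: "k \<ge> K \<Longrightarrow> T k > 0"
  using X_pos[of k] T_ge_X[of k] by simp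

lemma \<omega>_le_T: "k \<ge> K \<Longrightarrow> \<omega> k \<le> T k" "k \<ge> K \<Longrightarrow> \<omega> (Suc k) \<le> T k"
  using T_ge_X[of k] \<omega>_pos[of k] \<omega>_pos_Suc[of k] by (auto simp: X_def)

lemma X_mono: "k \<ge> K \<Longrightarrow> X k \<le> X (Suc k)"
  using \<omega>_mono[of k] \<omega>_mono[of "Suc k"] by (simp add: X_def)

lemma T_mono: "k \<ge> K \<Longrightarrow> T k \<le> T (Suc k)"
  using X_mono[of k] \<delta> by (simp add: T_def mult_left_mono)

lemma Q_pos: "k \<ge> K \<Longrightarrow> Q k > 0"
  using T_pos[of k] \<omega>_mono[of k] by (simp add: Q_def)

lemma filterlim_ge_\<omega>:
  assumes "\<And>k. k \<ge> K \<Longrightarrow> \<omega> k \<le> p k"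
  shows "filterlim p at_top sequentially"
  by (rule filterlim_at_top_mono[OF \<omega>_lim])
    (use assms in \<open>auto simp: eventually_sequentially\<close>)

lemma T_lim: "filterlim T at_top sequentially"
  by (rule filterlim_ge_\<omega>) (rule \<omega>_le_T)

lemma t_limits:
  "e > 0 \<Longrightarrow> eventually (\<lambda>k. t k > \<sigma> - e) sequentially"
  "e > 0 \<Longrightarrow> frequently (\<lambda>k. t k < \<sigma> + e) sequentially"
  using t_ev t_freq by (simp_all add: t_def)

lemma \<omega>_eq: "k \<ge> K \<Longrightarrow> \<omega> k = t k * \<omega> (Suc k)"
  using \<omega>_pos_Suc[of k] by (simp add: t_def)

lemma t_pos: "k \<ge> K \<Longrightarrow> t k > 0"
  using \<omega>_pos_Suc[of k] \<omega>_pos[of k] by (simp add: t_def)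

section \<open>The first minimum on a tile and its two exponents\<close>

lemma L1_upper:
  assumes "k \<ge> K" "T k \<le> q" "q \<le> T (Suc k)"
  shows "L1 q \<le> \<omega> k + q - T k + C" "L1 q \<le> \<omega> (Suc k) + C"
proof -
  have "q \<ge> 0" using T_pos[OF assms(1)] assms(2) by simp
  then show "L1 q \<le> \<omega> k + q - T k + C" "L1 q \<le> \<omega> (Suc k) + C"
    using L1_le[of k q] L1_le[of "Suc k" q] assms unfolding T_def X_def by auto
qed

text \<open>The bound \<open>L1_ge\<close> is a minimum of four terms. Past \<open>T k\<close>, the
  condition \<open>\<delta>_X\<close> makes the first two at least \<open>\<omega> (Suc k)\<close>,
  so only the trajectory and \<open>\<omega> (Suc k)\<close> remain.\<close>

lemma L1_lower:
  assumes "k \<ge> K" "T k \<le> q"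
  shows "L1 q \<ge> min (\<omega> (Suc k)) (\<omega> k + q - T k) - C"
proof -
  have q: "q \<ge> 0" using T_pos[OF assms(1)] assms(2) by simp
  have "(1 - \<delta>) * X k \<ge> \<omega> (Suc k)"
    using \<delta>_X[OF assms(1)] by (simp add: X_def algebra_simps)
  moreover have "q - X k \<ge> (1 - \<delta>) * X k"
    using assms(2) by (simp add: T_def algebra_simps)
  ultimately show ?thesis
    using L1_ge[OF assms(1) q] unfolding X_def T_def by (auto simp: algebra_simps)
qed

lemma Q_ratio: "k \<ge> K \<Longrightarrow> \<omega> (Suc k) / Q k = 1 / ((1 - \<delta>) * (1 + t k) + 2)"
  using \<omega>_eq[of k] \<omega>_pos_Suc[of k]
proof -
  assume k: "k \<ge> K"
  have "Q k = \<omega> (Suc k) * ((1 - \<delta>) * (1 + t k) + 2)"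
    unfolding Q_def T_def X_def by (subst (1 2) \<omega>_eq[OF k]) (simp add: algebra_simps)
  then show ?thesis using \<omega>_pos_Suc[OF k] by simp
qed

lemma T_ratio: "k \<ge> K \<Longrightarrow> \<omega> k / T k = t k / ((2 - \<delta>) * (1 + t k))"
proof -
  assume k: "k \<ge> K"
  have "T k = \<omega> (Suc k) * ((2 - \<delta>) * (1 + t k))"
    unfolding T_def X_def by (subst \<omega>_eq[OF k]) (simp add: algebra_simps)
  then show ?thesis using \<omega>_pos_Suc[OF k] \<omega>_eq[OF k] by simp
qed

text \<open>Up to a constant, \<open>L1\<close> rises on a tile with slope 1 from
  \<open>\<omega> k\<close> at \<open>T k\<close> to \<open>\<omega> (Suc k)\<close> at
  \<open>Q k\<close> and then stays constant, so the quotient peaks at the corner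
  \<open>Q k\<close>.\<close>

theorem limsup_L1:
  "Limsup at_top (\<lambda>q. ereal (L1 q / q)) = ereal (1 / ((1 - \<delta>) * (1 + \<sigma>) + 2))"
proof (rule Limsup_along_tiles[where t = t and g = "\<lambda>x. 1 / ((1 - \<delta>) * (1 + x) + 2)" and K = K
      and C = C and p = Q, OF T_lim t_limits])
  have pos: "(1 - \<delta>) * (1 + x) + 2 > 0" if "x \<ge> 0" for x
    using that \<delta> by (intro add_nonneg_pos mult_nonneg_nonneg) auto
  show "isCont (\<lambda>x. 1 / ((1 - \<delta>) * (1 + x) + 2)) \<sigma>"
    using pos[of \<sigma>] \<sigma> by (intro continuous_intros) auto
  show "1 / ((1 - \<delta>) * (1 + x) + 2) \<le> 1 / ((1 - \<delta>) * (1 + \<sigma>) + 2)" if "x \<ge> \<sigma>" for x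
    using pos[of x] pos[of \<sigma>] \<sigma> that \<delta>
    by (intro divide_left_mono add_mono mult_left_mono mult_pos_pos) auto
  show "\<exists>j\<ge>k. L1 q \<le> 1 / ((1 - \<delta>) * (1 + t j) + 2) * q + C"
    if q: "k \<ge> K" "T k \<le> q" "q \<le> T (Suc k)" for k q
  proof (intro exI[of _ k] conjI)
    have le: "\<omega> (Suc k) \<le> Q k" using \<omega>_le_T(1)[OF q(1)] by (simp add: Q_def)
    have "min (\<omega> k + q - T k) (\<omega> (Suc k)) \<le> \<omega> (Suc k) / Q k * q"
    proof (cases "q \<le> Q k")
      case True
      have "1 * (q - Q k) + \<omega> (Suc k) \<le> \<omega> (Suc k) / Q k * q"
        using True le by (intro chord_le Q_pos q(1)) (auto simp: mult_le_0_iff)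
      then show ?thesis by (simp add: Q_def)
    next
      case False
      have "0 * (q - Q k) + \<omega> (Suc k) \<le> \<omega> (Suc k) / Q k * q"
        using False \<omega>_pos_Suc[OF q(1)] by (intro chord_le Q_pos q(1)) (auto simp: mult_le_0_iff)
      then show ?thesis by simp
    qed
    then show "L1 q \<le> 1 / ((1 - \<delta>) * (1 + t k) + 2) * q + C"
      using L1_upper[OF q] unfolding Q_ratio[OF q(1)] by linarith
  qed simp
  show "filterlim Q at_top sequentially"
    using \<omega>_le_T \<omega>_mono by (intro filterlim_ge_\<omega>) (force simp: Q_def)
  show "1 / ((1 - \<delta>) * (1 + t k) + 2) * Q k - C \<le> L1 (Q k)" if k: "k \<ge> K" for k
    using L1_lower[OF k, of "Q k"] Q_pos[OF k] \<omega>_mono[OF k] Q_ratio[OF k, symmetric]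
    by (simp add: Q_def)
qed

text \<open>The quotient \<open>L1 q / q\<close> is smallest where the slope changes from 0 to 1,
  that is, at the ends of the tiles.\<close>

theorem liminf_L1:
  "Liminf at_top (\<lambda>q. ereal (L1 q / q)) = ereal (\<sigma> / ((2 - \<delta>) * (1 + \<sigma>)))"
proof (rule Liminf_along_tiles[where t = t and g = "\<lambda>x. x / ((2 - \<delta>) * (1 + x))" and K = K
      and C = C and p = T, OF T_lim t_limits])
  show "isCont (\<lambda>x. x / ((2 - \<delta>) * (1 + x))) \<sigma>"
    using \<sigma> \<delta> by (intro continuous_intros) auto
  show "\<sigma> / ((2 - \<delta>) * (1 + \<sigma>)) \<le> x / ((2 - \<delta>) * (1 + x))" if "x \<ge> \<sigma>" for x
  proof -
    have "\<sigma> / (1 + \<sigma>) \<le> x / (1 + x)" using that \<sigma> by (simp add: field_simps)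
    then have "\<sigma> / (1 + \<sigma>) / (2 - \<delta>) \<le> x / (1 + x) / (2 - \<delta>)"
      using \<delta> by (intro divide_right_mono) auto
    then show ?thesis by (simp add: mult.commute)
  qed
  show "\<exists>j\<ge>k. L1 q \<ge> t j / ((2 - \<delta>) * (1 + t j)) * q - C"
    if q: "k \<ge> K" "T k \<le> q" "q \<le> T (Suc k)" for k q
  proof (cases "q \<le> Q k")
    case True
    have "\<omega> k / T k * q \<le> 1 * (q - T k) + \<omega> k"
      using q(2) \<omega>_le_T[OF q(1)] by (intro chord_ge T_pos q(1)) auto
    also have "\<dots> \<le> L1 q + C"
      using L1_lower[OF q(1,2)] True by (simp add: Q_def)
    finally have "L1 q \<ge> \<omega> k / T k * q - C" by simp
    then show ?thesis unfolding T_ratio[OF q(1)] by blast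
  next
    case False
    have k: "Suc k \<ge> K" using q(1) by simp
    \<comment> \<open>The flat piece right of \<open>Q k\<close> has its least quotient at the right
      end of the tile, hence the index \<open>Suc k\<close>.\<close>
    have "\<omega> (Suc k) / T (Suc k) * q \<le> 0 * (q - T (Suc k)) + \<omega> (Suc k)"
      using q(3) \<omega>_pos[OF k] by (intro chord_ge T_pos k) (auto simp: mult_le_0_iff)
    also have "\<dots> \<le> L1 q + C"
      using L1_lower[OF q(1,2)] False by (simp add: Q_def)
    finally have "L1 q \<ge> \<omega> (Suc k) / T (Suc k) * q - C" by simp
    then show ?thesis unfolding T_ratio[OF k] by (intro exI[of _ "Suc k"]) auto
  qed
  show "filterlim T at_top sequentially" by (rule T_lim)
  show "L1 (T k) \<le> t k / ((2 - \<delta>) * (1 + t k)) * T k + C" if k: "k \<ge> K" for k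
    using L1_upper(1)[OF k order_refl T_mono[OF k]] T_pos[OF k] T_ratio[OF k, symmetric]
    by simp
qed

section \<open>Bounds for the third minimum from the points inside a block\<close>

lemma block_bounds:
  assumes k: "k \<ge> K" and l: "1 \<le> l" "l \<le> n (k + 2)" and x: "x = real l * \<omega> (k + 1) + \<omega> k"
  shows "X k \<le> x" "x \<le> \<omega> (k + 2) + C" "\<delta> * x \<le> \<omega> (k + 1) + C"
    "\<delta> * (x + \<omega> (k + 1)) \<le> \<omega> (k + 1) + C"
proof -
  have "1 * \<omega> (k + 1) \<le> real l * \<omega> (k + 1)"
    using l(1) \<omega>_pos_Suc[OF k] by (intro mult_right_mono) auto
  then show "X k \<le> x" by (simp add: X_def x)
  have "real l * \<omega> (k + 1) \<le> real (n (k + 2)) * \<omega> (k + 1)"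
    using l(2) \<omega>_pos_Suc[OF k] by (intro mult_right_mono) auto
  then show le: "x \<le> \<omega> (k + 2) + C" using \<omega>_rec[OF k] by (simp add: x abs_le_iff)
  have "\<delta> * C \<le> C" using \<delta> C by (simp add: mult_left_le_one_le)
  moreover have "\<delta> * (x + \<omega> (k + 1)) \<le> \<delta> * (\<omega> (k + 2) + C + \<omega> (k + 1))"
    using le \<delta> by (intro mult_left_mono) auto
  \<comment> \<open>Here \<open>x + \<omega> (k + 1)\<close> is at most
    \<open>X (Suc k) + C\<close>, and \<open>\<delta>_X\<close> is applied at
    \<open>Suc k\<close>.\<close>
  ultimately show *: "\<delta> * (x + \<omega> (k + 1)) \<le> \<omega> (k + 1) + C"
    using \<delta>_X[of "Suc k"] k by (simp add: algebra_simps)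
  have "\<delta> * x \<le> \<delta> * (x + \<omega> (k + 1))"
    using \<delta> \<omega>_pos_Suc[OF k] by (intro mult_left_mono) auto
  with * show "\<delta> * x \<le> \<omega> (k + 1) + C" by linarith
qed

lemma L1_ge_next:
  assumes "k \<ge> K" "Q k \<le> q"
  shows "L1 q \<ge> \<omega> (Suc k) - C"
  using L1_lower[of k q] assms \<omega>_mono[of k] by (simp add: Q_def)

text \<open>Places the first breakpoint of \<open>L3_block\<close> to the right of
  \<open>Q k\<close>, where \<open>L1\<close> has already reached
  \<open>\<omega> (Suc k)\<close>.\<close>

lemma Q_le_block:
  assumes k: "k \<ge> K" and "X k \<le> x"
  shows "Q k \<le> \<omega> (Suc k) + 2 * (1 - \<delta>) * x"
proof -
  have "2 * (1 - \<delta>) * X k \<le> 2 * (1 - \<delta>) * x"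
    using assms \<delta> by (intro mult_left_mono) auto
  moreover have "\<delta> * X k \<le> \<omega> k" using \<delta>_X[OF k] by (simp add: X_def)
  ultimately show ?thesis by (simp add: Q_def T_def algebra_simps)
qed

text \<open>At \<open>p\<close> and \<open>p'\<close> the two lower bounds for \<open>L2\<close>
  reach \<open>(1 - \<delta>) * x\<close> and \<open>x\<close>. Subtracting these and
  \<open>L1 \<ge> \<omega> (k + 1)\<close> from the sum \<open>q\<close> bounds \<open>L3\<close> to
  the right of each breakpoint; to the left, monotonicity of \<open>L3\<close> carries over the
  value at the breakpoint. The error \<open>4 * C\<close> is \<open>C\<close> from the sum,
  \<open>C\<close> from \<open>L1\<close> and \<open>2 * C\<close> from \<open>L2\<close>.\<close>

lemma L3_block:
  assumes k: "k \<ge> K" and l: "1 \<le> l" "l \<le> n (k + 2)" and x: "x = real l * \<omega> (k + 1) + \<omega> k"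
    and q: "q \<ge> 0"
  shows "q \<le> \<omega> (k + 1) + 2 * (1 - \<delta>) * x \<Longrightarrow> L3 q \<le> (1 - \<delta>) * x + 4 * C"
    and "q \<ge> \<omega> (k + 1) + 2 * (1 - \<delta>) * x \<Longrightarrow> L3 q \<le> q - \<omega> (k + 1) - (1 - \<delta>) * x + 4 * C"
    and "q \<le> \<omega> (k + 1) + 2 * x \<Longrightarrow> L3 q \<le> x + 4 * C"
    and "q \<ge> \<omega> (k + 1) + 2 * x \<Longrightarrow> L3 q \<le> q - \<omega> (k + 1) - x + 4 * C"
proof -
  note bb = block_bounds[OF k l x]
  define p where "p = \<omega> (k + 1) + 2 * (1 - \<delta>) * x"
  define p' where "p' = \<omega> (k + 1) + 2 * x"
  have x0: "x > 0" using bb(1) X_pos[OF k] by simp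
  have Qp: "Q k \<le> p" using Q_le_block[OF k bb(1)] by (simp add: p_def)
  have pp': "p \<le> p'" using x0 \<delta> by (simp add: p_def p'_def)
  have p0: "p \<ge> 0" using Qp Q_pos[OF k] by simp
  have p'0: "p' \<ge> 0" using p0 pp' by simp
  have "p - x = (1 - \<delta>) * x + (\<omega> (k + 1) - \<delta> * x)" "\<delta> * x + p - x - \<omega> (k + 1) = (1 - \<delta>) * x"
    by (simp_all add: p_def algebra_simps)
  then have L2p: "L2 p \<ge> (1 - \<delta>) * x - 2 * C"
    using L2_ge1[OF k p0 l x] bb(3) C by (auto simp: min_def split: if_splits)
  have "(1 - \<delta>) * (x + \<omega> (k + 1)) = x + \<omega> (k + 1) - \<delta> * (x + \<omega> (k + 1))"
    "p' - x - \<omega> (k + 1) = x"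
    by (simp_all add: p'_def algebra_simps)
  then have L2p': "L2 p' \<ge> x - 2 * C"
    using L2_ge2[OF k p'0 l x] bb(4) C by (auto simp: min_def split: if_splits)
  have L1: "L1 r \<ge> \<omega> (k + 1) - C" if "r \<ge> p" for r
    using L1_ge_next[OF k, of r] Qp that by simp
  have L3: "L3 r \<le> r - \<omega> (k + 1) - (1 - \<delta>) * x + 4 * C" if "r \<ge> p" for r
    using L1[OF that] L2_mono[OF p0 that] L2p L_sum[of r] p0 that by (simp add: abs_le_iff)
  have L3': "L3 r \<le> r - \<omega> (k + 1) - x + 4 * C" if "r \<ge> p'" for r
    using L1[of r] L2_mono[OF p'0 that] L2p' L_sum[of r] p'0 that pp' by (simp add: abs_le_iff)
  show "q \<le> \<omega> (k + 1) + 2 * (1 - \<delta>) * x \<Longrightarrow> L3 q \<le> (1 - \<delta>) * x + 4 * C"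
    using L3_mono[OF q, of p] L3[of p] by (simp add: p_def algebra_simps)
  show "q \<ge> \<omega> (k + 1) + 2 * (1 - \<delta>) * x \<Longrightarrow> L3 q \<le> q - \<omega> (k + 1) - (1 - \<delta>) * x + 4 * C"
    using L3[of q] by (simp add: p_def)
  show "q \<le> \<omega> (k + 1) + 2 * x \<Longrightarrow> L3 q \<le> x + 4 * C"
    using L3_mono[OF q, of p'] L3'[of p'] by (simp add: p'_def)
  show "q \<ge> \<omega> (k + 1) + 2 * x \<Longrightarrow> L3 q \<le> q - \<omega> (k + 1) - x + 4 * C"
    using L3'[of q] by (simp add: p'_def)
qed

text \<open>Up to constants, \<open>L2 \<le> (q - L1) / 2\<close> because
  \<open>L2 \<le> L3\<close>, while the dual points give a flat bound. The two meet at
  \<open>2 * \<omega> (Suc k) + \<omega> k\<close>, where the end of the preceding block shows that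
  the value is reached. Starting at \<open>Suc K\<close> provides that preceding block.\<close>

theorem limsup_L2:
  "Limsup at_top (\<lambda>q. ereal (L2 q / q)) = ereal (1 / (2 + \<sigma>))"
proof (rule Limsup_along_tiles[where t = t and g = "\<lambda>x. 1 / (2 + x)" and K = "Suc K"
      and C = "4 * C" and p = "\<lambda>k. 2 * \<omega> (Suc k) + \<omega> k", OF T_lim t_limits])
  have ratio: "\<omega> (Suc k) / (2 * \<omega> (Suc k) + \<omega> k) = 1 / (2 + t k)" if k: "k \<ge> K" for k
  proof -
    have "2 * \<omega> (Suc k) + \<omega> k = \<omega> (Suc k) * (2 + t k)"
      by (subst \<omega>_eq[OF k]) (simp add: algebra_simps)
    then show ?thesis using \<omega>_pos_Suc[OF k] by simp
  qed
  have bound: "min (\<omega> (Suc k)) ((q - \<omega> k) / 2) \<le> 1 / (2 + t k) * q" if k: "k \<ge> K" for k q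
  proof -
    define p where "p = 2 * \<omega> (Suc k) + \<omega> k"
    have p: "p > 0" "\<omega> (Suc k) \<le> 1 / 2 * p"
      using \<omega>_pos_Suc[OF k] \<omega>_pos[OF k] by (auto simp: p_def)
    have "min (\<omega> (Suc k)) ((q - \<omega> k) / 2) \<le> \<omega> (Suc k) / p * q"
    proof (cases "q \<le> p")
      case True
      have "1 / 2 * (q - p) + \<omega> (Suc k) \<le> \<omega> (Suc k) / p * q"
        using True p by (intro chord_le) (auto simp: mult_le_0_iff)
      then show ?thesis by (simp add: p_def field_simps min_le_iff_disj)
    next
      case False
      have "0 * (q - p) + \<omega> (Suc k) \<le> \<omega> (Suc k) / p * q"
        using False p \<omega>_pos_Suc[OF k] by (intro chord_le) (auto simp: mult_le_0_iff)
      then show ?thesis by simp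
    qed
    then show ?thesis using ratio[OF k] by (simp add: p_def)
  qed
  show "isCont (\<lambda>x. 1 / (2 + x)) \<sigma>"
    using \<sigma> by (intro continuous_intros) auto
  show "1 / (2 + x) \<le> 1 / (2 + \<sigma>)" if "x \<ge> \<sigma>" for x
    using that \<sigma> by (intro divide_left_mono) auto
  show "\<exists>j\<ge>k. L2 q \<le> 1 / (2 + t j) * q + 4 * C"
    if q': "k \<ge> Suc K" "T k \<le> q" "q \<le> T (Suc k)" for k q
  proof -
    have q: "k \<ge> K" "T k \<le> q" "q \<le> T (Suc k)" using q' by auto
    have q0: "q \<ge> 0" using T_pos[OF q(1)] q(2) by simp
    have half: "L2 q \<le> (q - L1 q) / 2 + C / 2"
      using L_ord[OF q0] L_sum[OF q0] by (simp add: abs_le_iff field_simps)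
    show ?thesis
    proof (cases "q \<le> Q k")
      case True
      have "L2 q \<le> \<omega> (Suc k) + C"
        using L2_le[OF q(1) q0] q True \<omega>_mono[OF q(1)] unfolding Q_def T_def X_def by auto
      moreover have "L1 q \<ge> \<omega> k - C"
        using L1_lower[OF q(1,2)] q(2) \<omega>_mono[OF q(1)] by linarith
      then have "L2 q \<le> (q - \<omega> k) / 2 + C"
        using half by (simp add: field_simps)
      ultimately have "L2 q \<le> 1 / (2 + t k) * q + C"
        using bound[OF q(1), of q] by linarith
      then show ?thesis using C by (intro exI[of _ k]) auto
    next
      case False
      have k: "Suc k \<ge> K" using q(1) by simp
      \<comment> \<open>After \<open>Q k\<close> the first minimum has reached
        \<open>\<omega> (Suc k)\<close>, so the relevant corner is the one with all indices raised
        by one.\<close>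
      have "L2 q \<le> \<omega> (Suc (Suc k)) + C"
        using L2_le[OF k q0] q T_mono[OF k] \<omega>_mono[OF k] unfolding T_def X_def by auto
      moreover have "L1 q \<ge> \<omega> (Suc k) - C"
        using L1_ge_next[OF q(1)] False by simp
      then have "L2 q \<le> (q - \<omega> (Suc k)) / 2 + C"
        using half by (simp add: field_simps)
      ultimately have "L2 q \<le> 1 / (2 + t (Suc k)) * q + C"
        using bound[OF k, of q] by linarith
      then show ?thesis using C by (intro exI[of _ "Suc k"]) auto
    qed
  qed
  show "filterlim (\<lambda>k. 2 * \<omega> (Suc k) + \<omega> k) at_top sequentially"
    using \<omega>_pos_Suc by (intro filterlim_ge_\<omega>) (simp add: less_imp_le)
  show "1 / (2 + t k) * (2 * \<omega> (Suc k) + \<omega> k) - 4 * C \<le> L2 (2 * \<omega> (Suc k) + \<omega> k)"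
    if k': "k \<ge> Suc K" for k
  proof -
    obtain m where k: "k = Suc m" and m: "m \<ge> K" using Suc_le_D[OF k'] k' by auto
    define x where "x = real (n (m + 2)) * \<omega> (m + 1) + \<omega> m"
    define q where "q = 2 * \<omega> (Suc k) + \<omega> k"
    have q: "q > 0" using \<omega>_pos_Suc[of k] \<omega>_pos[of k] m by (simp add: q_def k)
    have l: "1 \<le> n (m + 2)" using n_pos m by simp
    have "\<bar>\<omega> (m + 2) - x\<bar> \<le> C" using \<omega>_rec[OF m] by (simp add: x_def)
    moreover have "(1 - \<delta>) * (x + \<omega> (m + 1)) \<ge> x - C"
      using block_bounds(4)[OF m l order_refl x_def] by (simp add: algebra_simps)
    moreover have "q = 2 * \<omega> (m + 2) + \<omega> (m + 1)" by (simp add: q_def k)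
    ultimately have "L2 q \<ge> \<omega> (m + 2) - 3 * C"
      using L2_ge2[OF m less_imp_le[OF q] l order_refl x_def] C by (auto simp: abs_le_iff)
    moreover have "1 / (2 + t k) = \<omega> (Suc k) / q" using ratio[of k] m by (simp add: q_def k)
    then have "1 / (2 + t k) * q = \<omega> (Suc k)" using q by simp
    ultimately show ?thesis using C unfolding q_def[symmetric] by (simp add: k)
  qed
qed

text \<open>The quotient is smallest at the corner \<open>p k\<close>, the case \<open>l = 1\<close>
  of the first breakpoint in \<open>L3_block\<close>: before it \<open>L3\<close> is at least
  \<open>(1 - \<delta>) * X k\<close>, after it at least half of \<open>q - L1\<close>, up to
  constants.\<close>

theorem liminf_L3:
  "Liminf at_top (\<lambda>q. ereal (L3 q / q)) =
    ereal ((1 - \<delta>) * (1 + \<sigma>) / (1 + 2 * (1 - \<delta>) * (1 + \<sigma>)))"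
proof (rule Liminf_along_tiles[where t = t and K = K and C = "4 * C"
      and g = "\<lambda>x. (1 - \<delta>) * (1 + x) / (1 + 2 * (1 - \<delta>) * (1 + x))"
      and p = "\<lambda>k. \<omega> (Suc k) + 2 * (1 - \<delta>) * X k", OF T_lim t_limits])
  define p where "p = (\<lambda>k. \<omega> (Suc k) + 2 * (1 - \<delta>) * X k)"
  have p: "p k > 0" "(1 - \<delta>) * X k \<le> 1 / 2 * p k" if "k \<ge> K" for k
  proof -
    have "0 \<le> (1 - \<delta>) * X k" using X_pos[OF that] \<delta> by simp
    moreover have "p k = \<omega> (Suc k) + 2 * ((1 - \<delta>) * X k)" by (simp add: p_def)
    ultimately show "p k > 0" "(1 - \<delta>) * X k \<le> 1 / 2 * p k"
      using \<omega>_pos_Suc[OF that] by auto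
  qed
  have ratio: "(1 - \<delta>) * X k / p k = (1 - \<delta>) * (1 + t k) / (1 + 2 * (1 - \<delta>) * (1 + t k))"
    if k: "k \<ge> K" for k
  proof -
    have X: "X k = \<omega> (Suc k) * (1 + t k)"
      unfolding X_def by (subst \<omega>_eq[OF k]) (simp add: algebra_simps)
    have "p k = \<omega> (Suc k) * (1 + 2 * (1 - \<delta>) * (1 + t k))"
      by (simp add: p_def X algebra_simps)
    then have "(1 - \<delta>) * X k / p k =
        (\<omega> (Suc k) * ((1 - \<delta>) * (1 + t k))) / (\<omega> (Suc k) * (1 + 2 * (1 - \<delta>) * (1 + t k)))"
      by (simp add: X)
    then show ?thesis using \<omega>_pos_Suc[OF k] by (metis less_irrefl mult_divide_mult_cancel_left)
  qed
  have pos: "1 + 2 * (1 - \<delta>) * (1 + x) > 0" if "x \<ge> 0" for x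
    using that \<delta> by (intro add_pos_nonneg mult_nonneg_nonneg) auto
  show "isCont (\<lambda>x. (1 - \<delta>) * (1 + x) / (1 + 2 * (1 - \<delta>) * (1 + x))) \<sigma>"
    using pos[of \<sigma>] \<sigma> by (intro continuous_intros) auto
  show "(1 - \<delta>) * (1 + \<sigma>) / (1 + 2 * (1 - \<delta>) * (1 + \<sigma>)) \<le>
      (1 - \<delta>) * (1 + x) / (1 + 2 * (1 - \<delta>) * (1 + x))" if "x \<ge> \<sigma>" for x
  proof -
    have "(1 - \<delta>) * (1 + \<sigma>) \<le> (1 - \<delta>) * (1 + x)" "0 \<le> (1 - \<delta>) * (1 + \<sigma>)"
      using that \<delta> \<sigma> by (auto intro: mult_left_mono)
    then have "a / (1 + 2 * a) \<le> b / (1 + 2 * b)" if "a = (1 - \<delta>) * (1 + \<sigma>)" "b = (1 - \<delta>) * (1 + x)" for a b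
      using that by (simp add: field_simps)
    then show ?thesis by (metis mult.assoc)
  qed
  show "\<exists>j\<ge>k. L3 q \<ge> (1 - \<delta>) * (1 + t j) / (1 + 2 * (1 - \<delta>) * (1 + t j)) * q - 4 * C"
    if q: "k \<ge> K" "T k \<le> q" "q \<le> T (Suc k)" for k q
  proof -
    have q0: "q \<ge> 0" using T_pos[OF q(1)] q(2) by simp
    have "L3 q \<ge> (1 - \<delta>) * X k / p k * q - 4 * C"
    proof (cases "q \<le> p k")
      case True
      have "0 * (q - p k) + (1 - \<delta>) * X k \<ge> (1 - \<delta>) * X k / p k * q"
        using True X_pos[OF q(1)] \<delta> by (intro chord_ge p q(1)) (auto simp: mult_nonneg_nonneg mult_le_0_iff)
      moreover have "q - X k \<ge> (1 - \<delta>) * X k"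
        using q(2) by (simp add: T_def algebra_simps)
      then have "L3 q \<ge> (1 - \<delta>) * X k - C"
        using L3_ge[OF q(1) q0] by (simp add: X_def)
      ultimately show ?thesis using C by linarith
    next
      case False
      have "1 / 2 * (q - p k) + (1 - \<delta>) * X k \<ge> (1 - \<delta>) * X k / p k * q"
        using False p[OF q(1)] by (intro chord_ge) auto
      moreover have "L3 q \<ge> (q - \<omega> (Suc k)) / 2 - C"
        using L_ord[OF q0] L_sum[OF q0] L1_upper(2)[OF q] by (simp add: abs_le_iff field_simps)
      then have "L3 q \<ge> 1 / 2 * (q - p k) + (1 - \<delta>) * X k - C"
        by (simp add: p_def field_simps)
      ultimately show ?thesis using C by linarith
    qed
    then show ?thesis unfolding ratio[OF q(1)] by blast
  qed
  show "filterlim (\<lambda>k. \<omega> (Suc k) + 2 * (1 - \<delta>) * X k) at_top sequentially"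
    using \<omega>_mono X_pos \<delta> by (intro filterlim_ge_\<omega> add_increasing2) (auto simp: less_imp_le)
  show "L3 (\<omega> (Suc k) + 2 * (1 - \<delta>) * X k) \<le>
      (1 - \<delta>) * (1 + t k) / (1 + 2 * (1 - \<delta>) * (1 + t k)) * (\<omega> (Suc k) + 2 * (1 - \<delta>) * X k) + 4 * C"
    if k: "k \<ge> K" for k
  proof -
    have "L3 (p k) \<le> (1 - \<delta>) * X k + 4 * C"
      using L3_block(1)[OF k, of 1 "X k" "p k"] n_pos[of "k + 2"] k p[OF k]
      by (simp add: X_def p_def)
    also have "(1 - \<delta>) * X k = (1 - \<delta>) * X k / p k * p k" using p[OF k] by simp
    finally show ?thesis unfolding ratio[OF k] by (simp add: p_def)
  qed
qed

text \<open>At \<open>q = T k\<close> both terms of \<open>L3_ge\<close> equal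
  \<open>(1 - \<delta>) * X k\<close>, a fixed multiple of \<open>T k\<close>; hence the constant
  \<open>g\<close>.\<close>

theorem limsup_L3_ge:
  "ereal ((1 - \<delta>) / (2 - \<delta>)) \<le> Limsup at_top (\<lambda>q. ereal (L3 q / q))"
proof (rule Limsup_ge_along_seq[where t = t and K = K and C = C and p = T
      and g = "\<lambda>_. (1 - \<delta>) / (2 - \<delta>)", OF t_limits])
  show "(1 - \<delta>) / (2 - \<delta>) * T k - C \<le> L3 (T k)" if k: "k \<ge> K" for k
  proof -
    have "T k - X k = (1 - \<delta>) * X k" by (simp add: T_def algebra_simps)
    then have "L3 (T k) \<ge> (1 - \<delta>) * X k - C"
      using L3_ge[OF k, of "T k"] T_pos[OF k] by (simp add: X_def)
    then show ?thesis using \<delta> by (simp add: T_def)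
  qed
qed (auto intro: T_lim)

text \<open>A tile is cut at the points \<open>(2 - \<delta>) * x\<close> for the successive block
  sizes \<open>x\<close>. The extra \<open>C\<close> covers the last piece, where
  \<open>x + \<omega> (k + 1)\<close> agrees with \<open>X (Suc k)\<close> only up to
  \<open>C\<close>.\<close>

lemma exists_block:
  assumes k: "k \<ge> K" and q: "T k \<le> q" "q \<le> T (Suc k)"
  shows "\<exists>l x. 1 \<le> l \<and> l \<le> n (k + 2) \<and> x = real l * \<omega> (k + 1) + \<omega> k \<and>
    (2 - \<delta>) * x \<le> q \<and> q \<le> (2 - \<delta>) * (x + \<omega> (k + 1) + C)"
proof -
  define x where "x = (\<lambda>l. real l * \<omega> (k + 1) + \<omega> k)"
  define S where "S = {l \<in> {1..n (k + 2)}. (2 - \<delta>) * x l \<le> q}"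
  have "1 \<in> S" using q n_pos[of "k + 2"] k by (auto simp: S_def x_def T_def X_def add_ac)
  moreover have "finite S" by (simp add: S_def)
  ultimately have "Max S \<in> S" using Max_in by blast
  define l where "l = Max S"
  have l: "1 \<le> l" "l \<le> n (k + 2)" "(2 - \<delta>) * x l \<le> q"
    using \<open>Max S \<in> S\<close> unfolding l_def[symmetric] by (auto simp: S_def)
  have "q \<le> (2 - \<delta>) * (x l + \<omega> (k + 1) + C)"
  proof (cases "l = n (k + 2)")
    case True
    have "X (Suc k) \<le> x l + \<omega> (k + 1) + C"
      using \<omega>_rec[OF k] True by (simp add: X_def x_def abs_le_iff)
    then have "T (Suc k) \<le> (2 - \<delta>) * (x l + \<omega> (k + 1) + C)"
      unfolding T_def using \<delta> by (intro mult_left_mono) auto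
    then show ?thesis using q by simp
  next
    case False
    have "Suc l \<notin> S" using Max_ge[OF \<open>finite S\<close>, of "Suc l"] by (auto simp: l_def)
    then have "q < (2 - \<delta>) * x (Suc l)" using l False by (auto simp: S_def)
    also have "\<dots> \<le> (2 - \<delta>) * (x l + \<omega> (k + 1) + C)"
      using \<delta> C by (intro mult_left_mono) (auto simp: x_def algebra_simps)
    finally show ?thesis by simp
  qed
  then show ?thesis using l by (intro exI[of _ l] exI[of _ "x l"]) (simp add: x_def)
qed

text \<open>On the two outer pieces the quotient is controlled by the cuts
  \<open>(2 - \<delta>) * x\<close> and \<open>(2 - \<delta>) * (x + W)\<close>, where it is
  \<open>(1 - \<delta>) / (2 - \<delta>)\<close>. On the middle piece the rising and the flat bound
  meet at \<open>W + (2 - \<delta>) * x\<close>, with quotient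
  \<open>1 / (2 - \<delta> + W / x)\<close>, and \<open>W / x\<close> is essentially at least
  \<open>t (Suc k)\<close> as \<open>x\<close> is at most
  \<open>\<omega> (k + 2) + C\<close>.\<close>

theorem limsup_L3_le:
  "Limsup at_top (\<lambda>q. ereal (L3 q / q)) \<le>
    ereal (max ((1 - \<delta>) / (2 - \<delta>)) (1 / (2 - \<delta> + \<sigma>)))"
proof (rule Limsup_le_along_tiles[where t = t and K = K and C = "6 * C"
      and g = "\<lambda>x. max ((1 - \<delta>) / (2 - \<delta>)) (1 / (2 - \<delta> + x))", OF T_lim t_limits(1)])
  show "isCont (\<lambda>x. max ((1 - \<delta>) / (2 - \<delta>)) (1 / (2 - \<delta> + x))) \<sigma>"
    using \<delta> \<sigma> by (intro continuous_intros) auto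
  show "max ((1 - \<delta>) / (2 - \<delta>)) (1 / (2 - \<delta> + x)) \<le> max ((1 - \<delta>) / (2 - \<delta>)) (1 / (2 - \<delta> + \<sigma>))"
    if "x \<ge> \<sigma>" for x
    using that \<delta> \<sigma> by (intro max.mono divide_left_mono) auto
  show "\<exists>j\<ge>k. L3 q \<le> max ((1 - \<delta>) / (2 - \<delta>)) (1 / (2 - \<delta> + t j)) * q + 6 * C"
    if q: "k \<ge> K" "T k \<le> q" "q \<le> T (Suc k)" for k q
  proof -
    define a where "a = (1 - \<delta>) / (2 - \<delta>)"
    define b where "b = 1 / (2 - \<delta> + t (Suc k))"
    define W where "W = \<omega> (k + 1)"
    have k: "k \<ge> K" "Suc k \<ge> K" using q by auto
    have q0: "q > 0" using T_pos[OF k(1)] q(2) by simp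
    obtain l x where l: "1 \<le> l" "l \<le> n (k + 2)" and x: "x = real l * \<omega> (k + 1) + \<omega> k"
      and xq: "(2 - \<delta>) * x \<le> q" "q \<le> (2 - \<delta>) * (x + \<omega> (k + 1) + C)"
      using exists_block[OF q] by blast
    note bb = block_bounds[OF k(1) l x]
    note L3 = L3_block[OF k(1) l x less_imp_le[OF q0], folded W_def]
    have W0: "W > 0" using \<omega>_pos_Suc[OF k(1)] by (simp add: W_def)
    have x0: "x > 0" using bb(1) X_pos[OF k(1)] by simp
    have aq: "a * q \<le> max a b * q" "b * q \<le> max a b * q"
      using q0 by (auto intro: mult_right_mono)
    consider "q \<le> W + 2 * (1 - \<delta>) * x" | "W + 2 * (1 - \<delta>) * x \<le> q" "q \<le> W + 2 * x" | "W + 2 * x \<le> q"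
      by linarith
    then have "L3 q \<le> max a b * q + 6 * C"
    proof cases
      case 1
      have "(1 - \<delta>) * x = a * ((2 - \<delta>) * x)" using \<delta> by (simp add: a_def)
      also have "\<dots> \<le> a * q" using xq(1) \<delta> by (intro mult_left_mono) (auto simp: a_def)
      finally show ?thesis using L3(1)[OF 1] aq(1) C by linarith
    next
      case 2
      \<comment> \<open>\<open>x\<close> exceeds \<open>\<omega> (k + 2)\<close> by at most
        \<open>C\<close>; replacing it by \<open>y\<close> makes the comparison with
        \<open>t (Suc k)\<close> exact at the cost of one more \<open>C\<close>.\<close>
      define y where "y = min x (\<omega> (k + 2))"
      define r where "r = W + (2 - \<delta>) * y"
      have y: "y > 0" "y \<le> x" "x - C \<le> y" "y \<le> \<omega> (k + 2)"
        using bb(2) C x0 \<omega>_pos_Suc[OF k(2)] by (auto simp: y_def min_def)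
      have "1 * y \<le> (2 - \<delta>) * y" using y \<delta> by (intro mult_right_mono) auto
      then have r: "r > 0" "y \<le> r" using y W0 unfolding r_def by linarith+
      have w2: "\<omega> (k + 2) > 0" using y by simp
      have "y * (W / \<omega> (k + 2)) \<le> \<omega> (k + 2) * (W / \<omega> (k + 2))"
        using y W0 w2 by (intro mult_right_mono) auto
      then have "y * (2 - \<delta> + t (Suc k)) \<le> r"
        using w2 by (simp add: r_def t_def W_def algebra_simps)
      then have "y / r \<le> b"
        using r t_pos[OF k(2)] \<delta> unfolding b_def by (simp add: field_simps)
      then have yb: "y / r * q \<le> b * q" using q0 by (intro mult_right_mono) auto
      have "L3 q \<le> y / r * q + 5 * C"
      proof (cases "q \<le> r")
        case True
        have "1 * (q - r) + y \<le> y / r * q"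
          using True r by (intro chord_le) (auto simp: mult_le_0_iff)
        moreover have "(1 - \<delta>) * y \<le> (1 - \<delta>) * x" using y \<delta> by (intro mult_left_mono) auto
        then have "q - W - (1 - \<delta>) * x \<le> q - r + y" by (simp add: r_def algebra_simps)
        ultimately have "q - W - (1 - \<delta>) * x \<le> y / r * q" by simp
        then show ?thesis using L3(2)[OF 2(1)] C by simp
      next
        case False
        have "0 * (q - r) + y \<le> y / r * q"
          using False r y by (intro chord_le) (auto simp: mult_le_0_iff)
        then have "y \<le> y / r * q" by simp
        then show ?thesis using L3(3)[OF 2(2)] y by simp
      qed
      also have "\<dots> \<le> max a b * q + 6 * C" using yb aq(2) C by simp
      finally show ?thesis .
    next
      case 3
      have "(2 - \<delta>) * a = 1 - \<delta>" using \<delta> by (simp add: a_def)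
      then have "(2 - \<delta>) * (a * q) = (1 - \<delta>) * q" by (metis mult.assoc)
      then have "(2 - \<delta>) * (q - (x + W)) \<le> (2 - \<delta>) * (a * q + C)"
        using xq(2) by (simp add: W_def algebra_simps)
      then have "q - (x + W) \<le> a * q + C" using \<delta> by simp
      then show ?thesis using L3(4)[OF 3] aq(1) C by linarith
    qed
    then have "L3 q \<le> max a b * q + 6 * C" .
    then show ?thesis unfolding a_def b_def by (intro exI[of _ "Suc k"]) auto
  qed
qed

end

section \<open>A weak form of Minkowski's second theorem in dimension 3\<close>

text \<open>Cut \<open>S\<close> along the integer translates of the unit cube and move all pieces
  into that cube: if no two points of \<open>S\<close> differ by an integral vector, the pieces are
  disjoint there, so the volume of \<open>S\<close> is at most 1.\<close>

lemma blichfeldt: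
  fixes S :: "(real^'n) set"
  assumes S: "S \<in> lmeasurable" "bounded S" and vol: "measure lebesgue S > 1"
  shows "\<exists>p\<in>S. \<exists>q\<in>S. p \<noteq> q \<and> (\<forall>i. (p - q) $ i \<in> \<int>)"
proof (rule ccontr)
  assume none: "\<not> ?thesis"
  obtain M0 where M0: "\<And>x. x \<in> S \<Longrightarrow> norm x \<le> M0"
    using S(2) bounded_iff by blast
  define M where "M = \<lceil>M0\<rceil>"
  have M: "\<bar>x $ i\<bar> \<le> of_int M" if "x \<in> S" for x i
    using component_le_norm_cart[of x i] M0[OF that] by (simp add: M_def) linarith
  define v :: "('n \<Rightarrow> int) \<Rightarrow> real^'n" where "v = (\<lambda>f. \<chi> i. of_int (f i))"
  define I :: "('n \<Rightarrow> int) set" where "I = PiE UNIV (\<lambda>_. {-M..M})"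
  have fin: "finite I" by (simp add: I_def finite_PiE)
  define Q :: "(real^'n) set" where "Q = cbox 0 1"
  have Qm: "Q \<in> lmeasurable" by (simp add: Q_def)
  have Q1: "measure lebesgue Q = 1"
    unfolding Q_def by (simp add: measure_completion content_cbox_cart interval_ne_empty_cart)
  define T where "T = (\<lambda>f. (\<lambda>x. x - v f) ` S \<inter> Q)"
  have Tm: "T f \<in> lmeasurable" for f
    unfolding T_def using S(1) Qm by (intro fmeasurable.Int measurable_translation_subtract) auto
  have "S \<subseteq> (\<Union>f\<in>I. (+) (v f) ` T f)"
  proof
    fix x assume x: "x \<in> S"
    define f where "f = (\<lambda>i. \<lfloor>x $ i\<rfloor>)"
    have "f \<in> I"
      using M[OF x] by (auto simp: I_def f_def PiE_def abs_le_iff le_floor_iff floor_le_iff) (smt (verit))+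
    moreover have "x - v f \<in> T f"
      using x by (auto simp: T_def Q_def mem_box_cart v_def f_def) linarith+
    ultimately show "x \<in> (\<Union>f\<in>I. (+) (v f) ` T f)"
      by (auto intro!: bexI[of _ f] image_eqI[of _ _ "x - v f"])
  qed
  moreover have Tt: "(+) (v f) ` T f \<in> lmeasurable" for f
    using Tm by (rule measurable_translation)
  ultimately have "measure lebesgue S \<le> measure lebesgue (\<Union>f\<in>I. (+) (v f) ` T f)"
    using S(1) fin by (intro measure_mono_fmeasurable) auto
  also have "\<dots> \<le> (\<Sum>f\<in>I. measure lebesgue ((+) (v f) ` T f))"
    using fin Tt by (intro measure_UNION_le) auto
  also have "\<dots> = (\<Sum>f\<in>I. measure lebesgue (T f))"
    by (simp add: measure_translation)
  also have "\<dots> = measure lebesgue (\<Union>f\<in>I. T f)"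
  proof (rule measure_finite_Union[symmetric])
    show "disjoint_family_on T I"
      unfolding disjoint_family_on_def
    proof (intro ballI impI, rule ccontr)
      fix f g assume "f \<noteq> g" "T f \<inter> T g \<noteq> {}"
      then obtain x where "x + v f \<in> S" "x + v g \<in> S" 
        by (auto simp: T_def) (metis diff_add_cancel)
      moreover have "x + v f \<noteq> x + v g" using \<open>f \<noteq> g\<close> by (auto simp: v_def vec_eq_iff)
      moreover have "\<forall>i. ((x + v f) - (x + v g)) $ i \<in> \<int>" by (simp add: v_def)
      ultimately show False using none by blast
    qed
    show "emeasure lebesgue (T f) \<noteq> \<infinity>" for f
      using Tm[of f] by (metis fmeasurableD2 infinity_ennreal_def)
  qed (use fin Tm in auto)
  also have "\<dots> \<le> measure lebesgue Q"
  proof (rule measure_mono_fmeasurable)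
    show "(\<Union>f\<in>I. T f) \<in> sets lebesgue"
      using fin Tm by (intro sets.finite_UN) auto
  qed (use Qm in \<open>auto simp: T_def\<close>)
  finally show False using vol Q1 by simp
qed

text \<open>The preimage under \<open>A\<close> of an open cube of side \<open>c\<close> has volume
  greater than 1, so it contains two points with integral difference; differences of points of the
  cube have coordinates below \<open>c\<close> in absolute value.\<close>

lemma minkowski_linear_forms:
  fixes A :: "((real, 'n::{finite,wellorder}) vec, 'n) vec"
  assumes "det A \<noteq> 0" "c > 0" "\<bar>det A\<bar> < c ^ CARD('n)"
  shows "\<exists>x. x \<noteq> 0 \<and> (\<forall>i. x $ i \<in> \<int>) \<and> (\<forall>i. \<bar>(A *v x) $ i\<bar> < c)"
proof -
  obtain A' where A': "A ** A' = mat 1"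
    using assms(1) invertible_det_nz invertible_right_inverse by blast
  have "det A * det A' = 1" using A' by (metis det_I det_mul)
  then have det': "\<bar>det A'\<bar> = 1 / \<bar>det A\<bar>"
    by (metis abs_1 abs_mult assms(1) nonzero_mult_div_cancel_left abs_eq_0)
  define B :: "(real, 'n) vec set" where "B = box 0 (\<chi> i. c)"
  have Bm: "B \<in> lmeasurable" by (simp add: B_def)
  have "measure lebesgue B = measure lebesgue (cbox 0 (\<chi> i. c) :: (real, 'n) vec set)"
    unfolding B_def by (simp add: measure_completion measure_lborel_box_eq measure_lborel_cbox_eq)
  also have "\<dots> = c ^ CARD('n)"
    using assms(2) by (simp add: measure_completion content_cbox_cart interval_ne_empty_cart)
  finally have B: "measure lebesgue B = c ^ CARD('n)" .
  define S where "S = (*v) A' ` B"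
  have lin: "linear ((*v) A')" by (rule matrix_vector_mul_linear)
  have "measure lebesgue S = \<bar>det A'\<bar> * c ^ CARD('n)"
    unfolding S_def using measure_linear_image[OF lin Bm] B by simp
  also have "\<dots> > 1" unfolding det' using assms by (simp add: pos_less_divide_eq)
  finally have "measure lebesgue S > 1" .
  moreover have "S \<in> lmeasurable" unfolding S_def using lin Bm by (rule measurable_linear_image)
  moreover have "bounded S"
    unfolding S_def using lin by (intro bounded_linear_image) (auto simp: B_def linear_linear)
  ultimately obtain p q where pq: "p \<in> S" "q \<in> S" "p \<noteq> q" "\<forall>i. (p - q) $ i \<in> \<int>"
    using blichfeldt by blast
  then obtain a b where ab: "p = A' *v a" "q = A' *v b" "a \<in> B" "b \<in> B" by (auto simp: S_def)
  have "A *v (p - q) = a - b"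
    unfolding ab by (simp add: matrix_vector_mult_diff_distrib matrix_vector_mul_assoc A')
  moreover have "\<bar>(a - b) $ i\<bar> < c" for i
    using ab(3,4) by (auto simp: B_def mem_box_cart abs_less_iff) (smt (verit))+
  ultimately show ?thesis using pq by (intro exI[of _ "p - q"]) auto
qed

text \<open>The rows of \<open>E\<close> form the Gram-Schmidt frame, built with cross products:
  \<open>e1\<close> along \<open>v1\<close>, \<open>e3\<close> normal to the plane of
  \<open>v1\<close> and \<open>v2\<close>, and \<open>e2\<close> completing them.\<close>

lemma orthogonal_flag:
  fixes v1 v2 :: "real^3"
  assumes "v1 \<times> v2 \<noteq> 0"
  shows "\<exists>E. orthogonal_matrix E \<and> (E *v v1) $ 2 = 0 \<and> (E *v v1) $ 3 = 0 \<and> (E *v v2) $ 3 = 0"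
proof -
  define e1 where "e1 = (1 / norm v1) *\<^sub>R v1"
  define e3 where "e3 = (1 / norm (v1 \<times> v2)) *\<^sub>R (v1 \<times> v2)"
  define e2 where "e2 = e3 \<times> e1"
  have "v1 \<noteq> 0" using assms by auto
  then have n1: "norm e1 = 1" and n3: "norm e3 = 1" using assms by (simp_all add: e1_def e3_def)
  have o13: "e1 \<bullet> e3 = 0" by (simp add: e1_def e3_def dot_cross_self)
  have o2: "e2 \<bullet> e1 = 0" "e2 \<bullet> e3 = 0" by (simp_all add: e2_def dot_cross_self)
  have "(norm e2)\<^sup>2 = 1"
    using norm_cross_dot[of e3 e1] n1 n3 o13 by (simp add: e2_def inner_commute)
  then have n2: "e2 \<bullet> e2 = 1" by (simp add: power2_norm_eq_inner)
  have n13: "e1 \<bullet> e1 = 1" "e3 \<bullet> e3 = 1" using n1 n3 by (simp_all add: norm_eq_1)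
  define E :: "real^3^3" where "E = vector [e1, e2, e3]"
  have row: "E $ 1 = e1" "E $ 2 = e2" "E $ 3 = e3" by (simp_all add: E_def)
  have comp: "(E *v x) $ i = E $ i \<bullet> x" for x i
    by (simp add: matrix_vector_mult_def inner_vec_def)
  have "(E ** transpose E) $ i $ j = E $ i \<bullet> E $ j" for i j
    by (simp add: matrix_matrix_mult_def transpose_def inner_vec_def)
  then have "E ** transpose E = mat 1"
    using n13 n2 o13 o2 by (simp add: vec_eq_iff forall_3 row mat_def inner_commute)
  then have "orthogonal_matrix E"
    by (simp add: orthogonal_matrix_def matrix_left_right_inverse)
  moreover have "e2 \<bullet> v1 = 0" using o2(1) \<open>v1 \<noteq> 0\<close> by (simp add: e1_def)
  moreover have "e3 \<bullet> v1 = 0" "e3 \<bullet> v2 = 0" by (simp_all add: e3_def dot_cross_self)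
  ultimately show ?thesis by (intro exI[of _ E]) (simp add: comp row)
qed

text \<open>In an orthonormal basis adapted to the flag of \<open>b1\<close> and \<open>b2\<close>, a box whose sides are half the
  minima contains no nonzero lattice point, which bounds its volume.\<close>
lemma minkowski_second_dim3:
  fixes A :: "real^3^3"
  assumes A: "det A \<noteq> 0" and ind: "b1 \<times> b2 \<noteq> 0"
    and \<mu>: "0 < \<mu>1" "\<mu>1 \<le> \<mu>2" "\<mu>2 \<le> \<mu>3"
    and min1: "\<And>z. z \<in> int_lattice \<Longrightarrow> z \<noteq> 0 \<Longrightarrow> \<mu>1 \<le> norm (A *v z)"
    and min2: "\<And>z. z \<in> int_lattice \<Longrightarrow> z \<notin> span {b1} \<Longrightarrow> \<mu>2 \<le> norm (A *v z)"
    and min3: "\<And>z. z \<in> int_lattice \<Longrightarrow> z \<notin> span {b1, b2} \<Longrightarrow> \<mu>3 \<le> norm (A *v z)"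
  shows "\<mu>1 * \<mu>2 * \<mu>3 \<le> 8 * \<bar>det A\<bar>"
proof (rule ccontr)
  assume neg: "\<not> ?thesis"
  define v1 where "v1 = A *v b1"
  define v2 where "v2 = A *v b2"
  have "transpose A *v (v1 \<times> v2) = det A *\<^sub>R (b1 \<times> b2)"
    unfolding v1_def v2_def by (rule cross_matrix_mult)
  then have "v1 \<times> v2 \<noteq> 0" using A ind by auto
  then obtain E where E: "orthogonal_matrix E" "(E *v v1) $ 2 = 0" "(E *v v1) $ 3 = 0" "(E *v v2) $ 3 = 0"
    using orthogonal_flag by blast
  define m :: "real^3" where "m = vector [1 / \<mu>1, 1 / \<mu>2, 1 / \<mu>3]"
  define D :: "real^3^3" where "D = (\<chi> i j. if i = j then m $ i else 0)"
  have \<mu>pos: "\<mu>1 > 0" "\<mu>2 > 0" "\<mu>3 > 0" using \<mu> by auto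
  have detD: "det D = 1 / (\<mu>1 * \<mu>2 * \<mu>3)"
    by (simp add: det_3 D_def m_def)
  have "\<bar>det E\<bar> = 1" using det_orthogonal_matrix[OF E(1)] by auto
  then have det: "\<bar>det (D ** E ** A)\<bar> = \<bar>det A\<bar> / (\<mu>1 * \<mu>2 * \<mu>3)"
    using \<mu>pos by (simp add: det_mul abs_mult detD)
  \<comment> \<open>The factor 8 of the claim is \<open>2 ^ 3\<close>, from halving the three
    sides.\<close>
  have "\<bar>det (D ** E ** A)\<bar> < (1 / 2) ^ CARD(3)"
    unfolding det using neg \<mu>pos by (simp add: field_simps)
  moreover have "det (D ** E ** A) \<noteq> 0" using det A \<mu>pos by auto
  ultimately obtain x where x: "x \<noteq> 0" "\<forall>i. x $ i \<in> \<int>" "\<forall>i. \<bar>((D ** E ** A) *v x) $ i\<bar> < 1 / 2"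
    using minkowski_linear_forms[of "D ** E ** A" "1 / 2"] by auto
  have lat: "x \<in> int_lattice" using x by (simp add: int_lattice_def)
  define y where "y = E *v (A *v x)"
  have "((D ** E ** A) *v x) $ i = m $ i * y $ i" for i
  proof -
    have "(D ** E ** A) *v x = D *v y"
      by (simp add: matrix_vector_mul_assoc y_def matrix_mul_assoc)
    then show ?thesis
      by (simp add: D_def matrix_vector_mult_def if_distrib if_distribR cong: if_cong)
  qed
  then have y: "\<bar>y $ 1\<bar> < \<mu>1 / 2" "\<bar>y $ 2\<bar> < \<mu>2 / 2" "\<bar>y $ 3\<bar> < \<mu>3 / 2"
    using x(3) \<mu>pos by (simp_all add: forall_3 m_def abs_mult field_simps)
  have "norm y = norm (A *v x)"
    unfolding y_def using E(1) by (metis orthogonal_transformation_matrix orthogonal_transformation_norm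
        matrix_of_matrix_vector_mul matrix_vector_mul_linear)
  then have n: "norm (A *v x) ^ 2 = (y $ 1)\<^sup>2 + (y $ 2)\<^sup>2 + (y $ 3)\<^sup>2"
    using power2_norm_eq_inner[of y] by (simp add: inner_vec_def sum_3 power2_eq_square)
  have sq: "t\<^sup>2 \<le> M\<^sup>2 / 4" if "\<bar>t\<bar> < s / 2" "s \<le> M" for t s M :: real
  proof -
    have "t\<^sup>2 \<le> (M / 2)\<^sup>2" using that by (intro abs_le_square_iff[THEN iffD1]) auto
    then show ?thesis by (simp add: power_divide)
  qed
  \<comment> \<open>Three coordinates of size at most \<open>M / 2\<close> give a squared length of
    at most three quarters of the square of \<open>M\<close>. In the plane of \<open>b1\<close> and
    \<open>b2\<close> the third coordinate vanishes, and on the line of \<open>b1\<close> the second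
    does too, so in each case \<open>M\<close> can be the minimum that applies to
    \<open>x\<close>.\<close>
  have imp: "\<not> M \<le> norm (A *v x)" if "(y $ 1)\<^sup>2 + (y $ 2)\<^sup>2 + (y $ 3)\<^sup>2 \<le> 3 * (M\<^sup>2 / 4)" "M > 0" for M
  proof
    assume "M \<le> norm (A *v x)"
    then have "M\<^sup>2 \<le> (norm (A *v x))\<^sup>2" using that(2) by (intro power_mono) auto
    moreover have "M\<^sup>2 > 0" using that(2) by simp
    ultimately show False using that(1) n by linarith
  qed
  show False
  proof (cases "x \<in> span {b1, b2}")
    case False
    have "(y $ 1)\<^sup>2 + (y $ 2)\<^sup>2 + (y $ 3)\<^sup>2 \<le> 3 * (\<mu>3\<^sup>2 / 4)"
      using sq[OF y(1), of \<mu>3] sq[OF y(2), of \<mu>3] sq[OF y(3), of \<mu>3] \<mu> by simp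
    then show False using imp[OF _ \<mu>pos(3)] min3[OF lat False] by blast
  next
    case True
    then obtain a b where "x = a *\<^sub>R b1 + b *\<^sub>R b2"
      by (auto simp: span_insert span_singleton algebra_simps)
    then have xab: "y = a *\<^sub>R (E *v v1) + b *\<^sub>R (E *v v2)"
      by (simp add: y_def v1_def v2_def matrix_vector_right_distrib matrix_vector_mult_scaleR)
    then have y3: "y $ 3 = 0" using E by simp
    show False
    proof (cases "x \<in> span {b1}")
      case False
      have "(y $ 1)\<^sup>2 + (y $ 2)\<^sup>2 + (y $ 3)\<^sup>2 \<le> 3 * (\<mu>2\<^sup>2 / 4)"
        using sq[OF y(1) \<mu>(2)] sq[OF y(2) order_refl] zero_le_power2[of \<mu>2]
        unfolding y3 zero_power2 by linarith
      then show False using imp[OF _ \<mu>pos(2)] min2[OF lat False] by blast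
    next
      case True
      then obtain a where "x = a *\<^sub>R b1" by (auto simp: span_singleton)
      then have "y = a *\<^sub>R (E *v v1)"
        by (simp add: y_def v1_def matrix_vector_mult_scaleR)
      then have y2: "y $ 2 = 0" using E by simp
      have "(y $ 1)\<^sup>2 + (y $ 2)\<^sup>2 + (y $ 3)\<^sup>2 \<le> 3 * (\<mu>1\<^sup>2 / 4)"
        using sq[OF y(1) order_refl] zero_le_power2[of \<mu>1]
        unfolding y3 y2 zero_power2 by linarith
      then show False using imp[OF _ \<mu>pos(1)] min1[OF lat x(1)] by blast
    qed
  qed
qed

section \<open>Successive minima of the convex bodies\<close>

text \<open>The gauge of the convex body at parameter \<open>q\<close>: by
  \<open>mem_scaled_body\<close> its sublevel sets are the dilates of the body.\<close>

definition body_norm :: "real^3 \<Rightarrow> real \<Rightarrow> real^3 \<Rightarrow> real" where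
  "body_norm u q x = max (norm x) (exp q * \<bar>x \<bullet> u\<bar>)"

lemma body_norm_nonneg: "body_norm u q x \<ge> 0"
  by (simp add: body_norm_def le_max_iff_disj)

lemma norm_le_body_norm: "norm x \<le> body_norm u q x"
  by (simp add: body_norm_def)

lemma body_norm_mono: "p \<le> q \<Longrightarrow> body_norm u p x \<le> body_norm u q x"
  unfolding body_norm_def by (intro max.mono mult_right_mono) auto

lemma body_norm_scaleR: "body_norm u q (c *\<^sub>R x) = \<bar>c\<bar> * body_norm u q x"
proof -
  have "exp q * \<bar>(c *\<^sub>R x) \<bullet> u\<bar> = \<bar>c\<bar> * (exp q * \<bar>x \<bullet> u\<bar>)" by (simp add: abs_mult)
  then show ?thesis unfolding body_norm_def norm_scaleR by (simp only: max_mult_distrib_left) simp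
qed

lemma int_lattice_norm_ge_1:
  assumes "z \<in> int_lattice" "z \<noteq> 0" shows "norm z \<ge> 1"
proof -
  obtain i where i: "z $ i \<noteq> 0" using assms(2) by (auto simp: vec_eq_iff)
  have "z $ i \<in> \<int>" using assms(1) by (simp add: int_lattice_def)
  then have "\<bar>z $ i\<bar> \<ge> 1" using i by (rule Ints_nonzero_abs_ge1)
  then show ?thesis using component_le_norm_cart[of z i] by linarith
qed

lemma body_norm_ge_1:
  assumes "z \<in> int_lattice" "z \<noteq> 0" shows "body_norm u q z \<ge> 1"
  by (rule order_trans[OF int_lattice_norm_ge_1[OF assms] norm_le_body_norm])

lemma inner_int_lattice: "x \<in> int_lattice \<Longrightarrow> y \<in> int_lattice \<Longrightarrow> x \<bullet> y \<in> \<int>"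
  by (auto simp: inner_vec_def int_lattice_def)

lemma cross_int_lattice: "x \<in> int_lattice \<Longrightarrow> y \<in> int_lattice \<Longrightarrow> x \<times> y \<in> int_lattice"
  by (simp add: int_lattice_def forall_3 cross3_def)

text \<open>The condition \<open>r > 0\<close> of \<open>succ_min\<close> follows for
  \<open>j > 0\<close>, because nonzero lattice points have gauge at least 1.\<close>

definition admissible_radii :: "real^3 \<Rightarrow> real \<Rightarrow> nat \<Rightarrow> real set" where
  "admissible_radii u q j = {r. \<exists>B. B \<subseteq> int_lattice \<and> independent B \<and> card B = j \<and> (\<forall>x\<in>B. body_norm u q x \<le> r)}"

lemma mem_scaled_body:
  assumes "r > 0" shows "x \<in> (*\<^sub>R) r ` conv_body u (exp q) \<longleftrightarrow> body_norm u q x \<le> r"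
proof -
  have "x \<in> (*\<^sub>R) r ` conv_body u (exp q) \<longleftrightarrow> (1 / r) *\<^sub>R x \<in> conv_body u (exp q)"
    using assms by (force simp: image_iff)
  also have "\<dots> \<longleftrightarrow> norm x \<le> r \<and> exp q * \<bar>x \<bullet> u\<bar> \<le> r"
    using assms by (simp add: conv_body_def abs_mult field_simps)
  finally show ?thesis by (simp add: body_norm_def)
qed

lemma succ_min_eq:
  assumes "j > 0" shows "succ_min j (conv_body u (exp q)) int_lattice = Inf (admissible_radii u q j)"
proof -
  have "{r. r > 0 \<and> (\<exists>B. B \<subseteq> (*\<^sub>R) r ` conv_body u (exp q) \<inter> int_lattice \<and> independent B \<and> card B = j)}
      = admissible_radii u q j" (is "?L = _")
  proof (intro set_eqI iffI)
    fix r assume "r \<in> ?L"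
    then obtain B where B: "r > 0" "B \<subseteq> (*\<^sub>R) r ` conv_body u (exp q) \<inter> int_lattice"
        "independent B" "card B = j" by blast
    then have "\<forall>x\<in>B. body_norm u q x \<le> r" using mem_scaled_body[OF B(1)] by blast
    with B show "r \<in> admissible_radii u q j" unfolding admissible_radii_def by blast
  next
    fix r assume "r \<in> admissible_radii u q j"
    then obtain B where B: "B \<subseteq> int_lattice" "independent B" "card B = j" "\<forall>x\<in>B. body_norm u q x \<le> r"
      unfolding admissible_radii_def by blast
    then obtain z where z: "z \<in> B" using assms by (cases "B = {}") auto
    then have "z \<noteq> 0" using B(2) dependent_zero by blast
    then have "r > 0" using body_norm_ge_1[of z u q] B z by fastforce
    moreover have "B \<subseteq> (*\<^sub>R) r ` conv_body u (exp q) \<inter> int_lattice"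
      using B mem_scaled_body[OF \<open>r > 0\<close>] by blast
    ultimately show "r \<in> ?L" using B by blast
  qed
  then show ?thesis by (simp add: succ_min_def)
qed

lemma admissible_radii_ge_1:
  assumes "j > 0" "r \<in> admissible_radii u q j" shows "r \<ge> 1"
proof -
  obtain B where B: "B \<subseteq> int_lattice" "independent B" "card B = j" "\<forall>x\<in>B. body_norm u q x \<le> r"
    using assms(2) unfolding admissible_radii_def by blast
  then obtain z where z: "z \<in> B" using assms(1) by (cases "B = {}") auto
  then have "z \<noteq> 0" using B(2) dependent_zero by blast
  then show ?thesis using body_norm_ge_1[of z u q] B z by fastforce
qed

lemma admissible_radii_nonempty:
  assumes "j \<le> 3" shows "admissible_radii u q j \<noteq> {}"
proof -
  have "card (Basis :: (real^3) set) = 3" by simp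
  then obtain B where B: "B \<subseteq> (Basis :: (real^3) set)" "card B = j"
    using assms by (metis obtain_subset_with_card_n)
  have "B \<subseteq> int_lattice"
    using B(1) by (auto simp: int_lattice_def Basis_vec_def axis_def)
  moreover have "independent B" using B(1) independent_Basis independent_mono by blast
  moreover have fin: "finite B" using B(1) finite_Basis finite_subset by blast
  then have "\<forall>x\<in>B. body_norm u q x \<le> (\<Sum>x\<in>B. body_norm u q x)"
    by (auto intro: member_le_sum body_norm_nonneg)
  ultimately show ?thesis using B(2) unfolding admissible_radii_def by blast
qed

definition lam :: "real^3 \<Rightarrow> nat \<Rightarrow> real \<Rightarrow> real" where
  "lam u j q = Inf (admissible_radii u q j)"

lemma log_min_eq: "j > 0 \<Longrightarrow> log_min u j q = ln (lam u j q)"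
  by (simp add: log_min_def succ_min_eq lam_def)

lemma lam_le:
  assumes "j > 0" "r \<in> admissible_radii u q j" shows "lam u j q \<le> r"
  unfolding lam_def
proof (rule cInf_lower[OF assms(2)])
  show "bdd_below (admissible_radii u q j)"
    using admissible_radii_ge_1[OF assms(1)] by (rule bdd_belowI)
qed

lemma lam_ge:
  assumes "j \<le> 3" "\<And>r. r \<in> admissible_radii u q j \<Longrightarrow> m \<le> r" shows "m \<le> lam u j q"
  unfolding lam_def by (rule cInf_greatest[OF admissible_radii_nonempty[OF assms(1)] assms(2)])

lemma lam_ge_1: "0 < j \<Longrightarrow> j \<le> 3 \<Longrightarrow> lam u j q \<ge> 1"
  by (intro lam_ge admissible_radii_ge_1) auto

text \<open>Stands in for attainment of the infimum; the factor 2 becomes an additive constant in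
  the logarithm.\<close>

lemma lam_approx:
  assumes "j > 0" "j \<le> 3" shows "\<exists>r\<in>admissible_radii u q j. r < 2 * lam u j q"
proof -
  have "Inf (admissible_radii u q j) < 2 * lam u j q"
    using lam_ge_1[OF assms, of u q] unfolding lam_def by linarith
  then show ?thesis using cInf_lessD[OF admissible_radii_nonempty[OF assms(2)]] by blast
qed

lemma lam_mono:
  assumes "j > 0" "j \<le> 3" "p \<le> q" shows "lam u j p \<le> lam u j q"
proof (rule lam_ge[OF assms(2)])
  fix r assume "r \<in> admissible_radii u q j"
  then obtain B where B: "B \<subseteq> int_lattice" "independent B" "card B = j" "\<forall>x\<in>B. body_norm u q x \<le> r"
    unfolding admissible_radii_def by blast
  have "body_norm u p x \<le> r" if "x \<in> B" for x
    using body_norm_mono[OF assms(3), of u x] B(4) that by fastforce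
  with B have "r \<in> admissible_radii u p j" unfolding admissible_radii_def by blast
  then show "lam u j p \<le> r" using assms(1) by (intro lam_le)
qed

lemma lam_Suc:
  assumes "j > 0" "Suc j \<le> 3" shows "lam u j q \<le> lam u (Suc j) q"
proof (rule lam_ge[OF assms(2)])
  fix r assume "r \<in> admissible_radii u q (Suc j)"
  then obtain B where B: "B \<subseteq> int_lattice" "independent B" "card B = Suc j" "\<forall>x\<in>B. body_norm u q x \<le> r"
    unfolding admissible_radii_def by blast
  then obtain B' where B': "B' \<subseteq> B" "card B' = j" by (metis le_add2 obtain_subset_with_card_n plus_1_eq_Suc)
  have "r \<in> admissible_radii u q j"
    unfolding admissible_radii_def using B B' independent_mono[OF B(2) B'(1)] by blast
  then show "lam u j q \<le> r" using assms(1) by (intro lam_le)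
qed

lemma card_le_dim_span:
  fixes B :: "(real^3) set"
  assumes "independent B" "B \<subseteq> span S" "finite S" shows "card B \<le> card S"
  by (rule conjunct2[OF independent_span_bound[OF assms(3,1,2)]])

lemma pair_not_in_line:
  fixes B :: "(real^3) set"
  assumes "independent B" "card B = 2" shows "\<exists>z\<in>B. z \<notin> span {v}"
proof (rule ccontr)
  assume "\<not> ?thesis"
  then have "card B \<le> card {v}" using assms(1) by (intro card_le_dim_span) auto
  then show False using assms(2) by simp
qed

lemma triple_not_in_plane:
  fixes B :: "(real^3) set"
  assumes "independent B" "card B = 3" "y \<noteq> 0" shows "\<exists>z\<in>B. z \<bullet> y \<noteq> 0"
proof (rule ccontr)
  assume "\<not> ?thesis"
  then have "\<forall>z\<in>B. orthogonal y z" by (simp add: orthogonal_def inner_commute)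
  moreover have "UNIV \<subseteq> span B" using assms(1,2) by (intro card_ge_dim_independent) auto
  ultimately have "orthogonal y y" using orthogonal_to_span by blast
  then show False using assms(3) by (simp add: orthogonal_def)
qed

lemma lam_1_ge:
  assumes "\<And>z. z \<in> int_lattice \<Longrightarrow> z \<noteq> 0 \<Longrightarrow> m \<le> body_norm u q z" shows "m \<le> lam u 1 q"
proof (rule lam_ge)
  fix r assume "r \<in> admissible_radii u q 1"
  then obtain B where B: "B \<subseteq> int_lattice" "independent B" "card B = 1" "\<forall>x\<in>B. body_norm u q x \<le> r"
    unfolding admissible_radii_def by blast
  then obtain z where "B = {z}" by (auto simp: card_1_singleton_iff)
  then show "m \<le> r" using B assms[of z] dependent_zero[of B] by fastforce
qed simp

text \<open>Two independent vectors cannot share the line of \<open>v\<close>. The freedom in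
  \<open>v\<close> is what allows the dual point to be excluded later.\<close>

lemma lam_2_ge:
  assumes "\<And>z. z \<in> int_lattice \<Longrightarrow> z \<notin> span {v} \<Longrightarrow> m \<le> body_norm u q z" shows "m \<le> lam u 2 q"
proof (rule lam_ge)
  fix r assume "r \<in> admissible_radii u q 2"
  then obtain B where B: "B \<subseteq> int_lattice" "independent B" "card B = 2" "\<forall>x\<in>B. body_norm u q x \<le> r"
    unfolding admissible_radii_def by blast
  then obtain z where "z \<in> B" "z \<notin> span {v}" using pair_not_in_line by blast
  then show "m \<le> r" using B assms by fastforce
qed simp

lemma lam_3_ge:
  assumes "y \<noteq> 0" "\<And>z. z \<in> int_lattice \<Longrightarrow> z \<bullet> y \<noteq> 0 \<Longrightarrow> m \<le> body_norm u q z" shows "m \<le> lam u 3 q"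
proof (rule lam_ge)
  fix r assume "r \<in> admissible_radii u q 3"
  then obtain B where B: "B \<subseteq> int_lattice" "independent B" "card B = 3" "\<forall>x\<in>B. body_norm u q x \<le> r"
    unfolding admissible_radii_def by blast
  then obtain z where "z \<in> B" "z \<bullet> y \<noteq> 0" using triple_not_in_plane assms(1) by blast
  then show "m \<le> r" using B assms by fastforce
qed simp

lemma lam_1_le: "z \<in> int_lattice \<Longrightarrow> z \<noteq> 0 \<Longrightarrow> lam u 1 q \<le> body_norm u q z"
proof (rule lam_le)
  assume "z \<in> int_lattice" "z \<noteq> 0"
  then have "{z} \<subseteq> int_lattice" "independent {z}" "card {z} = 1" "\<forall>x\<in>{z}. body_norm u q x \<le> body_norm u q z"
    by auto
  then show "body_norm u q z \<in> admissible_radii u q 1" unfolding admissible_radii_def by blast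
qed simp

lemma independent_pair: "independent {a, b}" "a \<noteq> b" if "a \<times> b \<noteq> 0" for a b :: "real^3"
proof -
  show "a \<noteq> b" using that by auto
  have "b \<noteq> 0" using that by auto
  then have "independent {b}" by simp
  moreover have "a \<notin> span {b}" using that by (auto simp: span_singleton cross_mult_left)
  ultimately show "independent {a, b}" by (rule independent_insertI[rotated])
qed

lemma lam_2_le:
  assumes "a \<in> int_lattice" "b \<in> int_lattice" "a \<times> b \<noteq> 0" "body_norm u q a \<le> r" "body_norm u q b \<le> r"
  shows "lam u 2 q \<le> r"
proof (rule lam_le)
  have "{a, b} \<subseteq> int_lattice" "independent {a, b}" "card {a, b} = 2" "\<forall>x\<in>{a, b}. body_norm u q x \<le> r"
    using assms independent_pair[OF assms(3)] by auto
  then show "r \<in> admissible_radii u q 2" unfolding admissible_radii_def by blast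
qed simp

lemma cross_eq_0_span:
  fixes a b :: "real^3"
  assumes "a \<noteq> 0" "b \<notin> span {a}" shows "a \<times> b \<noteq> 0"
proof
  assume "a \<times> b = 0"
  then obtain c where "b = c *\<^sub>R a"
    using assms span_zero[of "{a}"] unfolding cross_eq_0 collinear_lemma by auto
  then show False using assms(2) span_mul[OF span_base, of a "{a}" c] by simp
qed

lemma norm_cross_le: "norm (x \<times> y) \<le> norm x * norm y" for x y :: "real^3"
proof (rule power2_le_imp_le)
  show "(norm (x \<times> y))\<^sup>2 \<le> (norm x * norm y)\<^sup>2"
    unfolding norm_cross_dot[symmetric] by simp
qed simp

lemma triple_product_matrix:
  fixes A :: "real^3^3"
  shows "(A *v x) \<bullet> ((A *v y) \<times> (A *v z)) = det A * (x \<bullet> (y \<times> z))"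
proof -
  have "(A *v x) \<bullet> w = x \<bullet> (transpose A *v w)" for w
    unfolding transpose_matrix_vector inner_commute[of x] dot_lmul_matrix by (rule inner_commute)
  then show ?thesis by (simp only: cross_matrix_mult inner_scaleR_right)
qed

text \<open>Vectors minimal up to a factor 2 come from the infimum alone, without counting the
  lattice points of a ball.\<close>

lemma near_minimum:
  fixes g :: "'a \<Rightarrow> real"
  assumes "S \<noteq> {}" "\<And>x. x \<in> S \<Longrightarrow> g x \<ge> 1"
  shows "\<exists>b\<in>S. \<forall>z\<in>S. g b \<le> 2 * g z"
proof -
  define m where "m = Inf (g ` S)"
  have m: "m \<le> g z" if "z \<in> S" for z
    unfolding m_def using that assms(2) by (intro cInf_lower) (auto intro!: bdd_belowI[of _ 1])
  have "m \<ge> 1" unfolding m_def using assms by (intro cInf_greatest) auto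
  then have "m < 2 * m" by simp
  then obtain b where "b \<in> S" "g b < 2 * m"
    using cInf_lessD[of "g ` S" "2 * m"] assms(1) unfolding m_def by auto
  then show ?thesis using m by force
qed

lemma axis_int_lattice: "axis i 1 \<in> int_lattice"
  by (simp add: int_lattice_def axis_def)

lemma int_lattice_not_subset_span:
  assumes "finite S" "card S < 3" shows "\<exists>z\<in>int_lattice. z \<notin> span S"
proof (rule ccontr)
  assume "\<not> ?thesis"
  then have "Basis \<subseteq> span S" using axis_int_lattice by (auto simp: Basis_vec_def)
  then have "card (Basis :: (real^3) set) \<le> card S"
    using assms(1) independent_Basis by (intro card_le_dim_span)
  then show False using assms(2) by simp
qed

section \<open>The product of the three minima compared with \<open>exp q\<close>\<close>

context
  fixes u :: "real^3" assumes u1: "u $ 1 = 1"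
begin

text \<open>The first row is the scaled linear form, the others are coordinates. As
  \<open>u $ 1 = 1\<close>, the determinant is \<open>exp q\<close>, and the first coordinate of
  \<open>x\<close> can be recovered from the image, so the norm of the image is comparable to the
  gauge for \<open>q \<ge> 0\<close>.\<close>

definition body_matrix :: "real \<Rightarrow> real^3^3" where
  "body_matrix q = vector [exp q *\<^sub>R u, axis 2 1, axis 3 1]"

lemma body_matrix_mult:
  "(body_matrix q *v x) $ 1 = exp q * (x \<bullet> u)" "(body_matrix q *v x) $ 2 = x $ 2"
  "(body_matrix q *v x) $ 3 = x $ 3"
proof -
  have "(body_matrix q *v x) $ 1 = (exp q *\<^sub>R u) \<bullet> x" "(body_matrix q *v x) $ 2 = axis 2 1 \<bullet> x"
    "(body_matrix q *v x) $ 3 = axis 3 1 \<bullet> x"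
    by (simp_all add: body_matrix_def matrix_vector_mult_def inner_vec_def)
  then show "(body_matrix q *v x) $ 1 = exp q * (x \<bullet> u)" "(body_matrix q *v x) $ 2 = x $ 2"
    "(body_matrix q *v x) $ 3 = x $ 3"
    by (simp_all add: inner_commute[of _ x] inner_axis)
qed

lemma det_body_matrix: "det (body_matrix q) = exp q"
  using u1 by (simp add: body_matrix_def det_3 axis_def)

lemma norm_body_matrix_le: "norm (body_matrix q *v x) \<le> 3 * body_norm u q x"
proof -
  have "norm (body_matrix q *v x) \<le> (\<Sum>i\<in>UNIV. \<bar>(body_matrix q *v x) $ i\<bar>)"
    by (rule norm_le_l1_cart)
  also have "\<dots> = exp q * \<bar>x \<bullet> u\<bar> + \<bar>x $ 2\<bar> + \<bar>x $ 3\<bar>"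
    by (simp add: sum_3 body_matrix_mult abs_mult)
  also have "\<dots> \<le> body_norm u q x + body_norm u q x + body_norm u q x"
    using order_trans[OF component_le_norm_cart norm_le_body_norm]
    by (intro add_mono) (auto simp: body_norm_def)
  finally show ?thesis by simp
qed

definition body_norm_const :: real where "body_norm_const = 3 + \<bar>u $ 2\<bar> + \<bar>u $ 3\<bar>"

lemma body_norm_le_norm_body_matrix:
  assumes "q \<ge> 0" shows "body_norm u q x \<le> body_norm_const * norm (body_matrix q *v x)"
proof -
  define n where "n = norm (body_matrix q *v x)"
  have n: "exp q * \<bar>x \<bullet> u\<bar> \<le> n" "\<bar>x $ 2\<bar> \<le> n" "\<bar>x $ 3\<bar> \<le> n"
    using component_le_norm_cart[of "body_matrix q *v x" 1]
      component_le_norm_cart[of "body_matrix q *v x" 2]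
      component_le_norm_cart[of "body_matrix q *v x" 3]
    by (simp_all add: body_matrix_mult abs_mult n_def)
  have "1 * \<bar>x \<bullet> u\<bar> \<le> exp q * \<bar>x \<bullet> u\<bar>" using assms by (intro mult_right_mono) auto
  then have xu: "\<bar>x \<bullet> u\<bar> \<le> n" using n by simp
  have "x $ 1 = x \<bullet> u - u $ 2 * x $ 2 - u $ 3 * x $ 3"
    using u1 by (simp add: inner_vec_def sum_3)
  then have "\<bar>x $ 1\<bar> \<le> \<bar>x \<bullet> u\<bar> + \<bar>u $ 2\<bar> * \<bar>x $ 2\<bar> + \<bar>u $ 3\<bar> * \<bar>x $ 3\<bar>"
    by (simp add: abs_mult[symmetric])
  also have "\<dots> \<le> n + \<bar>u $ 2\<bar> * n + \<bar>u $ 3\<bar> * n"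
    using xu n by (intro add_mono mult_left_mono) auto
  finally have x1: "\<bar>x $ 1\<bar> \<le> n + \<bar>u $ 2\<bar> * n + \<bar>u $ 3\<bar> * n" .
  have "norm x \<le> \<bar>x $ 1\<bar> + \<bar>x $ 2\<bar> + \<bar>x $ 3\<bar>"
    using norm_le_l1_cart[of x] by (simp add: sum_3)
  then have "norm x \<le> body_norm_const * n"
    using x1 n(2,3) unfolding body_norm_const_def distrib_right by linarith
  moreover have "0 \<le> n" by (simp add: n_def)
  then have "1 * n \<le> body_norm_const * n" by (intro mult_right_mono) (auto simp: body_norm_const_def)
  ultimately show ?thesis using n by (simp add: body_norm_def n_def)
qed

text \<open>A nonzero integral triple product is at least 1 in absolute value,
  \<open>body_matrix q\<close> multiplies it by \<open>exp q\<close>, and Hadamard's inequality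
  bounds the result; \<open>27 = 3 ^ 3\<close> comes from
  \<open>norm_body_matrix_le\<close>.\<close>

lemma exp_le_body_norm_prod:
  assumes "x \<in> int_lattice" "y \<in> int_lattice" "z \<in> int_lattice" "x \<bullet> (y \<times> z) \<noteq> 0"
  shows "exp q \<le> 27 * (body_norm u q x * body_norm u q y * body_norm u q z)"
proof -
  define A where "A = body_matrix q"
  have "x \<bullet> (y \<times> z) \<in> \<int>" using assms by (intro inner_int_lattice cross_int_lattice)
  then have "1 \<le> \<bar>x \<bullet> (y \<times> z)\<bar>" using assms(4) by (intro Ints_nonzero_abs_ge1)
  then have "exp q * 1 \<le> exp q * \<bar>x \<bullet> (y \<times> z)\<bar>" by (intro mult_left_mono) auto
  also have "\<dots> = \<bar>(A *v x) \<bullet> ((A *v y) \<times> (A *v z))\<bar>"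
    by (simp add: triple_product_matrix A_def det_body_matrix abs_mult)
  also have "\<dots> \<le> norm (A *v x) * norm ((A *v y) \<times> (A *v z))"
    by (rule Cauchy_Schwarz_ineq2)
  also have "\<dots> \<le> norm (A *v x) * (norm (A *v y) * norm (A *v z))"
    by (intro mult_left_mono norm_cross_le) auto
  also have "\<dots> \<le> (3 * body_norm u q x) * ((3 * body_norm u q y) * (3 * body_norm u q z))"
    unfolding A_def by (intro mult_mono norm_body_matrix_le) (auto intro!: mult_nonneg_nonneg body_norm_nonneg)
  finally show ?thesis by (simp add: mult_ac)
qed

text \<open>Independent \<open>x\<close>, \<open>y\<close>, \<open>z\<close> are picked one after
  another from near-optimal sets for the three minima; \<open>216\<close> is
  \<open>27 * 2 ^ 3\<close>.\<close>

lemma lam_prod_ge: "exp q \<le> 216 * (lam u 1 q * lam u 2 q * lam u 3 q)"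
proof -
  obtain r1 where r1: "r1 \<in> admissible_radii u q 1" "r1 < 2 * lam u 1 q"
    using lam_approx[of 1 u q] by auto
  obtain r2 where r2: "r2 \<in> admissible_radii u q 2" "r2 < 2 * lam u 2 q"
    using lam_approx[of 2 u q] by auto
  obtain r3 where r3: "r3 \<in> admissible_radii u q 3" "r3 < 2 * lam u 3 q"
    using lam_approx[of 3 u q] by auto
  obtain B1 where B1: "B1 \<subseteq> int_lattice" "independent B1" "card B1 = 1" "\<forall>x\<in>B1. body_norm u q x \<le> r1"
    using r1 unfolding admissible_radii_def by blast
  obtain B2 where B2: "B2 \<subseteq> int_lattice" "independent B2" "card B2 = 2" "\<forall>x\<in>B2. body_norm u q x \<le> r2"
    using r2 unfolding admissible_radii_def by blast
  obtain B3 where B3: "B3 \<subseteq> int_lattice" "independent B3" "card B3 = 3" "\<forall>x\<in>B3. body_norm u q x \<le> r3"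
    using r3 unfolding admissible_radii_def by blast
  obtain x where x: "x \<in> B1" using B1(3) by (cases "B1 = {}") auto
  then have "x \<noteq> 0" using B1(2) dependent_zero by blast
  obtain y where y: "y \<in> B2" "y \<notin> span {x}" using pair_not_in_line[OF B2(2,3)] by blast
  have "x \<times> y \<noteq> 0" using cross_eq_0_span \<open>x \<noteq> 0\<close> y by blast
  then obtain z where z: "z \<in> B3" "z \<bullet> (x \<times> y) \<noteq> 0" using triple_not_in_plane[OF B3(2,3)] by blast
  have "exp q \<le> 27 * (body_norm u q z * body_norm u q x * body_norm u q y)"
    using x y z B1 B2 B3 by (intro exp_le_body_norm_prod) auto
  also have "\<dots> \<le> 27 * ((2 * lam u 3 q) * (2 * lam u 1 q) * (2 * lam u 2 q))"
  proof -
    have "body_norm u q z \<le> 2 * lam u 3 q" "body_norm u q x \<le> 2 * lam u 1 q" "body_norm u q y \<le> 2 * lam u 2 q"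
      using B1(4) B2(4) B3(4) x y(1) z(1) r1(2) r2(2) r3(2) by fastforce+
    then show ?thesis
      using lam_ge_1[of 1 u q] lam_ge_1[of 2 u q] lam_ge_1[of 3 u q]
      by (intro mult_left_mono mult_mono) (auto intro!: mult_nonneg_nonneg body_norm_nonneg)
  qed
  finally show ?thesis by (simp add: mult_ac)
qed

lemma lam_prod_le:
  assumes "q \<ge> 0" shows "lam u 1 q * lam u 2 q * lam u 3 q \<le> 4096 * body_norm_const ^ 3 * exp q"
proof -
  define g where "g = body_norm u q"
  define K where "K = body_norm_const"
  have K: "K > 0" by (simp add: K_def body_norm_const_def add_pos_nonneg)
  have near: "\<exists>b\<in>int_lattice - span S. \<forall>z\<in>int_lattice - span S. g b \<le> 2 * g z"
    if "finite S" "card S < 3" for S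
  proof (rule near_minimum)
    show "int_lattice - span S \<noteq> {}" using int_lattice_not_subset_span[OF that] by blast
    show "1 \<le> g x" if "x \<in> int_lattice - span S" for x
      using that span_zero[of S] by (auto simp: g_def intro!: body_norm_ge_1)
  qed
  obtain b1 where b1: "b1 \<in> int_lattice - span {}" "\<And>z. z \<in> int_lattice - span {} \<Longrightarrow> g b1 \<le> 2 * g z"
    using near[of "{}"] by auto
  obtain b2 where b2: "b2 \<in> int_lattice - span {b1}" "\<And>z. z \<in> int_lattice - span {b1} \<Longrightarrow> g b2 \<le> 2 * g z"
    using near[of "{b1}"] by auto
  obtain b3 where b3: "b3 \<in> int_lattice - span {b1, b2}"
      "\<And>z. z \<in> int_lattice - span {b1, b2} \<Longrightarrow> g b3 \<le> 2 * g z"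
    using near[of "{b1, b2}"] card_length[of "[b1, b2]"] by auto
  have sub: "span {b1} \<subseteq> span {b1, b2}" by (rule span_mono) auto
  have b10: "b1 \<noteq> 0" using b1 by auto
  have b20: "b2 \<notin> span {}" "b3 \<notin> span {b1}" using b2 b3 sub span_zero[of "{b1}"] by auto
  have cr: "b1 \<times> b2 \<noteq> 0" using cross_eq_0_span b10 b2 by auto
  have b30: "b3 \<noteq> 0" using b3 span_zero[of "{b1, b2}"] by auto
  have pos: "g b1 > 0" "g b2 > 0" "g b3 > 0"
    using b30 body_norm_ge_1[of b1 u q] body_norm_ge_1[of b2 u q] body_norm_ge_1[of b3 u q] b1 b2 b3 b20
      by (auto simp: g_def)
  have le: "g b1 \<le> 2 * g b2" "g b2 \<le> 2 * g b3" using b1(2)[of b2] b2(2)[of b3] b1 b2 b3 b20 by auto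
  have norm: "g z / K \<le> norm (body_matrix q *v z)" for z
    using body_norm_le_norm_body_matrix[OF assms, of z] K by (simp add: g_def K_def field_simps)
  \<comment> \<open>The vectors are minimal only up to a factor 2, and the denominators
    \<open>8\<close>, \<open>4\<close>, \<open>2\<close> restore the order that
    \<open>minkowski_second_dim3\<close> demands. The product of the gauges is then at most
    \<open>8 * 64 * K ^ 3 * exp q\<close>.\<close>
  have "g b1 / (8 * K) * (g b2 / (4 * K)) * (g b3 / (2 * K)) \<le> 8 * \<bar>det (body_matrix q)\<bar>"
  proof (rule minkowski_second_dim3[OF _ cr])
    show "det (body_matrix q) \<noteq> 0" by (simp add: det_body_matrix)
    show "0 < g b1 / (8 * K)" "g b1 / (8 * K) \<le> g b2 / (4 * K)" "g b2 / (4 * K) \<le> g b3 / (2 * K)"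
      using pos K le by (auto simp: field_simps)
    have half: "g b / (2 * K) \<le> norm (body_matrix q *v z)" if "g b \<le> 2 * g z" for b z
    proof -
      have "g b / (2 * K) \<le> g z / K" using that K by (simp add: field_simps)
      then show ?thesis using norm[of z] by linarith
    qed
    have le8: "g b / (8 * K) \<le> g b / (2 * K)" "g b / (4 * K) \<le> g b / (2 * K)" if "g b > 0" for b
      using that K by (auto simp: field_simps)
    show "g b1 / (8 * K) \<le> norm (body_matrix q *v z)" if "z \<in> int_lattice" "z \<noteq> 0" for z
      using half[OF b1(2)[of z]] le8(1)[OF pos(1)] that by auto
    show "g b2 / (4 * K) \<le> norm (body_matrix q *v z)" if "z \<in> int_lattice" "z \<notin> span {b1}" for z
      using half[OF b2(2)[of z]] le8(2)[OF pos(2)] that by auto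
    show "g b3 / (2 * K) \<le> norm (body_matrix q *v z)" if "z \<in> int_lattice" "z \<notin> span {b1, b2}" for z
      using half[OF b3(2)[of z]] that by auto
  qed
  then have prod: "g b1 * g b2 * g b3 \<le> 512 * K ^ 3 * exp q"
    using K by (simp add: det_body_matrix field_simps power3_eq_cube)
  have l1: "lam u 1 q \<le> g b1" unfolding g_def using b1(1) b10 by (intro lam_1_le) auto
  have l2: "lam u 2 q \<le> 2 * g b2"
    using b1 b2 cr le pos by (intro lam_2_le[of b1 b2]) (auto simp: g_def)
  have ind: "independent {b1, b2}" "b1 \<noteq> b2" using independent_pair[OF cr] by auto
  have "independent (insert b3 {b1, b2})" using b3 ind by (metis DiffD2 independent_insertI)
  moreover have "b3 \<notin> {b1, b2}" using b3 span_base[of b3 "{b1, b2}"] by auto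
  then have "card (insert b3 {b1, b2}) = 3" using ind by simp
  ultimately have l3: "lam u 3 q \<le> 4 * g b3"
    using b1 b2 b3 le pos
    by (intro lam_le) (auto simp: admissible_radii_def g_def intro!: exI[of _ "insert b3 {b1, b2}"])
  \<comment> \<open>The factors \<open>1\<close>, \<open>2\<close>, \<open>4\<close> also cover the
    gauges of the earlier vectors, and \<open>8 * 512 = 4096\<close>.\<close>
  have "lam u 1 q * lam u 2 q * lam u 3 q \<le> g b1 * (2 * g b2) * (4 * g b3)"
    using l1 l2 l3 lam_ge_1[of 1 u q] lam_ge_1[of 2 u q] lam_ge_1[of 3 u q] pos
    by (intro mult_mono) (auto intro!: mult_nonneg_nonneg)
  also have "\<dots> \<le> 4096 * K ^ 3 * exp q" using prod by (simp add: mult_ac)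
  finally show ?thesis by (simp add: K_def)
qed

end

section \<open>From integer points to the profile\<close>

text \<open>The two exponentials add up to at most \<open>2 * exp (C - min a b)\<close>, and
  \<open>2 \<le> exp 1\<close> explains the summand 1.\<close>

lemma ln_lower_bound:
  fixes F m a b C :: real
  assumes "F > 0" "exp m \<le> F * (exp (C - a) + exp (C - b))"
  shows "m + min a b - C - 1 \<le> ln F"
proof -
  define e where "e = C - min a b"
  have "exp (C - a) \<le> exp e" "exp (C - b) \<le> exp e" by (auto simp: e_def)
  then have "exp (C - a) + exp (C - b) \<le> 2 * exp e" by linarith
  also have "\<dots> \<le> exp 1 * exp e" using exp_ge_add_one_self[of "1::real"] by (intro mult_right_mono) auto
  finally have "F * (exp (C - a) + exp (C - b)) \<le> F * exp (1 + e)"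
    using assms(1) by (intro mult_left_mono) (auto simp: exp_add)
  with assms(2) have "exp m \<le> F * exp (1 + e)" by linarith
  then have "exp m / exp (1 + e) \<le> F" by (simp add: pos_divide_le_eq)
  then have "exp (m - (1 + e)) \<le> F" by (simp only: exp_diff)
  then have "m - (1 + e) \<le> ln F" using assms(1) by (simp add: ln_ge_iff)
  then show ?thesis by (simp add: e_def)
qed

lemma parallel_of_orthogonal:
  fixes p z z' :: "real^3"
  assumes "p \<noteq> 0" "z \<bullet> p = 0" "z' \<bullet> p = 0"
  shows "\<exists>c. z \<times> z' = c *\<^sub>R p"
proof -
  have "p \<times> (z \<times> z') = 0" using assms by (simp add: Lagrange inner_commute)
  then have "(\<exists>c. z \<times> z' = c *\<^sub>R p) \<or> z \<times> z' = 0"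
    using assms(1) unfolding cross_eq_0[of p] collinear_lemma by blast
  then show ?thesis by (metis scale_zero_left)
qed

text \<open>The points \<open>z k\<close> are the dual points attached to \<open>w_k\<close>, and \<open>p k l\<close> is the symmetric matrix
  \<open>w_(k+1)^l w_k N_(k+1)\<close>, of determinant \<open>d k l\<close>, viewed as a point.\<close>
locale sturmian_points =
  fixes u :: "real^3" and \<omega> :: "nat \<Rightarrow> real" and n :: "nat \<Rightarrow> nat" and \<delta> C :: real and K :: nat
    and z :: "nat \<Rightarrow> real^3" and p :: "nat \<Rightarrow> nat \<Rightarrow> real^3" and d :: "nat \<Rightarrow> nat \<Rightarrow> real"
    and \<kappa> :: "nat \<Rightarrow> real" and x :: "nat \<Rightarrow> nat \<Rightarrow> real"
  assumes u1: "u $ 1 = 1" and C: "C \<ge> 0" and \<delta>: "0 \<le> \<delta>" "\<delta> < 1"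
    and x_def: "\<And>k l. x k l = real l * \<omega> (k + 1) + \<omega> k"
    and \<omega>_large: "\<And>k. k \<ge> K \<Longrightarrow> \<omega> k \<ge> 4 * C + 1"
    and n_pos: "\<And>k. k \<ge> K \<Longrightarrow> n k \<ge> 1"
    and \<omega>_rec: "\<And>k. k \<ge> K \<Longrightarrow> \<bar>\<omega> (k + 2) - x k (n (k + 2))\<bar> \<le> C"
    and z_int: "\<And>k. k \<ge> K \<Longrightarrow> z k \<in> int_lattice"
    and z_norm: "\<And>k. k \<ge> K \<Longrightarrow> norm (z k) \<le> exp (\<omega> k + C)"
    and p_int: "\<And>k l. k \<ge> K \<Longrightarrow> p k l \<in> int_lattice"
    and p_norm_ge: "\<And>k l. k \<ge> K \<Longrightarrow> 1 \<le> l \<Longrightarrow> l \<le> Suc (n (k + 2)) \<Longrightarrow> exp (x k l - C) \<le> norm (p k l)"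
    and p_norm_le: "\<And>k l. k \<ge> K \<Longrightarrow> 1 \<le> l \<Longrightarrow> l \<le> Suc (n (k + 2)) \<Longrightarrow> norm (p k l) \<le> exp (x k l + C)"
    and p_first: "\<And>k l. k \<ge> K \<Longrightarrow> 1 \<le> l \<Longrightarrow> l \<le> Suc (n (k + 2)) \<Longrightarrow> exp (x k l - C) \<le> \<bar>p k l $ 1\<bar>"
    and p_near_u: "\<And>k l. k \<ge> K \<Longrightarrow> 1 \<le> l \<Longrightarrow> l \<le> Suc (n (k + 2)) \<Longrightarrow>
      norm (p k l - (p k l $ 1) *\<^sub>R u) \<le> exp ((\<delta> - 1) * x k l + C)"
    and z_p: "\<And>k l. k \<ge> K \<Longrightarrow> z (k + 1) \<bullet> p k l = 0"
    and p_cross: "\<And>k l. k \<ge> K \<Longrightarrow> p k l \<times> p k (Suc l) = d k l *\<^sub>R z (k + 1)"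
    and d_ge: "\<And>k l. k \<ge> K \<Longrightarrow> 1 \<le> l \<Longrightarrow> l \<le> n (k + 2) \<Longrightarrow> exp (\<delta> * x k l - C) \<le> \<bar>d k l\<bar>"
    and d_le: "\<And>k l. k \<ge> K \<Longrightarrow> 1 \<le> l \<Longrightarrow> l \<le> n (k + 2) \<Longrightarrow> \<bar>d k l\<bar> \<le> exp (\<delta> * x k l + C)"
    and p_link: "\<And>k. k \<ge> K \<Longrightarrow> p k (Suc (n (k + 2))) = p (k + 1) 1"
    and z_cross: "\<And>k. k \<ge> K \<Longrightarrow> z (k + 1) \<times> z (k + 2) = \<kappa> k *\<^sub>R p (k + 1) 1"
    and \<kappa>_ge: "\<And>k. k \<ge> K \<Longrightarrow> exp (- C) \<le> \<bar>\<kappa> k\<bar>"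
    and \<kappa>_le: "\<And>k. k \<ge> K \<Longrightarrow> \<bar>\<kappa> k\<bar> \<le> exp C"
    and content: "\<And>k l c. k \<ge> K \<Longrightarrow> 1 \<le> l \<Longrightarrow> l \<le> Suc (n (k + 2)) \<Longrightarrow> c \<noteq> 0 \<Longrightarrow>
      c *\<^sub>R p k l \<in> int_lattice \<Longrightarrow> exp (- C) \<le> \<bar>c\<bar>"
begin

section \<open>Integer points tested against the block points\<close>

lemma \<omega>_pos: "k \<ge> K \<Longrightarrow> \<omega> k > 0"
  using \<omega>_large[of k] C by simp

lemma p_nonzero:
  assumes "k \<ge> K" "1 \<le> l" "l \<le> Suc (n (k + 2))" shows "p k l \<noteq> 0"
  using p_norm_ge[OF assms] less_le_trans[OF exp_gt_zero] by fastforce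

lemma one_le_n: "k \<ge> K \<Longrightarrow> 1 \<le> n (k + 2)"
  using n_pos[of "k + 2"] by simp

lemma z_nonzero: "k \<ge> K \<Longrightarrow> z (k + 1) \<noteq> 0" "k \<ge> K \<Longrightarrow> z (k + 1) \<times> z (k + 2) \<noteq> 0"
proof -
  assume k: "k \<ge> K"
  have "\<kappa> k \<noteq> 0" using \<kappa>_ge[OF k] less_le_trans[OF exp_gt_zero] by fastforce
  moreover have "p (k + 1) 1 \<noteq> 0" using k by (intro p_nonzero) auto
  ultimately show *: "z (k + 1) \<times> z (k + 2) \<noteq> 0" using z_cross[OF k] by simp
  then show "z (k + 1) \<noteq> 0" by auto
qed

text \<open>Splitting \<open>p k l\<close> into its multiple of \<open>u\<close> and a remainder
  bounds the value \<open>v \<bullet> p k l\<close> by the gauge of \<open>v\<close> times two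
  exponentials, one from the remainder and one from \<open>v \<bullet> u\<close>;
  \<open>ln_lower_bound\<close> inverts this.\<close>

lemma body_norm_of_value:
  assumes k: "k \<ge> K" "1 \<le> l" "l \<le> Suc (n (k + 2))"
    and v: "v \<noteq> 0" "exp m \<le> \<bar>v \<bullet> p k l\<bar>"
  shows "m + min ((1 - \<delta>) * x k l) (q - x k l) - C - 1 \<le> ln (body_norm u q v)"
proof (rule ln_lower_bound)
  define F where "F = body_norm u q v"
  have "norm v \<le> F" using norm_le_body_norm by (simp add: F_def)
  then have F: "F > 0" using v(1) by (simp add: less_le_trans[of 0 "norm v"])
  then show "body_norm u q v > 0" by (simp add: F_def)
  have "exp q * \<bar>v \<bullet> u\<bar> \<le> F" by (simp add: F_def body_norm_def)
  then have vu: "\<bar>v \<bullet> u\<bar> \<le> F * exp (- q)" by (simp add: exp_minus field_simps)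
  have "v \<bullet> p k l = v \<bullet> (p k l - (p k l $ 1) *\<^sub>R u) + (p k l $ 1) * (v \<bullet> u)"
    by (simp add: inner_diff_right)
  then have "\<bar>v \<bullet> p k l\<bar> \<le> \<bar>v \<bullet> (p k l - (p k l $ 1) *\<^sub>R u)\<bar> + \<bar>p k l $ 1\<bar> * \<bar>v \<bullet> u\<bar>"
    by (simp add: abs_mult[symmetric])
  also have "\<dots> \<le> norm v * norm (p k l - (p k l $ 1) *\<^sub>R u) + norm (p k l) * \<bar>v \<bullet> u\<bar>"
    by (intro add_mono Cauchy_Schwarz_ineq2 mult_right_mono component_le_norm_cart) auto
  also have "\<dots> \<le> F * exp ((\<delta> - 1) * x k l + C) + exp (x k l + C) * (F * exp (- q))"
    using \<open>norm v \<le> F\<close> vu F p_near_u[OF k] p_norm_le[OF k] by (intro add_mono mult_mono) auto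
  also have "\<dots> = F * (exp (C - (1 - \<delta>) * x k l) + exp (C - (q - x k l)))"
    by (simp add: distrib_left exp_add[symmetric] mult.left_commute[of _ F] algebra_simps)
  finally show "exp m \<le> body_norm u q v * (exp (C - (1 - \<delta>) * x k l) + exp (C - (q - x k l)))"
    using v(2) by (simp add: F_def)
qed

lemma body_norm_not_orthogonal:
  assumes k: "k \<ge> K" "1 \<le> l" "l \<le> Suc (n (k + 2))"
    and v: "v \<in> int_lattice" "v \<bullet> p k l \<noteq> 0"
  shows "min ((1 - \<delta>) * x k l) (q - x k l) - C - 1 \<le> ln (body_norm u q v)"
proof -
  have "v \<bullet> p k l \<in> \<int>" using v(1) p_int[OF k(1)] by (rule inner_int_lattice)
  then have "1 \<le> \<bar>v \<bullet> p k l\<bar>" using v(2) by (intro Ints_nonzero_abs_ge1)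
  then have "exp 0 \<le> \<bar>v \<bullet> p k l\<bar>" by simp
  moreover have "v \<noteq> 0" using v(2) by auto
  ultimately show ?thesis using body_norm_of_value[OF k, of v 0 q] by simp
qed

text \<open>Both \<open>v\<close> and \<open>z (k + 1)\<close> are orthogonal to
  \<open>p k l\<close>, so their cross product is a multiple of it; being integral and nonzero, it
  cannot be a small multiple when the content is bounded.\<close>

lemma orthogonal_cross:
  assumes k: "k \<ge> K" "1 \<le> l" "l \<le> Suc (n (k + 2))"
    and v: "v \<in> int_lattice" "v \<bullet> p k l = 0" "v \<notin> span {z (k + 1)}"
  shows "\<exists>c. v \<times> z (k + 1) = c *\<^sub>R p k l \<and> exp (- C) \<le> \<bar>c\<bar>"
proof -
  obtain c where c: "v \<times> z (k + 1) = c *\<^sub>R p k l"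
    using parallel_of_orthogonal[OF p_nonzero[OF k] v(2) z_p[OF k(1)]] by blast
  have "z (k + 1) \<times> v \<noteq> 0" using cross_eq_0_span[OF z_nonzero(1)[OF k(1)] v(3)] .
  then have "c \<noteq> 0" using c cross_skew[of v "z (k + 1)"] by auto
  moreover have "c *\<^sub>R p k l \<in> int_lattice"
    unfolding c[symmetric] using v(1) z_int[of "k + 1"] k(1) by (intro cross_int_lattice) auto
  ultimately show ?thesis using content[OF k] c by blast
qed

lemma norm_orthogonal:
  assumes k: "k \<ge> K" "1 \<le> l" "l \<le> Suc (n (k + 2))"
    and v: "v \<in> int_lattice" "v \<bullet> p k l = 0" "v \<notin> span {z (k + 1)}"
  shows "x k l - \<omega> (k + 1) - 3 * C \<le> ln (body_norm u q v)"
proof -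
  obtain c where c: "v \<times> z (k + 1) = c *\<^sub>R p k l" "exp (- C) \<le> \<bar>c\<bar>"
    using orthogonal_cross[OF assms] by blast
  have "exp (- C) * exp (x k l - C) \<le> \<bar>c\<bar> * norm (p k l)"
    using c(2) p_norm_ge[OF k] by (intro mult_mono) auto
  also have "\<dots> = norm (v \<times> z (k + 1))" unfolding c(1) by simp
  also have "\<dots> \<le> norm v * norm (z (k + 1))" by (rule norm_cross_le)
  also have "\<dots> \<le> body_norm u q v * exp (\<omega> (k + 1) + C)"
    using z_norm[of "k + 1"] k(1) norm_le_body_norm body_norm_nonneg by (intro mult_mono) auto
  finally have "exp (x k l - 2 * C) \<le> body_norm u q v * exp (\<omega> (k + 1) + C)"
    by (simp add: exp_add[symmetric])
  then have "exp (x k l - 2 * C) / exp (\<omega> (k + 1) + C) \<le> body_norm u q v"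
    by (simp add: pos_divide_le_eq)
  then have "exp (x k l - 2 * C - (\<omega> (k + 1) + C)) \<le> body_norm u q v" by (simp only: exp_diff)
  moreover have "body_norm u q v > 0" using calculation less_le_trans[OF exp_gt_zero] by blast
  ultimately show ?thesis by (simp add: ln_ge_iff)
qed

text \<open>Expanding \<open>v \<times> (p k l \<times> p k (l + 1))\<close> in two ways.\<close>
lemma value_at_next:
  assumes "k \<ge> K" "p k l \<noteq> 0" "v \<bullet> p k l = 0" "v \<times> z (k + 1) = c *\<^sub>R p k l"
  shows "v \<bullet> p k (Suc l) = c * d k l"
proof -
  have "v \<times> (p k l \<times> p k (Suc l)) = (v \<bullet> p k (Suc l)) *\<^sub>R p k l"
    using assms(3) by (simp add: Lagrange)
  moreover have "v \<times> (p k l \<times> p k (Suc l)) = (c * d k l) *\<^sub>R p k l"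
    unfolding p_cross[OF assms(1)] cross_mult_right assms(4) by simp
  ultimately show ?thesis using assms(2) by simp
qed

text \<open>By \<open>value_at_next\<close>, \<open>v\<close> takes at the following point a value
  of size at least a constant times \<open>d k l\<close>, which yields the summand
  \<open>\<delta> * x k l\<close> beyond the bound 1 for nonzero integers.\<close>

lemma body_norm_next:
  assumes k: "k \<ge> K" "1 \<le> l" "l \<le> n (k + 2)"
    and v: "v \<in> int_lattice" "v \<bullet> p k l = 0" "v \<notin> span {z (k + 1)}"
  shows "\<delta> * x k l + min ((1 - \<delta>) * x k (Suc l)) (q - x k (Suc l)) - 3 * C - 1 \<le> ln (body_norm u q v)"
proof -
  have k': "l \<le> Suc (n (k + 2))" "1 \<le> Suc l" "Suc l \<le> Suc (n (k + 2))" using k by auto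
  obtain c where c: "v \<times> z (k + 1) = c *\<^sub>R p k l" "exp (- C) \<le> \<bar>c\<bar>"
    using orthogonal_cross[OF k(1,2) k'(1) v] by blast
  have "v \<bullet> p k (Suc l) = c * d k l"
    using value_at_next[OF k(1) p_nonzero[OF k(1,2) k'(1)] v(2) c(1)] .
  moreover have "exp (- C) * exp (\<delta> * x k l - C) \<le> \<bar>c\<bar> * \<bar>d k l\<bar>"
    using c(2) d_ge[OF k] by (intro mult_mono) auto
  ultimately have "exp (- C) * exp (\<delta> * x k l - C) \<le> \<bar>v \<bullet> p k (Suc l)\<bar>"
    by (simp only: abs_mult)
  then have "exp (\<delta> * x k l - 2 * C) \<le> \<bar>v \<bullet> p k (Suc l)\<bar>" by (simp add: exp_add[symmetric])
  moreover have "v \<noteq> 0" using v(3) span_zero by blast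
  ultimately show ?thesis using body_norm_of_value[OF k(1) k'(2,3)] by fastforce
qed

lemma x_Suc: "x k (Suc l) = x k l + \<omega> (k + 1)"
  by (simp add: x_def algebra_simps)

lemma x_1: "x k 1 = \<omega> k + \<omega> (Suc k)"
  by (simp add: x_def)

lemma log_lam_ge:
  assumes "0 < j" "j \<le> 3" "exp a \<le> lam u j q" shows "a \<le> log_min u j q"
  using assms lam_ge_1[OF assms(1,2), of u q] by (simp add: log_min_eq ln_ge_iff)

lemma exp_le_body_norm: "v \<noteq> 0 \<Longrightarrow> a \<le> ln (body_norm u q v) \<Longrightarrow> exp a \<le> body_norm u q v"
  using norm_le_body_norm[of v u q] by (simp add: ln_ge_iff less_le_trans[of 0 "norm v"])

text \<open>Points off the line of \<open>z (k + 1)\<close> are either not orthogonal to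
  \<open>p k l\<close>, with value at least 1 there, or orthogonal to it and then tested at
  \<open>p k (Suc l)\<close>.\<close>

lemma log_min_2_ge1:
  assumes k: "k \<ge> K" and l: "1 \<le> l" "l \<le> n (k + 2)"
  shows "min ((1 - \<delta>) * x k l) (min (q - x k l) (\<delta> * x k l + q - x k l - \<omega> (k + 1))) - (3 * C + 1)
    \<le> log_min u 2 q"
proof (intro log_lam_ge lam_2_ge[of "z (k + 1)"])
  fix v assume v: "v \<in> int_lattice" "v \<notin> span {z (k + 1)}"
  have "(1 - \<delta>) * x k l \<le> \<delta> * x k l + (1 - \<delta>) * x k (Suc l)"
  proof -
    have "0 \<le> \<delta> * x k l" "(1 - \<delta>) * x k l \<le> (1 - \<delta>) * x k (Suc l)"
      using \<omega>_pos[of k] \<omega>_pos[of "k + 1"] k \<delta>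
      by (auto simp: x_def mult_nonneg_nonneg intro!: mult_left_mono add_nonneg_nonneg mult_right_mono)
    then show ?thesis by linarith
  qed
  moreover have "\<delta> * x k l + (q - x k (Suc l)) = \<delta> * x k l + q - x k l - \<omega> (k + 1)"
    by (simp add: x_Suc)
  ultimately have "min ((1 - \<delta>) * x k l) (min (q - x k l) (\<delta> * x k l + q - x k l - \<omega> (k + 1))) - (3 * C + 1)
      \<le> ln (body_norm u q v)"
    using body_norm_not_orthogonal[OF k l(1) _ v(1), of q] body_norm_next[OF k l v(1) _ v(2), of q] l C
    by (cases "v \<bullet> p k l = 0") (auto simp: min_def split: if_splits)
  moreover have "v \<noteq> 0" using v(2) span_zero by blast
  ultimately show "exp (min ((1 - \<delta>) * x k l) (min (q - x k l) (\<delta> * x k l + q - x k l - \<omega> (k + 1))) - (3 * C + 1))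
      \<le> body_norm u q v"
    using exp_le_body_norm by blast
qed auto

text \<open>The same division is made at \<open>p k (Suc l)\<close>, but orthogonal points are now
  bounded by their length, through \<open>norm_orthogonal\<close>.\<close>

lemma log_min_2_ge2:
  assumes k: "k \<ge> K" and l: "1 \<le> l" "l \<le> n (k + 2)"
  shows "min (x k l) (min (q - x k l - \<omega> (k + 1)) ((1 - \<delta>) * (x k l + \<omega> (k + 1)))) - (3 * C + 1)
    \<le> log_min u 2 q"
proof (intro log_lam_ge lam_2_ge[of "z (k + 1)"])
  fix v assume v: "v \<in> int_lattice" "v \<notin> span {z (k + 1)}"
  have l': "1 \<le> Suc l" "Suc l \<le> Suc (n (k + 2))" using l by auto
  have "min (x k l) (min (q - x k l - \<omega> (k + 1)) ((1 - \<delta>) * (x k l + \<omega> (k + 1)))) - (3 * C + 1)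
      \<le> ln (body_norm u q v)"
    using body_norm_not_orthogonal[OF k l' v(1), of q] norm_orthogonal[OF k l' v(1) _ v(2), of q] C
    by (cases "v \<bullet> p k (Suc l) = 0") (auto simp: x_Suc min_def split: if_splits)
  moreover have "v \<noteq> 0" using v(2) span_zero by blast
  ultimately show "exp (min (x k l) (min (q - x k l - \<omega> (k + 1)) ((1 - \<delta>) * (x k l + \<omega> (k + 1)))) - (3 * C + 1))
      \<le> body_norm u q v"
    using exp_le_body_norm by blast
qed auto

lemma log_min_3_ge:
  assumes k: "k \<ge> K"
  shows "min ((1 - \<delta>) * x k 1) (q - x k 1) - (C + 1) \<le> log_min u 3 q"
proof (intro log_lam_ge lam_3_ge[of "p k 1"])
  show "p k 1 \<noteq> 0" using k by (intro p_nonzero) auto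
  fix v assume v: "v \<in> int_lattice" "v \<bullet> p k 1 \<noteq> 0"
  have "min ((1 - \<delta>) * x k 1) (q - x k 1) - (C + 1) \<le> ln (body_norm u q v)"
    using body_norm_not_orthogonal[OF k _ _ v, of q] by simp
  moreover have "v \<noteq> 0" using v(2) by auto
  ultimately show "exp (min ((1 - \<delta>) * x k 1) (q - x k 1) - (C + 1)) \<le> body_norm u q v"
    using exp_le_body_norm by blast
qed auto

text \<open>The value of \<open>z k\<close> at \<open>p k 2\<close> is
  \<open>\<kappa> m * d k 1\<close>. Since \<open>p k 2\<close> is close to a multiple of
  \<open>u\<close>, this value determines the size of \<open>z k \<bullet> u\<close>.\<close>

lemma z_inner_u:
  assumes k: "k \<ge> Suc K"
  shows "\<bar>z k \<bullet> u\<bar> \<le> exp (\<omega> k - (2 - \<delta>) * (\<omega> k + \<omega> (Suc k)) + 3 * C + 1)"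
    and "exp (\<omega> k - (2 - \<delta>) * (\<omega> k + \<omega> (Suc k)) - 3 * C - 1) \<le> \<bar>z k \<bullet> u\<bar>"
proof -
  obtain m where m: "k = Suc m" "m \<ge> K" using Suc_le_D[OF k] k by auto
  have k': "k \<ge> K" "k + 1 \<ge> K" using k by auto
  define P where "P = p k 2"
  define X where "X = x k 1"
  have X: "X = \<omega> k + \<omega> (Suc k)" by (simp add: X_def x_def)
  have x2: "x k 2 = X + \<omega> (Suc k)" by (simp add: X x_def)
  have l: "(1::nat) \<le> 2" "2 \<le> Suc (n (k + 2))" using one_le_n[OF k'(1)] by auto
  have "p k 1 \<noteq> 0" using k' by (intro p_nonzero) auto
  \<comment> \<open>\<open>p k 1\<close> also closes the preceding block, whose points are all
    orthogonal to \<open>z k\<close>.\<close>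
  moreover have "z k \<bullet> p k 1 = 0"
    using z_p[OF m(2), of "Suc (n (m + 2))"] p_link[OF m(2)] m(1) by simp
  moreover have "z k \<times> z (k + 1) = \<kappa> m *\<^sub>R p k 1"
    using z_cross[OF m(2)] m(1) by simp
  ultimately have val: "z k \<bullet> P = \<kappa> m * d k 1"
    using value_at_next[OF k'(1), of 1 "z k" "\<kappa> m"] by (simp add: P_def numeral_2_eq_2)
  have "\<bar>\<kappa> m\<bar> * \<bar>d k 1\<bar> \<le> exp C * exp (\<delta> * X + C)"
    using \<kappa>_le[OF m(2)] d_le[OF k'(1) order_refl one_le_n[OF k'(1)]] unfolding X_def by (intro mult_mono) auto
  then have up: "\<bar>z k \<bullet> P\<bar> \<le> exp (\<delta> * X + 2 * C)"
    by (simp add: val abs_mult exp_add[symmetric] add_ac)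
  have "exp (- C) * exp (\<delta> * X - C) \<le> \<bar>\<kappa> m\<bar> * \<bar>d k 1\<bar>"
    using \<kappa>_ge[OF m(2)] d_ge[OF k'(1) order_refl one_le_n[OF k'(1)]] unfolding X_def by (intro mult_mono) auto
  then have lo: "exp (\<delta> * X - 2 * C) \<le> \<bar>z k \<bullet> P\<bar>" by (simp add: val abs_mult exp_add[symmetric])
  define E where "E = z k \<bullet> (P - (P $ 1) *\<^sub>R u)"
  have "\<bar>E\<bar> \<le> norm (z k) * norm (P - (P $ 1) *\<^sub>R u)"
    unfolding E_def by (rule Cauchy_Schwarz_ineq2)
  also have "\<dots> \<le> exp (\<omega> k + C) * exp ((\<delta> - 1) * x k 2 + C)"
    unfolding P_def by (intro mult_mono z_norm p_near_u k' l) auto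
  also have "\<dots> = exp (\<delta> * X - (2 - \<delta>) * \<omega> (Suc k) + 2 * C)"
    by (simp add: exp_add[symmetric] x2 X algebra_simps)
  \<comment> \<open>The threshold \<open>4 * C + 1\<close> of \<open>\<omega>_large\<close> is
    chosen so that \<open>E\<close> is at most half of the lower bound for the value at
    \<open>P\<close>.\<close>
  also have "\<dots> \<le> exp (\<delta> * X - 2 * C - 1)"
  proof -
    have "\<omega> (Suc k) \<ge> 4 * C + 1" using \<omega>_large[of "k + 1"] k' by simp
    moreover have "1 * \<omega> (Suc k) \<le> (2 - \<delta>) * \<omega> (Suc k)"
      using \<delta> \<omega>_pos[of "k + 1"] k' by (intro mult_right_mono) auto
    ultimately show ?thesis by simp
  qed
  finally have E: "\<bar>E\<bar> \<le> exp (\<delta> * X - 2 * C - 1)" .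
  have "exp 1 \<ge> (2::real)" using exp_ge_add_one_self[of "1::real"] by simp
  then have "2 * exp (\<delta> * X - 2 * C - 1) \<le> exp 1 * exp (\<delta> * X - 2 * C - 1)"
    by (intro mult_right_mono) auto
  then have half: "2 * exp (\<delta> * X - 2 * C - 1) \<le> exp (\<delta> * X - 2 * C)"
    by (simp add: exp_add[symmetric])
  have pm: "exp (\<delta> * X - 2 * C) \<le> exp (\<delta> * X + 2 * C)" using C by simp
  have "2 * exp (\<delta> * X + 2 * C) \<le> exp 1 * exp (\<delta> * X + 2 * C)"
    using \<open>exp 1 \<ge> 2\<close> by (intro mult_right_mono) auto
  then have dbl: "2 * exp (\<delta> * X + 2 * C) \<le> exp (\<delta> * X + 2 * C + 1)"
    by (simp add: exp_add[symmetric] add.commute)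
  have split: "z k \<bullet> P = E + P $ 1 * (z k \<bullet> u)"
    by (simp add: E_def inner_diff_right)
  have "\<bar>P $ 1\<bar> * \<bar>z k \<bullet> u\<bar> \<le> \<bar>z k \<bullet> P\<bar> + \<bar>E\<bar>"
    unfolding abs_mult[symmetric] using split by linarith
  also have "\<dots> \<le> exp (\<delta> * X + 2 * C + 1)" using up E half dbl pm exp_gt_zero[of "\<delta> * X - 2 * C - 1"] by linarith
  finally have "\<bar>P $ 1\<bar> * \<bar>z k \<bullet> u\<bar> \<le> exp (\<delta> * X + 2 * C + 1)" .
  moreover have "exp (x k 2 - C) * \<bar>z k \<bullet> u\<bar> \<le> \<bar>P $ 1\<bar> * \<bar>z k \<bullet> u\<bar>"
    unfolding P_def by (intro mult_right_mono p_first k' l) auto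
  ultimately have "exp (x k 2 - C) * \<bar>z k \<bullet> u\<bar> \<le> exp (\<delta> * X + 2 * C + 1)" by linarith
  then have "\<bar>z k \<bullet> u\<bar> \<le> exp (\<delta> * X + 2 * C + 1) / exp (x k 2 - C)"
    by (simp add: pos_le_divide_eq mult.commute)
  also have "\<dots> = exp (\<omega> k - (2 - \<delta>) * (\<omega> k + \<omega> (Suc k)) + 3 * C + 1)"
    unfolding exp_diff[symmetric] by (simp add: x2 X algebra_simps)
  finally show "\<bar>z k \<bullet> u\<bar> \<le> exp (\<omega> k - (2 - \<delta>) * (\<omega> k + \<omega> (Suc k)) + 3 * C + 1)" .
  have "exp (\<delta> * X - 2 * C - 1) \<le> \<bar>z k \<bullet> P\<bar> - \<bar>E\<bar>" using lo E half by linarith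
  also have "\<dots> \<le> \<bar>P $ 1\<bar> * \<bar>z k \<bullet> u\<bar>"
    unfolding abs_mult[symmetric] using split by linarith
  also have "\<dots> \<le> norm P * \<bar>z k \<bullet> u\<bar>"
    by (intro mult_right_mono component_le_norm_cart) auto
  also have "\<dots> \<le> exp (x k 2 + C) * \<bar>z k \<bullet> u\<bar>"
    unfolding P_def by (intro mult_right_mono p_norm_le k' l) auto
  finally have "exp (\<delta> * X - 2 * C - 1) / exp (x k 2 + C) \<le> \<bar>z k \<bullet> u\<bar>"
    by (simp add: pos_divide_le_eq mult.commute)
  moreover have "exp (\<delta> * X - 2 * C - 1) / exp (x k 2 + C) =
      exp (\<omega> k - (2 - \<delta>) * (\<omega> k + \<omega> (Suc k)) - 3 * C - 1)"
    unfolding exp_diff[symmetric] by (simp add: x2 X algebra_simps)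
  ultimately show "exp (\<omega> k - (2 - \<delta>) * (\<omega> k + \<omega> (Suc k)) - 3 * C - 1) \<le> \<bar>z k \<bullet> u\<bar>" by simp
qed

text \<open>The cross product with \<open>z (k + 1)\<close> has logarithmic norm at least about
  \<open>\<omega> k + \<omega> (k + 1)\<close>, and \<open>z (k + 1)\<close> accounts for at most
  about the second summand.\<close>

lemma z_norm_ge:
  assumes k: "k \<ge> Suc K" shows "exp (\<omega> k - 3 * C) \<le> norm (z k)"
proof -
  obtain m where m: "k = Suc m" "m \<ge> K" using Suc_le_D[OF k] k by auto
  have "exp (- C) * exp (x k 1 - C) \<le> \<bar>\<kappa> m\<bar> * norm (p k 1)"
    using k by (intro mult_mono \<kappa>_ge m p_norm_ge) auto
  also have "\<dots> = norm (z k \<times> z (k + 1))" using z_cross[OF m(2)] m(1) by simp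
  also have "\<dots> \<le> norm (z k) * norm (z (k + 1))" by (rule norm_cross_le)
  also have "\<dots> \<le> norm (z k) * exp (\<omega> (k + 1) + C)"
    using k by (intro mult_left_mono z_norm) auto
  finally have "exp (x k 1 - 2 * C) / exp (\<omega> (k + 1) + C) \<le> norm (z k)"
    by (simp add: pos_divide_le_eq exp_add[symmetric])
  then show ?thesis unfolding exp_diff[symmetric] by (simp add: x_def)
qed

text \<open>Up to a constant, the logarithm of the gauge of \<open>z k\<close> at parameter
  \<open>q\<close>; see \<open>body_norm_z\<close>.\<close>

definition traj :: "nat \<Rightarrow> real \<Rightarrow> real" where
  "traj k q = max (\<omega> k) (q + \<omega> k - (2 - \<delta>) * (\<omega> k + \<omega> (Suc k)))"

lemma body_norm_z:
  assumes k: "k \<ge> Suc K"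
  shows "body_norm u q (z k) \<le> exp (traj k q + (3 * C + 1))"
    and "exp (traj k q - (3 * C + 1)) \<le> body_norm u q (z k)"
proof -
  define a where "a = q + \<omega> k - (2 - \<delta>) * (\<omega> k + \<omega> (Suc k))"
  have tr: "traj k q = max (\<omega> k) a" by (simp add: traj_def a_def)
  have "exp q * \<bar>z k \<bullet> u\<bar> \<le> exp q * exp (\<omega> k - (2 - \<delta>) * (\<omega> k + \<omega> (Suc k)) + 3 * C + 1)"
    by (intro mult_left_mono z_inner_u k) auto
  then have "exp q * \<bar>z k \<bullet> u\<bar> \<le> exp (a + (3 * C + 1))"
    by (simp add: exp_add[symmetric] a_def algebra_simps)
  also have "\<dots> \<le> exp (traj k q + (3 * C + 1))" by (simp add: tr)
  finally have 1: "exp q * \<bar>z k \<bullet> u\<bar> \<le> exp (traj k q + (3 * C + 1))" .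
  have "norm (z k) \<le> exp (\<omega> k + C)" using k by (intro z_norm) auto
  also have "\<dots> \<le> exp (traj k q + (3 * C + 1))" using C by (simp add: tr)
  finally show "body_norm u q (z k) \<le> exp (traj k q + (3 * C + 1))"
    using 1 by (simp add: body_norm_def)
  have "exp q * exp (\<omega> k - (2 - \<delta>) * (\<omega> k + \<omega> (Suc k)) - 3 * C - 1) \<le> exp q * \<bar>z k \<bullet> u\<bar>"
    by (intro mult_left_mono z_inner_u k) auto
  then have "exp (a - (3 * C + 1)) \<le> exp q * \<bar>z k \<bullet> u\<bar>"
    by (simp add: exp_add[symmetric] a_def algebra_simps)
  moreover have "exp (\<omega> k - (3 * C + 1)) \<le> exp (\<omega> k - 3 * C)" by simp
  then have "exp (\<omega> k - (3 * C + 1)) \<le> norm (z k)" using z_norm_ge[OF k] by linarith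
  ultimately show "exp (traj k q - (3 * C + 1)) \<le> body_norm u q (z k)"
    unfolding body_norm_def tr by (auto simp: max_def split: if_splits intro: order_trans)
qed

lemma log_lam_le:
  assumes "0 < j" "j \<le> 3" "lam u j q \<le> exp a" shows "log_min u j q \<le> a"
proof -
  have "ln (lam u j q) \<le> ln (exp a)"
    using assms lam_ge_1[OF assms(1,2), of u q] by (intro ln_mono) auto
  then show ?thesis using assms(1) by (simp add: log_min_eq)
qed

lemma log_min_1_le:
  assumes k: "k \<ge> Suc K" shows "log_min u 1 q \<le> traj k q + (3 * C + 1)"
proof (rule log_lam_le)
  obtain m where m: "k = Suc m" "m \<ge> K" using Suc_le_D[OF k] k by auto
  have "lam u 1 q \<le> body_norm u q (z k)"
    using z_nonzero(1)[OF m(2)] m k by (intro lam_1_le z_int) auto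
  also have "\<dots> \<le> exp (traj k q + (3 * C + 1))" by (rule body_norm_z[OF k])
  finally show "lam u 1 q \<le> exp (traj k q + (3 * C + 1))" .
qed auto

lemma log_min_2_le:
  assumes k: "k \<ge> Suc K" shows "log_min u 2 q \<le> max (traj k q) (traj (k + 1) q) + (3 * C + 1)"
proof (rule log_lam_le)
  obtain m where m: "k = Suc m" "m \<ge> K" using Suc_le_D[OF k] k by auto
  have "body_norm u q (z k) \<le> exp (max (traj k q) (traj (k + 1) q) + (3 * C + 1))"
    by (rule order_trans[OF body_norm_z(1)[OF k]]) simp
  moreover have "body_norm u q (z (k + 1)) \<le> exp (max (traj k q) (traj (k + 1) q) + (3 * C + 1))"
    using k by (intro order_trans[OF body_norm_z(1)]) auto
  ultimately show "lam u 2 q \<le> exp (max (traj k q) (traj (k + 1) q) + (3 * C + 1))"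
    using z_nonzero(2)[OF m(2)] m k by (intro lam_2_le[of "z k" "z (k + 1)"] z_int) auto
qed auto

text \<open>A nonzero \<open>v\<close> is not orthogonal to \<open>p k 1\<close>, or orthogonal to
  it and off the line of \<open>z k\<close>, hence of logarithmic length at least about
  \<open>\<omega> (k + 1)\<close>, or a multiple of \<open>z k\<close>. These cases give the terms
  of the minimum.\<close>

lemma log_min_1_ge:
  assumes k: "k \<ge> Suc K"
  shows "min (min ((1 - \<delta>) * (\<omega> k + \<omega> (Suc k))) (q - (\<omega> k + \<omega> (Suc k)))) (min (\<omega> (k + 1)) (traj k q))
    - (5 * C + 1) \<le> log_min u 1 q" (is "?a \<le> _")
proof (intro log_lam_ge lam_1_ge)
  fix v assume v: "v \<in> int_lattice" "v \<noteq> 0"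
  obtain m where m: "k = Suc m" "m \<ge> K" using Suc_le_D[OF k] k by auto
  \<comment> \<open>\<open>p k 1\<close> is read as the closing point \<open>p m l\<close> of the
    previous block, because the estimates for that block refer to
    \<open>z (m + 1) = z k\<close>.\<close>
  define l where "l = Suc (n (m + 2))"
  have l: "1 \<le> l" "l \<le> Suc (n (m + 2))" by (auto simp: l_def)
  have k': "k \<ge> K" using k by simp
  have "?a \<le> ln (body_norm u q v)"
  proof (cases "v \<bullet> p k 1 = 0")
    case False
    then have "min ((1 - \<delta>) * x k 1) (q - x k 1) - C - 1 \<le> ln (body_norm u q v)"
      using k' v by (intro body_norm_not_orthogonal) auto
    then show ?thesis using C unfolding x_1 by (auto simp: min_def split: if_splits)
  next
    case True
    then have vp: "v \<bullet> p m l = 0" using p_link[OF m(2)] by (simp add: l_def m(1))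
    show ?thesis
    proof (cases "v \<in> span {z (m + 1)}")
      case False
      have "x m l - \<omega> (m + 1) - 3 * C \<le> ln (body_norm u q v)"
        by (rule norm_orthogonal[OF m(2) l v(1) vp False])
      moreover have "x m l - \<omega> (m + 1) \<ge> \<omega> (m + 2) - C"
        using \<omega>_rec[OF m(2)] unfolding l_def x_Suc by simp
      ultimately have "\<omega> (k + 1) - (5 * C + 1) \<le> ln (body_norm u q v)"
        using C by (simp add: m(1))
      then show ?thesis by (auto simp: min_def split: if_splits)
    next
      case True
      \<comment> \<open>\<open>z k\<close> may fail to be primitive, so \<open>t\<close> can be a
        fraction; the bounded content of \<open>p k 1\<close> keeps it away from 0.\<close>
      then obtain t where t: "v = t *\<^sub>R z (m + 1)" by (auto simp: span_singleton)
      have tn: "t \<noteq> 0" using t v(2) by auto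
      have "v \<times> z (m + 2) = (t * \<kappa> m) *\<^sub>R p k 1"
        using z_cross[OF m(2)] by (simp add: t cross_mult_left m(1))
      moreover have "v \<times> z (m + 2) \<in> int_lattice"
        using v(1) m by (intro cross_int_lattice z_int) auto
      moreover have "\<kappa> m \<noteq> 0" using \<kappa>_ge[OF m(2)] less_le_trans[OF exp_gt_zero] by fastforce
      ultimately have "exp (- C) \<le> \<bar>t\<bar> * \<bar>\<kappa> m\<bar>"
        using content[OF k', of 1 "t * \<kappa> m"] tn by (simp add: abs_mult)
      also have "\<dots> \<le> \<bar>t\<bar> * exp C" using \<kappa>_le[OF m(2)] by (intro mult_left_mono) auto
      finally have "exp (- C) / exp C \<le> \<bar>t\<bar>" by (simp add: pos_divide_le_eq)
      then have te: "exp (- 2 * C) \<le> \<bar>t\<bar>" unfolding exp_diff[symmetric] by simp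
      have "exp (traj k q - (5 * C + 1)) = exp (- 2 * C) * exp (traj k q - (3 * C + 1))"
        by (simp add: exp_add[symmetric])
      also have "\<dots> \<le> \<bar>t\<bar> * body_norm u q (z k)"
        using te body_norm_z(2)[OF k, of q] by (intro mult_mono) auto
      also have "\<dots> = body_norm u q v" by (simp add: t body_norm_scaleR m(1))
      finally have e: "exp (traj k q - (5 * C + 1)) \<le> body_norm u q v" .
      then have "0 < body_norm u q v" using less_le_trans[OF exp_gt_zero] by blast
      then have "traj k q - (5 * C + 1) \<le> ln (body_norm u q v)" using e by (simp add: ln_ge_iff)
      then show ?thesis by (auto simp: min_def split: if_splits)
    qed
  qed
  then show "exp ?a \<le> body_norm u q v" using exp_le_body_norm v(2) by blast
qed auto

lemma log_min_sum:
  "\<exists>C'\<ge>0. \<forall>q\<ge>0. \<bar>log_min u 1 q + log_min u 2 q + log_min u 3 q - q\<bar> \<le> C'"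
proof -
  define M where "M = ln (4096 * body_norm_const u ^ 3)"
  have bc: "body_norm_const u > 0" by (simp add: body_norm_const_def[OF u1] add_pos_nonneg)
  have "\<bar>log_min u 1 q + log_min u 2 q + log_min u 3 q - q\<bar> \<le> \<bar>M\<bar> + \<bar>ln 216\<bar>" if q: "q \<ge> 0" for q
  proof -
    have pos: "lam u 1 q > 0" "lam u 2 q > 0" "lam u 3 q > 0"
      using lam_ge_1[of 1 u q] lam_ge_1[of 2 u q] lam_ge_1[of 3 u q] by auto
    define S where "S = log_min u 1 q + log_min u 2 q + log_min u 3 q"
    have S: "exp S = lam u 1 q * lam u 2 q * lam u 3 q"
      using pos by (simp add: S_def log_min_eq exp_add)
    have "exp S \<le> exp (M + q)"
      using lam_prod_le[OF u1 q] bc unfolding S M_def by (simp add: exp_add)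
    then have 1: "S \<le> M + q" by simp
    have "exp q \<le> exp (ln 216 + S)"
      using lam_prod_ge[OF u1, of q] unfolding exp_add S by simp
    then have "q \<le> ln 216 + S" by (simp only: exp_le_cancel_iff)
    then show ?thesis using 1 unfolding S_def by linarith
  qed
  then show ?thesis by (intro exI[of _ "\<bar>M\<bar> + \<bar>ln 216\<bar>"]) auto
qed

end

section \<open>Symmetric matrices as points\<close>

text \<open>Chosen so that \<open>zvec A \<bullet> sym_point Y\<close> is the difference of the off-diagonal entries of \<open>A ** Y\<close>
  when \<open>Y\<close> is symmetric.\<close>
definition zvec :: "int^2^2 \<Rightarrow> real^3" where
  "zvec A = vector [- of_int (A $ 2 $ 1), of_int (A $ 1 $ 1 - A $ 2 $ 2), of_int (A $ 1 $ 2)]"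

lemmas mat2_simps = matrix_matrix_mult_def transpose_def vec_eq_iff forall_2 sum_2

lemma symmetric_mat_iff: "symmetric_mat A \<longleftrightarrow> A $ 1 $ 2 = A $ 2 $ 1"
  by (auto simp: symmetric_mat_def mat2_simps)

lemma zvec_int_lattice: "zvec A \<in> int_lattice"
  by (simp add: int_lattice_def forall_3 zvec_def)

lemma sym_point_int_lattice: "sym_point A \<in> int_lattice"
  by (simp add: int_lattice_def forall_3 sym_point_def)

lemma zvec_orthogonal:
  assumes "symmetric_mat Y" "symmetric_mat (A ** Y)"
  shows "zvec A \<bullet> sym_point Y = 0"
proof -
  have "A $ 1 $ 1 * Y $ 1 $ 2 + A $ 1 $ 2 * Y $ 2 $ 2 = A $ 2 $ 1 * Y $ 1 $ 1 + A $ 2 $ 2 * Y $ 1 $ 2"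
    using assms by (simp add: symmetric_mat_iff matrix_matrix_mult_def sum_2)
  then have "real_of_int (- (A $ 2 $ 1) * Y $ 1 $ 1 + (A $ 1 $ 1 - A $ 2 $ 2) * Y $ 1 $ 2 + A $ 1 $ 2 * Y $ 2 $ 2)
      = real_of_int 0"
    by (intro arg_cong[of _ _ real_of_int]) (simp add: algebra_simps)
  then show ?thesis by (simp add: zvec_def sym_point_def inner_vec_def sum_3)
qed

text \<open>The coordinates are polynomial identities modulo the single relation \<open>e\<close>
  that expresses symmetry of \<open>A ** Y\<close>.\<close>

lemma sym_point_cross:
  assumes "symmetric_mat Y" "symmetric_mat (A ** Y)"
  shows "sym_point Y \<times> sym_point (A ** Y) = real_of_int (det Y) *\<^sub>R zvec A"
proof -
  define a b c d where "a = real_of_int (A $ 1 $ 1)" "b = real_of_int (A $ 1 $ 2)"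
    "c = real_of_int (A $ 2 $ 1)" "d = real_of_int (A $ 2 $ 2)"
  define p q r where "p = real_of_int (Y $ 1 $ 1)" "q = real_of_int (Y $ 1 $ 2)"
    "r = real_of_int (Y $ 2 $ 2)"
  have sym: "Y $ 2 $ 1 = Y $ 1 $ 2" using assms(1) by (simp add: symmetric_mat_iff)
  have "real_of_int ((A ** Y) $ 1 $ 2) = real_of_int ((A ** Y) $ 2 $ 1)"
    using assms(2) by (simp add: symmetric_mat_iff)
  then have e: "a * q + b * r = c * p + d * q"
    using sym by (simp add: matrix_matrix_mult_def sum_2 a_b_c_d_def p_q_r_def)
  have "q * (c * q + d * r) - r * (a * q + b * r) = (p * r - q * q) * (- c)"
    "r * (a * p + b * q) - p * (c * q + d * r) = (p * r - q * q) * (a - d)"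
    "p * (a * q + b * r) - q * (a * p + b * q) = (p * r - q * q) * b"
    using e by algebra+
  then show ?thesis
    using sym
    by (simp add: vec_eq_iff forall_3 cross3_def sym_point_def zvec_def det_2
        matrix_matrix_mult_def sum_2 a_b_c_d_def p_q_r_def)
qed

definition adjugate2 :: "int^2^2 \<Rightarrow> int^2^2" where
  "adjugate2 M = vector [vector [M $ 2 $ 2, - M $ 1 $ 2], vector [- M $ 2 $ 1, M $ 1 $ 1]]"

lemma mult_adjugate2: "X ** M ** adjugate2 M = (\<chi> i j. det M * X $ i $ j)"
  by (simp add: mat2_simps adjugate2_def det_2 algebra_simps)

text \<open>The two factorisations of \<open>Y\<close> express the commutator of \<open>A\<close> and \<open>B\<close> through \<open>Y\<close> and the
  antisymmetric part of \<open>M\<close>; the cross product of two such vectors encodes the commutator.\<close>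
lemma zvec_cross:
  assumes "symmetric_mat Y" "Y = A ** B ** M" "Y = B ** A ** transpose M"
  shows "of_int (det M) *\<^sub>R (zvec A \<times> zvec B) = of_int (M $ 2 $ 1 - M $ 1 $ 2) *\<^sub>R sym_point Y"
proof -
  have 1: "Y ** adjugate2 M = (\<chi> i j. det M * (A ** B) $ i $ j)"
    unfolding assms(2) by (rule mult_adjugate2)
  have 2: "Y ** adjugate2 (transpose M) = (\<chi> i j. det M * (B ** A) $ i $ j)"
    unfolding assms(3) using mult_adjugate2[of "B ** A" "transpose M"] by (simp only: det_transpose)
  define m where "m = M $ 2 $ 1 - M $ 1 $ 2"
  have s: "Y $ 2 $ 1 = Y $ 1 $ 2" using assms(1) by (simp add: symmetric_mat_iff)
  have "(Y ** adjugate2 M) $ i $ j - (Y ** adjugate2 (transpose M)) $ i $ j =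
      det M * ((A ** B) $ i $ j - (B ** A) $ i $ j)" for i j
    unfolding 1 2 by (simp add: algebra_simps)
  from this[of 1 1] this[of 1 2] this[of 2 1]
  have e: "det M * ((A ** B) $ 1 $ 1 - (B ** A) $ 1 $ 1) = - (m * Y $ 1 $ 2)"
    "det M * ((A ** B) $ 1 $ 2 - (B ** A) $ 1 $ 2) = m * Y $ 1 $ 1"
    "det M * ((A ** B) $ 2 $ 1 - (B ** A) $ 2 $ 1) = - (m * Y $ 2 $ 2)"
    by (simp_all add: matrix_matrix_mult_def[of Y] sum_2 adjugate2_def transpose_def m_def s algebra_simps)
  have z: "zvec A \<times> zvec B = vector [of_int ((A ** B) $ 1 $ 2 - (B ** A) $ 1 $ 2),
      - of_int ((A ** B) $ 1 $ 1 - (B ** A) $ 1 $ 1), - of_int ((A ** B) $ 2 $ 1 - (B ** A) $ 2 $ 1)]"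
    by (simp add: vec_eq_iff forall_3 cross3_def zvec_def matrix_matrix_mult_def sum_2 algebra_simps)
  have "of_int (det M) * real_of_int t = real_of_int (det M * t)" for t by simp
  then show ?thesis
    unfolding z m_def[symmetric] using e
    by (simp add: vec_eq_iff forall_3 sym_point_def del: of_int_mult of_int_diff) simp
qed

lemma det_mat_pow: "det (mat_pow A l) = det A ^ l"
  by (induction l) (simp_all add: det_mul)

lemma transpose_alt_transpose: "transpose (alt_transpose N k) = alt_transpose N (Suc k)"
  by (simp add: alt_transpose_def)

lemma alt_transpose_Suc_Suc [simp]: "alt_transpose N (Suc (Suc k)) = alt_transpose N k"
  by (simp add: alt_transpose_def)

lemma det_alt_transpose: "det (alt_transpose N k) = det N"
  by (simp add: alt_transpose_def)

text \<open>The block of points \<open>w_(k+1)^l w_k N_(k+1)\<close>; in the notation of the paper this is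
  \<open>y_(t_(k+1) + l - 1)\<close> for \<open>1 \<le> l \<le> s_(k+2)\<close>.\<close>
definition block_point :: "(nat \<Rightarrow> int^2^2) \<Rightarrow> int^2^2 \<Rightarrow> nat \<Rightarrow> nat \<Rightarrow> int^2^2" where
  "block_point w N k l = mat_pow (w (Suc k)) l ** w k ** alt_transpose N (Suc k)"

lemma block_point_Suc: "block_point w N k (Suc l) = w (Suc k) ** block_point w N k l"
  by (simp add: block_point_def matrix_mul_assoc)

lemma block_point_0: "block_point w N k 0 = w k ** alt_transpose N (Suc k)"
  by (simp add: block_point_def)

text \<open>Symmetry of \<open>A ** Y\<close> means \<open>A ** Y = Y ** transpose A\<close>, so
  \<open>A ** (A ** Y)\<close> is \<open>A ** Y ** transpose A\<close>, congruent to
  \<open>Y\<close>.\<close>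

lemma symmetric_next:
  assumes "symmetric_mat Y" "symmetric_mat (A ** Y)" shows "symmetric_mat (A ** (A ** Y))"
proof -
  have "A ** Y = Y ** transpose A"
    using assms unfolding symmetric_mat_def by (metis matrix_transpose_mul)
  then have "A ** (A ** Y) = A ** Y ** transpose A" by (simp add: matrix_mul_assoc)
  then show ?thesis
    using assms(1) unfolding symmetric_mat_def by (simp add: matrix_transpose_mul matrix_mul_assoc)
qed

context
  fixes s :: "nat \<Rightarrow> int" and w :: "nat \<Rightarrow> int^2^2" and N :: "int^2^2"
  assumes sturmian: "sturmian_seq s w" and admissible: "admissible_with w N"
begin

lemma w_rec: "w (Suc (Suc k)) = mat_pow (w (Suc k)) (nat (s (Suc (Suc k)))) ** w k"
proof -
  have "w (Suc k + 1) = mat_pow (w (Suc k)) (nat (s (Suc k + 1))) ** w (Suc k - 1)"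
    using sturmian unfolding sturmian_seq_def by (metis le_add1 plus_1_eq_Suc)
  then show ?thesis by simp
qed

lemma det_w: "det (w k) \<noteq> 0"
  using sturmian unfolding sturmian_seq_def mat_monoid_def by simp

lemma block_point_end: "block_point w N k (nat (s (Suc (Suc k)))) = w (Suc (Suc k)) ** alt_transpose N (Suc k)"
  by (simp add: block_point_def w_rec)

text \<open>Transposing the three symmetric products in turn interchanges \<open>A\<close> and
  \<open>B\<close> at the price of transposing \<open>M\<close>. This is the origin of the
  alternation between \<open>N\<close> and its transpose.\<close>

lemma commuting_factorisations:
  assumes "symmetric_mat (A ** M)" "symmetric_mat (B ** transpose M)"
    and "symmetric_mat (A ** (B ** transpose M))"
  shows "B ** (A ** M) = A ** (B ** transpose M)"
proof -
  have "A ** (B ** transpose M) = transpose (B ** transpose M) ** transpose A"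
    using assms(3) unfolding symmetric_mat_def by (metis matrix_transpose_mul)
  also have "\<dots> = B ** (transpose M ** transpose A)"
    using assms(2) unfolding symmetric_mat_def by (simp add: matrix_mul_assoc)
  also have "transpose M ** transpose A = A ** M"
    using assms(1) unfolding symmetric_mat_def by (simp add: matrix_transpose_mul)
  finally show ?thesis by simp
qed

text \<open>At \<open>k = 0\<close> the three conditions are exactly admissibility. In the step,
  \<open>symmetric_next\<close> carries symmetry through the block, its end supplies the product of
  \<open>w (k + 2)\<close> with \<open>alt_transpose N (Suc k)\<close>, and
  \<open>commuting_factorisations\<close> starts the next block.\<close>

lemma block_symmetric_aux:
  "symmetric_mat (w (Suc k) ** alt_transpose N k) \<and> symmetric_mat (block_point w N k 0) \<and>
    symmetric_mat (block_point w N k 1)"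
proof (induction k)
  case 0
  then show ?case
    using admissible by (simp add: admissible_with_def block_point_def alt_transpose_def)
next
  case (Suc k)
  have sym: "symmetric_mat (block_point w N k l) \<and> symmetric_mat (block_point w N k (Suc l))" for l
    by (induction l) (use Suc in \<open>simp_all add: block_point_Suc symmetric_next\<close>)
  define A where "A = w (Suc k)"
  define B where "B = w (Suc (Suc k))"
  define M where "M = alt_transpose N k"
  have B: "symmetric_mat (B ** transpose M)"
    using sym[of "nat (s (Suc (Suc k)))"] by (simp add: block_point_end B_def M_def transpose_alt_transpose)
  have AB: "symmetric_mat (A ** (B ** transpose M))"
    using sym[of "nat (s (Suc (Suc k)))"]
    by (simp add: block_point_Suc block_point_end B_def A_def M_def transpose_alt_transpose)
  have A: "symmetric_mat (A ** M)" using Suc by (simp add: A_def M_def)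
  have "B ** (A ** M) = A ** (B ** transpose M)" by (rule commuting_factorisations[OF A B AB])
  then have "symmetric_mat (block_point w N (Suc k) 1)"
    using AB by (simp add: block_point_def A_def B_def M_def matrix_mul_assoc)
  moreover have "symmetric_mat (block_point w N (Suc k) 0)"
    using A by (simp add: block_point_0 A_def M_def)
  ultimately show ?case using B by (simp add: B_def M_def transpose_alt_transpose)
qed

lemma block_symmetric: "symmetric_mat (block_point w N k l)"
proof -
  have "symmetric_mat (block_point w N k l) \<and> symmetric_mat (block_point w N k (Suc l))"
    by (induction l) (use block_symmetric_aux[of k] in \<open>simp_all add: block_point_Suc symmetric_next\<close>)
  then show ?thesis by blast
qed

text \<open>Both sides multiply \<open>w (Suc k)\<close> and \<open>w (Suc (Suc k))\<close>, in
  opposite orders, so \<open>commuting_factorisations\<close> applies. This glues consecutive blocks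
  together.\<close>

lemma block_link: "block_point w N k (Suc (nat (s (Suc (Suc k))))) = block_point w N (Suc k) 1"
proof -
  define A where "A = w (Suc k)"
  define B where "B = w (Suc (Suc k))"
  define M where "M = alt_transpose N k"
  have "B ** (A ** M) = A ** (B ** transpose M)"
  proof (rule commuting_factorisations)
    show "symmetric_mat (A ** M)" using block_symmetric_aux[of k] by (simp add: A_def M_def)
    show "symmetric_mat (B ** transpose M)"
      using block_symmetric[of k "nat (s (Suc (Suc k)))"]
      by (simp add: block_point_end B_def M_def transpose_alt_transpose)
    show "symmetric_mat (A ** (B ** transpose M))"
      using block_symmetric[of k "Suc (nat (s (Suc (Suc k))))"]
      by (simp add: block_point_Suc block_point_end B_def A_def M_def transpose_alt_transpose)
  qed
  then show ?thesis
    by (simp add: block_point_Suc block_point_end)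
      (simp add: block_point_def A_def B_def M_def transpose_alt_transpose matrix_mul_assoc)
qed

lemma block_zvec_orthogonal: "zvec (w (Suc k)) \<bullet> sym_point (block_point w N k l) = 0"
  using zvec_orthogonal[OF block_symmetric, of "w (Suc k)" k l] block_symmetric[of k "Suc l"]
  by (simp add: block_point_Suc)

lemma block_cross:
  "sym_point (block_point w N k l) \<times> sym_point (block_point w N k (Suc l)) =
    real_of_int (det (block_point w N k l)) *\<^sub>R zvec (w (Suc k))"
  using sym_point_cross[OF block_symmetric, of "w (Suc k)" k l] block_symmetric[of k "Suc l"]
  by (simp add: block_point_Suc)

text \<open>\<open>block_link\<close> provides the two factorisations required by
  \<open>zvec_cross\<close>; the sign appears because transposing \<open>N\<close> negates its
  antisymmetric part.\<close>

lemma block_zvec_cross: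
  "\<exists>\<epsilon>\<in>{1, -1}. real_of_int (det N) *\<^sub>R (zvec (w (Suc k)) \<times> zvec (w (Suc (Suc k)))) =
    (\<epsilon> * real_of_int (N $ 2 $ 1 - N $ 1 $ 2)) *\<^sub>R sym_point (block_point w N (Suc k) 1)"
proof -
  define Y where "Y = block_point w N (Suc k) 1"
  define M where "M = alt_transpose N (Suc k)"
  have "Y = w (Suc (Suc k)) ** w (Suc k) ** transpose M"
    by (simp add: Y_def block_point_def M_def transpose_alt_transpose)
  moreover have "Y = w (Suc k) ** w (Suc (Suc k)) ** M"
    unfolding Y_def block_link[symmetric]
    by (simp add: block_point_Suc block_point_end M_def matrix_mul_assoc)
  ultimately have "of_int (det M) *\<^sub>R (zvec (w (Suc k)) \<times> zvec (w (Suc (Suc k)))) =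
      of_int (M $ 2 $ 1 - M $ 1 $ 2) *\<^sub>R sym_point Y"
    using zvec_cross[of Y "w (Suc k)" "w (Suc (Suc k))" M] block_symmetric[of "Suc k" 1]
    by (simp add: Y_def)
  then show ?thesis
    unfolding M_def det_alt_transpose Y_def[symmetric]
    by (cases "even (Suc k)") (auto simp: alt_transpose_def transpose_def)
qed

end

section \<open>Norms, content and convergence of integer points\<close>

lemma abs_entries_finite: "finite {\<bar>A $ i $ j\<bar> | i j. True}" for A :: "int^2^2"
proof -
  have "{\<bar>A $ i $ j\<bar> | i j. True} = (\<lambda>(i, j). \<bar>A $ i $ j\<bar>) ` UNIV" by auto
  then show ?thesis by simp
qed

lemma entry_le_max_norm: "\<bar>A $ i $ j\<bar> \<le> max_norm A"
  unfolding max_norm_def by (rule Max_ge[OF abs_entries_finite]) blast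

lemma max_norm_le_iff: "max_norm A \<le> b \<longleftrightarrow> (\<forall>i j. \<bar>A $ i $ j\<bar> \<le> b)"
  unfolding max_norm_def by (subst Max_le_iff[OF abs_entries_finite]) auto

lemma max_norm_nonneg: "0 \<le> max_norm A"
  using entry_le_max_norm[of A 1 1] by linarith

lemma max_norm_ge_1:
  assumes "det A \<noteq> 0" shows "1 \<le> max_norm A"
proof (rule ccontr)
  assume "\<not> ?thesis"
  then have "max_norm A \<le> 0" by simp
  then have "\<forall>i j. A $ i $ j = 0" by (simp add: max_norm_le_iff)
  then show False using assms by (simp add: det_2)
qed

lemma max_norm_mult_le: "max_norm (A ** B) \<le> 2 * max_norm A * max_norm B"
  unfolding max_norm_le_iff
proof (intro allI)
  fix i j
  have "\<bar>A $ i $ k * B $ k $ j\<bar> \<le> max_norm A * max_norm B" for k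
    unfolding abs_mult by (intro mult_mono entry_le_max_norm max_norm_nonneg) auto
  from this[of 1] this[of 2] show "\<bar>(A ** B) $ i $ j\<bar> \<le> 2 * max_norm A * max_norm B"
    by (simp add: matrix_matrix_mult_def sum_2)
qed

lemma max_norm_adjugate2: "max_norm (adjugate2 M) \<le> max_norm M"
  unfolding max_norm_le_iff by (simp add: forall_2 adjugate2_def entry_le_max_norm)

text \<open>Right multiplication by the adjugate undoes \<open>M\<close> up to \<open>det M\<close>,
  which is at least 1 in absolute value.\<close>

lemma max_norm_le_mult:
  assumes "det M \<noteq> 0" shows "max_norm A \<le> 2 * max_norm (A ** M) * max_norm M"
  unfolding max_norm_le_iff
proof (intro allI)
  fix i j
  have "1 * \<bar>A $ i $ j\<bar> \<le> \<bar>det M\<bar> * \<bar>A $ i $ j\<bar>" using assms by (intro mult_right_mono) auto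
  also have "\<dots> = \<bar>(A ** M ** adjugate2 M) $ i $ j\<bar>" by (simp add: mult_adjugate2 abs_mult)
  also have "\<dots> \<le> max_norm (A ** M ** adjugate2 M)" by (rule entry_le_max_norm)
  also have "\<dots> \<le> 2 * max_norm (A ** M) * max_norm (adjugate2 M)" by (rule max_norm_mult_le)
  also have "\<dots> \<le> 2 * max_norm (A ** M) * max_norm M"
    by (intro mult_left_mono max_norm_adjugate2) (simp add: max_norm_nonneg)
  finally show "\<bar>A $ i $ j\<bar> \<le> 2 * max_norm (A ** M) * max_norm M" by simp
qed

lemma norm_vec3_le: "norm x \<le> \<bar>x $ 1\<bar> + \<bar>x $ 2\<bar> + \<bar>x $ 3\<bar>" for x :: "real^3"
  using norm_le_l1_cart[of x] by (simp add: sum_3)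

lemma real_entry_le_max_norm: "\<bar>real_of_int (A $ i $ j)\<bar> \<le> real_of_int (max_norm A)"
  using entry_le_max_norm[of A i j] by (metis of_int_abs of_int_le_iff)

lemma norm_sym_point_le: "norm (sym_point A) \<le> 3 * real_of_int (max_norm A)"
  using norm_vec3_le[of "sym_point A"] real_entry_le_max_norm[of A 1 1]
    real_entry_le_max_norm[of A 1 2] real_entry_le_max_norm[of A 2 2]
  by (simp add: sym_point_def)

lemma norm_sym_point_ge:
  assumes "symmetric_mat A" shows "real_of_int (max_norm A) \<le> norm (sym_point A)"
proof -
  have "\<bar>real_of_int (A $ 1 $ 1)\<bar> \<le> norm (sym_point A)" "\<bar>real_of_int (A $ 1 $ 2)\<bar> \<le> norm (sym_point A)"
    "\<bar>real_of_int (A $ 2 $ 2)\<bar> \<le> norm (sym_point A)"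
    using component_le_norm_cart[of "sym_point A" 1] component_le_norm_cart[of "sym_point A" 2]
      component_le_norm_cart[of "sym_point A" 3] by (simp_all add: sym_point_def)
  then have "\<forall>i j. \<bar>A $ i $ j\<bar> \<le> \<lfloor>norm (sym_point A)\<rfloor>"
    using assms by (simp add: forall_2 symmetric_mat_iff le_floor_iff)
  then have "max_norm A \<le> \<lfloor>norm (sym_point A)\<rfloor>" by (simp add: max_norm_le_iff)
  then show ?thesis by (simp add: le_floor_iff)
qed

lemma norm_zvec_le: "norm (zvec A) \<le> 4 * real_of_int (max_norm A)"
  using norm_vec3_le[of "zvec A"] real_entry_le_max_norm[of A 1 1]
    real_entry_le_max_norm[of A 1 2] real_entry_le_max_norm[of A 2 1] real_entry_le_max_norm[of A 2 2]
  by (simp add: zvec_def)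

text \<open>By Bezout the content \<open>g\<close> is an integral combination of the coordinates, so
  \<open>c * g\<close> is a nonzero integer.\<close>

lemma sym_point_scale_integral:
  assumes "c *\<^sub>R sym_point A \<in> int_lattice" "c \<noteq> 0" "sym_content A \<le> G" "sym_point A \<noteq> 0"
  shows "1 \<le> \<bar>c\<bar> * real_of_int G"
proof -
  define g where "g = sym_content A"
  obtain a b where ab: "a * A $ 1 $ 2 + b * A $ 2 $ 2 = gcd (A $ 1 $ 2) (A $ 2 $ 2)"
    using bezout_int by blast
  obtain a' b' where "a' * A $ 1 $ 1 + b' * gcd (A $ 1 $ 2) (A $ 2 $ 2) = g"
    unfolding g_def sym_content_def using bezout_int by blast
  then have g: "g = a' * A $ 1 $ 1 + b' * (a * A $ 1 $ 2 + b * A $ 2 $ 2)" by (simp add: ab)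
  have int: "c * of_int (A $ 1 $ 1) \<in> \<int>" "c * of_int (A $ 1 $ 2) \<in> \<int>" "c * of_int (A $ 2 $ 2) \<in> \<int>"
    using assms(1) by (simp_all add: int_lattice_def forall_3 sym_point_def)
  have "c * of_int g = of_int a' * (c * of_int (A $ 1 $ 1)) +
      of_int b' * (of_int a * (c * of_int (A $ 1 $ 2)) + of_int b * (c * of_int (A $ 2 $ 2)))"
    unfolding g by (simp add: algebra_simps)
  also have "\<dots> \<in> \<int>" by (intro int Ints_add Ints_mult Ints_of_int)
  finally have "c * of_int g \<in> \<int>" .
  moreover have "g \<noteq> 0"
    using assms(4) by (auto simp: g_def sym_content_def sym_point_def vec_eq_iff forall_3)
  then have "g > 0" unfolding g_def sym_content_def by (simp add: gcd_pos_int less_le)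
  ultimately have "1 \<le> \<bar>c * of_int g\<bar>" using assms(2) by (intro Ints_nonzero_abs_ge1) auto
  also have "\<dots> = \<bar>c\<bar> * of_int g" using \<open>g > 0\<close> by (simp add: abs_mult)
  also have "\<dots> \<le> \<bar>c\<bar> * of_int G" using assms(3) by (intro mult_left_mono) (auto simp: g_def)
  finally show ?thesis .
qed

text \<open>The condition \<open>P\<close> is open and invariant under nonzero scaling, so it
  defines an open set of lines containing that of \<open>u\<close>; this converts the quotient
  topology into ratios of coordinates.\<close>

lemma limitin_proj_plane_ratio:
  fixes v :: "int \<Rightarrow> real^3" and u :: "real^3"
  assumes lim: "limitin proj_plane (\<lambda>i. proj_class (v i)) (proj_class u) at_top"
    and u1: "u $ 1 = 1" and e: "e > 0"
  shows "eventually (\<lambda>i. \<bar>v i $ 2 - u $ 2 * v i $ 1\<bar> < e * \<bar>v i $ 1\<bar> \<and>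
    \<bar>v i $ 3 - u $ 3 * v i $ 1\<bar> < e * \<bar>v i $ 1\<bar>) at_top"
proof -
  define P where "P = (\<lambda>x :: real^3. \<bar>x $ 2 - u $ 2 * x $ 1\<bar> < e * \<bar>x $ 1\<bar> \<and>
    \<bar>x $ 3 - u $ 3 * x $ 1\<bar> < e * \<bar>x $ 1\<bar>)"
  have scale: "P (c *\<^sub>R x) \<longleftrightarrow> P x" if "c \<noteq> 0" for c x
  proof -
    have "\<bar>(c *\<^sub>R x) $ 2 - u $ 2 * (c *\<^sub>R x) $ 1\<bar> = \<bar>c\<bar> * \<bar>x $ 2 - u $ 2 * x $ 1\<bar>"
      "\<bar>(c *\<^sub>R x) $ 3 - u $ 3 * (c *\<^sub>R x) $ 1\<bar> = \<bar>c\<bar> * \<bar>x $ 3 - u $ 3 * x $ 1\<bar>"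
      "e * \<bar>(c *\<^sub>R x) $ 1\<bar> = \<bar>c\<bar> * (e * \<bar>x $ 1\<bar>)"
      by (simp_all add: abs_mult[symmetric] algebra_simps)
    moreover have "\<bar>c\<bar> > 0" using that by simp
    ultimately show ?thesis unfolding P_def by (simp only: mult_less_cancel_left_pos)
  qed
  have same: "P x" if "proj_class x = proj_class x'" "P x'" for x x'
  proof -
    have "x' \<noteq> 0" using that(2) by (auto simp: P_def)
    have "x' \<in> span {x}" using that(1) span_base[of x' "{x'}"] by (simp add: proj_class_def)
    then obtain c where c: "x' = c *\<^sub>R x" by (auto simp: span_singleton)
    then have "c \<noteq> 0" using \<open>x' \<noteq> 0\<close> by auto
    then show ?thesis using scale that(2) c by blast
  qed
  define U where "U = proj_class ` {x. P x}"
  have P0: "x \<noteq> 0" if "P x" for x using that by (auto simp: P_def)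
  have "{x. x \<noteq> 0 \<and> proj_class x \<in> U} = {x. P x}"
    using same P0 by (auto simp: U_def)
  moreover have "open {x. P x}"
    unfolding P_def by (intro open_Collect_conj open_Collect_less continuous_intros)
  ultimately have "openin proj_plane U"
    unfolding openin_proj_plane using P0 by (auto simp: U_def)
  moreover have "proj_class u \<in> U" using u1 e by (auto simp: U_def P_def)
  ultimately have "eventually (\<lambda>i. proj_class (v i) \<in> U) at_top"
    using lim by (simp add: limitin_def)
  then have "eventually (\<lambda>i. P (v i)) at_top"
    by eventually_elim (use same in \<open>auto simp: U_def\<close>)
  then show ?thesis by (simp add: P_def)
qed

text \<open>Halving bounds the sum of all later differences by \<open>2 * c * e i\<close>; the
  subtracted term \<open>2 * c * e (i + k)\<close> is what lets the induction close.\<close>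

lemma geometric_telescope:
  fixes r e :: "nat \<Rightarrow> real"
  assumes step: "\<And>i. i \<ge> I \<Longrightarrow> \<bar>r (Suc i) - r i\<bar> \<le> c * e i"
    and half: "\<And>i. i \<ge> I \<Longrightarrow> e (Suc i) \<le> e i / 2"
    and e: "\<And>i. e i \<ge> 0" and c: "c \<ge> 0" and lim: "r \<longlonglongrightarrow> l" and i: "i \<ge> I"
  shows "\<bar>r i - l\<bar> \<le> 2 * c * e i"
proof -
  have bound: "\<bar>r (i + k) - r i\<bar> \<le> 2 * c * e i - 2 * c * e (i + k)" for k
  proof (induction k)
    case (Suc k)
    have "\<bar>r (Suc (i + k)) - r (i + k)\<bar> \<le> c * e (i + k)" using i by (intro step) simp
    moreover have "c * e (Suc (i + k)) \<le> c * (e (i + k) / 2)" using i c by (intro mult_left_mono half) auto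
    ultimately show ?case using Suc by simp
  qed simp
  have "\<bar>r (i + k) - r i\<bar> \<le> 2 * c * e i" for k
    using bound[of k] mult_nonneg_nonneg[OF c e[of "i + k"]] by linarith
  moreover have "(\<lambda>k. \<bar>r (i + k) - r i\<bar>) \<longlonglongrightarrow> \<bar>l - r i\<bar>"
    using LIMSEQ_ignore_initial_segment[OF lim, of i]
    by (intro tendsto_intros) (simp add: add.commute)
  ultimately have "\<bar>l - r i\<bar> \<le> 2 * c * e i" by (intro LIMSEQ_le_const2) auto
  then show ?thesis by (simp add: abs_minus_commute)
qed

lemma abs_ln_diff_le:
  fixes a b c1 c2 :: real
  assumes "a > 0" "c1 > 0" "c1 * a \<le> b" "b \<le> c2 * a"
  shows "\<bar>ln b - ln a\<bar> \<le> \<bar>ln c1\<bar> + \<bar>ln c2\<bar>"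
proof -
  have b: "b > 0" using assms(1-3) by (meson less_le_trans mult_pos_pos)
  have "c2 > 0"
  proof (rule ccontr)
    assume "\<not> c2 > 0"
    then have "c2 * a \<le> 0" using assms(1) by (simp add: mult_nonpos_nonneg)
    then show False using assms(4) b by simp
  qed
  have "ln (c1 * a) \<le> ln b" using assms b by (intro ln_mono) auto
  moreover have "ln b \<le> ln (c2 * a)" using assms b \<open>c2 > 0\<close> by (intro ln_mono) auto
  ultimately have "ln c1 + ln a \<le> ln b" "ln b \<le> ln c2 + ln a"
    using assms(1,2) \<open>c2 > 0\<close> by (simp_all add: ln_mult)
  then show ?thesis by linarith
qed

text \<open>Here \<open>\<delta> < 1\<close> replaces the bound by \<open>\<sigma>\<close>: norms,
  determinants and the rate of convergence are settled before \<open>\<sigma>\<close>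
  enters.\<close>

locale sturmian_data =
  fixes s :: "nat \<Rightarrow> int" and w :: "nat \<Rightarrow> int^2^2" and N :: "int^2^2" and y :: "int \<Rightarrow> int^2^2"
    and \<delta> \<xi> :: real and u :: "real^3"
  assumes s_bounded: "\<exists>B. \<forall>k. \<bar>s k\<bar> \<le> B"
    and s_0: "s 0 = -1" and s_1: "s 1 = 1" and s_pos: "\<forall>k\<ge>1. s k \<ge> 1"
    and sturmian: "sturmian_seq s w" and admissible: "admissible_with w N"
    and N_nonsym: "\<not> symmetric_mat N"
    and growth: "mult_growth s w"
    and unbounded: "filterlim (\<lambda>i. max_norm (w i)) at_top sequentially"
    and y_seq: "symmetric_seq s w N y"
    and delta_nonneg: "\<delta> \<ge> 0"
    and delta: "(\<lambda>i. real_of_int \<bar>det (w i)\<bar>) \<in> \<Theta>(\<lambda>i. real_of_int (max_norm (w i)) powr \<delta>)"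
    and delta_less_1: "\<delta> < 1"
    and content_bounded: "\<exists>C. \<forall>i\<ge>-2. sym_content (y i) \<le> C"
    and u: "u = vector [1, \<xi>, \<xi>\<^sup>2]"
    and limit: "limitin proj_plane (\<lambda>i. proj_class (sym_point (y i))) (proj_class u) at_top"
begin

definition n :: "nat \<Rightarrow> nat" where "n k = nat (s k)"
definition \<nu> :: "nat \<Rightarrow> real" where "\<nu> k = real_of_int (max_norm (w k))"
definition \<omega> :: "nat \<Rightarrow> real" where "\<omega> k = ln (\<nu> k)"
definition x :: "nat \<Rightarrow> nat \<Rightarrow> real" where "x k l = real l * \<omega> (k + 1) + \<omega> k"
definition p :: "nat \<Rightarrow> nat \<Rightarrow> real^3" where "p k l = sym_point (block_point w N k l)"

lemma n_pos: "k \<ge> 1 \<Longrightarrow> n k \<ge> 1"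
  using s_pos by (auto simp: n_def Suc_le_eq zero_less_nat_eq intro: less_le_trans[of 0 1])

lemma int_n: "k \<ge> 1 \<Longrightarrow> int (n k) = s k"
  using s_pos by (simp add: n_def) (smt (verit))

lemma n_bounded: "\<exists>B. \<forall>k. n k \<le> B"
proof -
  obtain B where "\<And>k. \<bar>s k\<bar> \<le> B" using s_bounded by blast
  then have "n k \<le> nat B" for k unfolding n_def by (intro nat_mono) (metis abs_ge_self order_trans)
  then show ?thesis by blast
qed

lemmas det_w = det_w[OF sturmian admissible]

lemma \<nu>_ge_1: "\<nu> k \<ge> 1"
  using max_norm_ge_1[OF det_w, of k] by (simp add: \<nu>_def)

lemma exp_\<omega>: "exp (\<omega> k) = \<nu> k"
  using \<nu>_ge_1[of k] by (simp add: \<omega>_def)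

lemma \<omega>_lim: "filterlim \<omega> at_top sequentially"
proof -
  have "filterlim (\<lambda>i. real_of_int (max_norm (w i))) at_top sequentially"
    by (rule filterlim_compose[OF filterlim_real_of_int_at_top unbounded])
  then show ?thesis unfolding \<omega>_def \<nu>_def by (rule filterlim_compose[OF ln_at_top])
qed

lemma x_Suc: "x k (Suc l) = x k l + \<omega> (k + 1)"
  by (simp add: x_def algebra_simps)

lemma w_rec: "w (k + 2) = mat_pow (w (k + 1)) (n (k + 2)) ** w k"
  using w_rec[OF sturmian admissible, of k] by (simp add: n_def)

lemma det_N: "det N \<noteq> 0"
  using admissible by (simp add: admissible_with_def mat_monoid_def)

lemma det_power: "det (mat_pow (w (k + 1)) l ** w k) \<noteq> 0"
  using det_w by (simp add: det_mul det_mat_pow)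

text \<open>Multiplicative growth is applied once per factor, each time losing the constant
  \<open>c\<close>; since \<open>s\<close> is bounded, so is the total loss. The growth condition
  reaches one step beyond the block, which admits \<open>l = Suc (n (k + 2))\<close>.\<close>

lemma log_max_norm_power:
  "\<exists>C\<ge>0. \<forall>k l. l \<le> Suc (n (k + 2)) \<longrightarrow>
    \<bar>ln (real_of_int (max_norm (mat_pow (w (k + 1)) l ** w k))) - x k l\<bar> \<le> C"
proof -
  obtain B where B: "\<And>k. n k \<le> B" using n_bounded by blast
  obtain c1 c2 :: real where c: "c1 > 0" "c2 > 0"
    and gr: "\<And>k l. k \<ge> 1 \<Longrightarrow> 1 \<le> l \<Longrightarrow> int l \<le> s (k + 1) + 1 \<Longrightarrow>
      c1 * (real_of_int (max_norm (w k)) * real_of_int (max_norm (mat_pow (w k) (l - 1) ** w (k - 1))))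
        \<le> real_of_int (max_norm (mat_pow (w k) l ** w (k - 1))) \<and>
      real_of_int (max_norm (mat_pow (w k) l ** w (k - 1)))
        \<le> c2 * (real_of_int (max_norm (w k)) * real_of_int (max_norm (mat_pow (w k) (l - 1) ** w (k - 1))))"
    using growth unfolding mult_growth_def Let_def by auto
  define c where "c = \<bar>ln c1\<bar> + \<bar>ln c2\<bar>"
  define m where "m = (\<lambda>k l. real_of_int (max_norm (mat_pow (w (k + 1)) l ** w k)))"
  have m1: "m k l \<ge> 1" for k l
    using max_norm_ge_1[OF det_power, of k l] by (simp add: m_def)
  have step: "\<bar>ln (m k (Suc l)) - (\<omega> (k + 1) + ln (m k l))\<bar> \<le> c" if "Suc l \<le> Suc (n (k + 2))" for k l
  proof -
    have "int (Suc l) \<le> s (k + 1 + 1) + 1" using that int_n[of "k + 2"] by simp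
    from gr[OF _ _ this] have "c1 * (\<nu> (k + 1) * m k l) \<le> m k (Suc l)"
      "m k (Suc l) \<le> c2 * (\<nu> (k + 1) * m k l)"
      by (simp_all add: m_def \<nu>_def)
    moreover have "\<nu> (k + 1) * m k l > 0"
      using \<nu>_ge_1[of "k + 1"] m1[of k l] by (intro mult_pos_pos) auto
    ultimately have "\<bar>ln (m k (Suc l)) - ln (\<nu> (k + 1) * m k l)\<bar> \<le> c"
      unfolding c_def using c by (intro abs_ln_diff_le) auto
    then show ?thesis
      using \<nu>_ge_1[of "k + 1"] m1[of k l] by (simp add: ln_mult \<omega>_def)
  qed
  have "\<bar>ln (m k l) - x k l\<bar> \<le> real l * c" if "l \<le> Suc (n (k + 2))" for k l
    using that
  proof (induction l)
    case 0
    then show ?case by (simp add: m_def x_def \<omega>_def \<nu>_def)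
  next
    case (Suc l)
    then show ?case using step[OF Suc.prems] by (simp add: x_Suc algebra_simps)
  qed
  moreover have "real l * c \<le> real (Suc B) * c" if "l \<le> Suc (n (k + 2))" for k l
    using that B[of "k + 2"] by (intro mult_right_mono) (auto simp: c_def)
  ultimately have "\<bar>ln (m k l) - x k l\<bar> \<le> real (Suc B) * c" if "l \<le> Suc (n (k + 2))" for k l
    using that order_trans by blast
  moreover have "0 \<le> real (Suc B) * c" by (simp add: c_def)
  ultimately show ?thesis unfolding m_def by blast
qed

lemma \<omega>_rec: "\<exists>C\<ge>0. \<forall>k. \<bar>\<omega> (k + 2) - x k (n (k + 2))\<bar> \<le> C"
proof -
  obtain C where C: "C \<ge> 0" "\<forall>k l. l \<le> Suc (n (k + 2)) \<longrightarrow>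
    \<bar>ln (real_of_int (max_norm (mat_pow (w (k + 1)) l ** w k))) - x k l\<bar> \<le> C"
    using log_max_norm_power by blast
  have "\<bar>\<omega> (k + 2) - x k (n (k + 2))\<bar> \<le> C" for k
    unfolding \<omega>_def \<nu>_def w_rec using C(2) by auto
  then show ?thesis using C(1) by blast
qed

lemma block_det: "det (block_point w N k l) = det (w (k + 1)) ^ l * det (w k) * det N"
  by (simp add: block_point_def det_mul det_mat_pow det_alt_transpose)

lemma max_norm_alt_transpose: "max_norm (alt_transpose N k) = max_norm N"
proof -
  have le: "max_norm (transpose A) \<le> max_norm A" for A
    unfolding max_norm_le_iff by (simp add: transpose_def entry_le_max_norm)
  have "max_norm (transpose N) = max_norm N"
    using le[of N] le[of "transpose N"] by simp
  then show ?thesis by (simp add: alt_transpose_def)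
qed

text \<open>The factor \<open>N\<close> or its transpose changes the norm by a bounded factor in
  both directions, from below through \<open>max_norm_le_mult\<close>. In \<open>6 * M\<close>, 2
  comes from the matrix product and 3 from passing to the Euclidean norm.\<close>

lemma log_norm_p:
  "\<exists>C\<ge>0. \<forall>k l. l \<le> Suc (n (k + 2)) \<longrightarrow>
    exp (x k l - C) \<le> norm (p k l) \<and> norm (p k l) \<le> exp (x k l + C)"
proof -
  obtain C where C: "C \<ge> 0" "\<And>k l. l \<le> Suc (n (k + 2)) \<Longrightarrow>
    \<bar>ln (real_of_int (max_norm (mat_pow (w (k + 1)) l ** w k))) - x k l\<bar> \<le> C"
    using log_max_norm_power by blast
  define M where "M = real_of_int (max_norm N)"
  have M: "M \<ge> 1" using max_norm_ge_1[OF det_N] by (simp add: M_def)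
  define D where "D = C + ln (6 * M)"
  have D: "D \<ge> 0" using C(1) M by (simp add: D_def add_nonneg_nonneg)
  have "exp (x k l - D) \<le> norm (p k l) \<and> norm (p k l) \<le> exp (x k l + D)"
    if l: "l \<le> Suc (n (k + 2))" for k l
  proof -
    define A where "A = mat_pow (w (k + 1)) l ** w k"
    define a where "a = real_of_int (max_norm A)"
    have a: "a \<ge> 1" using max_norm_ge_1[OF det_power, of k l] by (simp add: a_def A_def)
    have bp: "block_point w N k l = A ** alt_transpose N (Suc k)" by (simp add: block_point_def A_def)
    have "max_norm A \<le> 2 * max_norm (block_point w N k l) * max_norm N"
      using max_norm_le_mult[of "alt_transpose N (Suc k)" A] det_N
      by (simp add: bp det_alt_transpose max_norm_alt_transpose)
    then have "a \<le> 2 * real_of_int (max_norm (block_point w N k l)) * M"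
      unfolding a_def M_def by (metis of_int_le_iff of_int_mult of_int_numeral)
    also have "\<dots> \<le> 2 * norm (p k l) * M"
      using M norm_sym_point_ge[OF block_symmetric[OF sturmian admissible]]
      by (intro mult_left_mono mult_right_mono) (auto simp: p_def)
    also have "\<dots> \<le> 6 * M * norm (p k l)" using M by (simp add: mult_right_mono)
    finally have lo: "a \<le> 6 * M * norm (p k l)" .
    have "max_norm (block_point w N k l) \<le> 2 * max_norm A * max_norm N"
      using max_norm_mult_le[of A "alt_transpose N (Suc k)"] by (simp add: bp max_norm_alt_transpose)
    then have "real_of_int (max_norm (block_point w N k l)) \<le> 2 * a * M"
      unfolding a_def M_def by (metis of_int_le_iff of_int_mult of_int_numeral)
    then have up: "norm (p k l) \<le> 6 * M * a"
      using norm_sym_point_le[of "block_point w N k l"] unfolding p_def by (simp add: mult_ac)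
    have ea: "exp (ln a) = a" and eM: "exp (ln (6 * M)) = 6 * M" using a M by simp_all
    have la: "\<bar>ln a - x k l\<bar> \<le> C" using C(2)[OF l] by (simp add: a_def A_def)
    have "exp (x k l - D) * (6 * M) = exp (x k l - D) * exp (ln (6 * M))" by (simp only: eM)
    also have "\<dots> = exp (x k l - C)" unfolding exp_add[symmetric] by (simp add: D_def)
    also have "\<dots> \<le> exp (ln a)" using la by simp
    also have "\<dots> \<le> norm (p k l) * (6 * M)" using lo ea by (simp add: mult_ac)
    finally have 1: "exp (x k l - D) \<le> norm (p k l)" using M by simp
    have "norm (p k l) \<le> exp (ln (6 * M)) * exp (ln a)" using up ea eM by simp
    also have "\<dots> = exp (ln (6 * M) + ln a)" by (simp only: exp_add)
    also have "\<dots> \<le> exp (x k l + D)" using la by (simp add: D_def)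
    finally show ?thesis using 1 by blast
  qed
  then show ?thesis using D by blast
qed

lemma log_det_w:
  "\<exists>C\<ge>0. \<exists>K. \<forall>k\<ge>K. \<bar>ln \<bar>real_of_int (det (w k))\<bar> - \<delta> * \<omega> k\<bar> \<le> C"
proof -
  have nu: "norm (real_of_int (max_norm (w i)) powr \<delta>) = \<nu> i powr \<delta>" for i
    using \<nu>_ge_1[of i] by (simp add: \<nu>_def)
  obtain c2 where c2: "c2 > 0" "eventually (\<lambda>i. norm (real_of_int \<bar>det (w i)\<bar>) \<le> c2 * \<nu> i powr \<delta>) sequentially"
    using landau_o.bigE[OF bigthetaD1[OF delta]] unfolding nu by blast
  obtain c1 where c1: "c1 > 0" "eventually (\<lambda>i. c1 * \<nu> i powr \<delta> \<le> norm (real_of_int \<bar>det (w i)\<bar>)) sequentially"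
    using landau_omega.bigE[OF bigthetaD2[OF delta]] unfolding nu by blast
  obtain K where K: "\<And>i. i \<ge> K \<Longrightarrow> \<bar>real_of_int (det (w i))\<bar> \<le> c2 * \<nu> i powr \<delta>"
      "\<And>i. i \<ge> K \<Longrightarrow> c1 * \<nu> i powr \<delta> \<le> \<bar>real_of_int (det (w i))\<bar>"
    using eventually_conj[OF c1(2) c2(2)] unfolding eventually_sequentially by auto
  have "\<bar>ln \<bar>real_of_int (det (w k))\<bar> - \<delta> * \<omega> k\<bar> \<le> \<bar>ln c1\<bar> + \<bar>ln c2\<bar>" if "k \<ge> K" for k
  proof -
    have "\<bar>ln \<bar>real_of_int (det (w k))\<bar> - ln (\<nu> k powr \<delta>)\<bar> \<le> \<bar>ln c1\<bar> + \<bar>ln c2\<bar>"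
      using K[OF that] c1(1) \<nu>_ge_1[of k] by (intro abs_ln_diff_le) auto
    then show ?thesis using \<nu>_ge_1[of k] by (simp add: ln_powr \<omega>_def)
  qed
  then show ?thesis by (intro exI[of _ "\<bar>ln c1\<bar> + \<bar>ln c2\<bar>"]) auto
qed

text \<open>The logarithm of the determinant is a sum over at most \<open>B + 1\<close> copies of
  \<open>w (k + 1)\<close> and one of \<open>w k\<close>, whence the factor
  \<open>real B + 2\<close>.\<close>

lemma log_det_block:
  "\<exists>C\<ge>0. \<exists>K. \<forall>k\<ge>K. \<forall>l. l \<le> Suc (n (k + 2)) \<longrightarrow>
    exp (\<delta> * x k l - C) \<le> \<bar>real_of_int (det (block_point w N k l))\<bar> \<and>
    \<bar>real_of_int (det (block_point w N k l))\<bar> \<le> exp (\<delta> * x k l + C)"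
proof -
  obtain B where B: "\<And>k. n k \<le> B" using n_bounded by blast
  obtain C K where C: "C \<ge> 0" "\<And>k. k \<ge> K \<Longrightarrow> \<bar>ln \<bar>real_of_int (det (w k))\<bar> - \<delta> * \<omega> k\<bar> \<le> C"
    using log_det_w by blast
  define D where "D = (real B + 2) * C + \<bar>ln \<bar>real_of_int (det N)\<bar>\<bar>"
  have "exp (\<delta> * x k l - D) \<le> \<bar>real_of_int (det (block_point w N k l))\<bar> \<and>
    \<bar>real_of_int (det (block_point w N k l))\<bar> \<le> exp (\<delta> * x k l + D)"
    if k: "k \<ge> K" and l: "l \<le> Suc (n (k + 2))" for k l
  proof -
    define g where "g = (\<lambda>k. ln \<bar>real_of_int (det (w k))\<bar>)"
    define a where "a = \<bar>real_of_int (det (block_point w N k l))\<bar>"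
    have pos: "\<bar>real_of_int (det (w j))\<bar> > 0" for j using det_w by simp
    have a: "a > 0" using det_w det_N by (simp add: a_def block_det)
    have "ln a = real l * g (k + 1) + g k + ln \<bar>real_of_int (det N)\<bar>"
      unfolding a_def block_det of_int_mult of_int_power abs_mult power_abs g_def
      using pos det_N by (simp add: ln_mult ln_realpow)
    moreover have "\<bar>real l * g (k + 1) - real l * (\<delta> * \<omega> (k + 1))\<bar> \<le> real l * C"
    proof -
      have "real l * \<bar>g (k + 1) - \<delta> * \<omega> (k + 1)\<bar> \<le> real l * C"
        using C(2)[of "k + 1"] k by (intro mult_left_mono) (auto simp: g_def)
      then show ?thesis by (simp add: abs_mult right_diff_distrib[symmetric])
    qed
    moreover have "real l * C \<le> (real B + 1) * C"
      using l B[of "k + 2"] C(1) by (intro mult_right_mono) auto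
    moreover have "\<bar>g k - \<delta> * \<omega> k\<bar> \<le> C" using C(2)[OF k] by (simp add: g_def)
    moreover have "\<delta> * x k l = real l * (\<delta> * \<omega> (k + 1)) + \<delta> * \<omega> k" by (simp add: x_def algebra_simps)
    moreover have "D = (real B + 1) * C + C + \<bar>ln \<bar>real_of_int (det N)\<bar>\<bar>"
      by (simp add: D_def algebra_simps)
    ultimately have "\<delta> * x k l - D \<le> ln a" "ln a \<le> \<delta> * x k l + D" by linarith+
    then have "exp (\<delta> * x k l - D) \<le> exp (ln a)" "exp (ln a) \<le> exp (\<delta> * x k l + D)" by simp_all
    then show ?thesis unfolding a_def[symmetric] using a by simp
  qed
  moreover have "D \<ge> 0" using C(1) by (simp add: D_def)
  ultimately show ?thesis by blast
qed

lemma log_norm_zvec: "\<exists>C\<ge>0. \<forall>k. norm (zvec (w k)) \<le> exp (\<omega> k + C)"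
proof -
  have "norm (zvec (w k)) \<le> exp (\<omega> k + ln 4)" for k
    using norm_zvec_le[of "w k"] by (simp add: exp_add exp_\<omega>) (simp add: \<nu>_def)
  then show ?thesis by (intro exI[of _ "ln 4"]) auto
qed

text \<open>The absolute value of \<open>\<kappa> k\<close> is that of the constant
  \<open>(N_21 - N_12) / det N\<close>, nonzero because \<open>N\<close> is not symmetric.\<close>

lemma zvec_cross_p:
  "\<exists>C\<ge>0. \<exists>\<kappa> :: nat \<Rightarrow> real. \<forall>k. exp (- C) \<le> \<bar>\<kappa> k\<bar> \<and> \<bar>\<kappa> k\<bar> \<le> exp C \<and>
    zvec (w (k + 1)) \<times> zvec (w (k + 2)) = \<kappa> k *\<^sub>R p (k + 1) 1"
proof -
  define a where "a = real_of_int (N $ 2 $ 1 - N $ 1 $ 2) / real_of_int (det N)"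
  have a: "a \<noteq> 0" using N_nonsym det_N by (simp add: a_def symmetric_mat_iff)
  have "\<exists>\<kappa>. \<bar>\<kappa>\<bar> = \<bar>a\<bar> \<and> zvec (w (k + 1)) \<times> zvec (w (k + 2)) = \<kappa> *\<^sub>R p (k + 1) 1" for k
  proof -
    obtain \<epsilon> where e: "\<epsilon> \<in> {1, -1 :: real}" "real_of_int (det N) *\<^sub>R (zvec (w (Suc k)) \<times> zvec (w (Suc (Suc k)))) =
        (\<epsilon> * real_of_int (N $ 2 $ 1 - N $ 1 $ 2)) *\<^sub>R sym_point (block_point w N (Suc k) 1)"
      using block_zvec_cross[OF sturmian admissible, of k] by blast
    have "zvec (w (Suc k)) \<times> zvec (w (Suc (Suc k))) =
        inverse (real_of_int (det N)) *\<^sub>R (real_of_int (det N) *\<^sub>R (zvec (w (Suc k)) \<times> zvec (w (Suc (Suc k)))))"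
      using det_N by simp
    also have "\<dots> = (\<epsilon> * a) *\<^sub>R p (Suc k) 1"
      unfolding e(2) p_def a_def by (simp add: divide_inverse mult_ac)
    finally show ?thesis using e(1) by (intro exI[of _ "\<epsilon> * a"]) auto
  qed
  then obtain \<kappa> where \<kappa>: "\<And>k. \<bar>\<kappa> k\<bar> = \<bar>a\<bar>"
      "\<And>k. zvec (w (k + 1)) \<times> zvec (w (k + 2)) = \<kappa> k *\<^sub>R p (k + 1) 1"
    by metis
  define C where "C = \<bar>ln \<bar>a\<bar>\<bar>"
  have "exp (- C) \<le> exp (ln \<bar>a\<bar>)" "exp (ln \<bar>a\<bar>) \<le> exp C" by (simp_all add: C_def)
  then have "exp (- C) \<le> \<bar>a\<bar>" "\<bar>a\<bar> \<le> exp C" using a by simp_all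
  moreover have "C \<ge> 0" by (simp add: C_def)
  ultimately show ?thesis using \<kappa> by metis
qed

section \<open>Indexing of the block points as members of the sequence \<open>y\<close>\<close>

lemma partial_sum_Suc: "partial_sum s (k + 2) = partial_sum s (k + 1) + int (n (k + 2))"
  using int_n[of "k + 2"] by (simp add: partial_sum_def)

lemma partial_sum_ge: "int k \<le> partial_sum s (k + 1)"
proof (induction k)
  case 0
  then show ?case using s_0 s_1 by (simp add: partial_sum_def)
next
  case (Suc k)
  then show ?case using partial_sum_Suc[of k] n_pos[of "k + 2"] by simp
qed

lemma partial_sum_mono: "j \<le> k \<Longrightarrow> partial_sum s (j + 1) \<le> partial_sum s (k + 1)"
proof (induction k rule: dec_induct)
  case (step k)
  then show ?case using partial_sum_Suc[of k] by simp
qed simp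

text \<open>The shift by 1 arises because the exponent in \<open>symmetric_seq\<close> is
  \<open>l + 1\<close>. For \<open>l = Suc (n (k + 2))\<close> the index belongs to the next block,
  and \<open>block_link\<close> identifies the two points.\<close>

lemma y_eq_block:
  assumes "1 \<le> l" "l \<le> Suc (n (k + 2))"
  shows "y (partial_sum s (k + 1) + int l - 1) = block_point w N k l"
proof -
  have main: "y (partial_sum s (k + 1) + int l - 1) = block_point w N k l"
    if "1 \<le> l" "l \<le> n (k + 2)" for k l
  proof -
    have "int (l - 1) < s ((k + 1) + 1)" using that int_n[of "k + 2"] by simp
    then have "y (partial_sum s (k + 1) + int (l - 1)) =
        mat_pow (w (k + 1)) (l - 1 + 1) ** w (k + 1 - 1) ** alt_transpose N (k + 1)"
      using y_seq unfolding symmetric_seq_def by (metis le_add2)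
    then show ?thesis using that(1) by (simp add: block_point_def of_nat_diff add_diff_eq)
  qed
  show ?thesis
  proof (cases "l \<le> n (k + 2)")
    case False
    then have l: "l = Suc (n (k + 2))" using assms by simp
    have "y (partial_sum s (k + 1) + int l - 1) = y (partial_sum s (k + 1 + 1) + int 1 - 1)"
      using partial_sum_Suc[of k] by (simp add: l)
    also have "\<dots> = block_point w N (k + 1) 1" using n_pos[of "Suc (Suc (Suc k))"] by (intro main) auto
    also have "\<dots> = block_point w N k l"
      using block_link[OF sturmian admissible, of k] by (simp add: l n_def)
    finally show ?thesis .
  qed (use main assms in auto)
qed

lemma exists_block_index:
  "\<exists>k l. 1 \<le> l \<and> l \<le> n (k + 2) \<and> int i = partial_sum s (k + 1) + int l - 1"
proof (induction i)
  case 0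
  have "partial_sum s 1 = 0" using s_0 s_1 by (simp add: partial_sum_def)
  then show ?case using n_pos[of 2] by (intro exI[of _ 0] exI[of _ 1]) (simp add: numeral_2_eq_2)
next
  case (Suc i)
  then obtain k l where kl: "1 \<le> l" "l \<le> n (k + 2)" "int i = partial_sum s (k + 1) + int l - 1" by blast
  show ?case
  proof (cases "l < n (k + 2)")
    case True
    then show ?thesis using kl by (intro exI[of _ k] exI[of _ "Suc l"]) auto
  next
    case False
    then show ?thesis
      using kl partial_sum_Suc[of k] n_pos[of "Suc (Suc (Suc k))"]
      by (intro exI[of _ "Suc k"] exI[of _ 1]) auto
  qed
qed

lemma p_nonzero: "p k l \<noteq> 0"
proof
  assume "p k l = 0"
  moreover have "real_of_int (max_norm (block_point w N k l)) \<le> norm (p k l)"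
    unfolding p_def by (rule norm_sym_point_ge[OF block_symmetric[OF sturmian admissible]])
  moreover have "det (block_point w N k l) \<noteq> 0" using det_w det_N by (simp add: block_det)
  then have "1 \<le> max_norm (block_point w N k l)" by (rule max_norm_ge_1)
  ultimately show False by simp
qed

lemma content_p:
  "\<exists>C\<ge>0. \<forall>k l c. 1 \<le> l \<longrightarrow> l \<le> Suc (n (k + 2)) \<longrightarrow> c \<noteq> 0 \<longrightarrow>
    c *\<^sub>R p k l \<in> int_lattice \<longrightarrow> exp (- C) \<le> \<bar>c\<bar>"
proof -
  obtain G where G: "\<And>i. i \<ge> -2 \<Longrightarrow> sym_content (y i) \<le> G" using content_bounded by blast
  have "exp (- ln (\<bar>real_of_int G\<bar> + 1)) \<le> \<bar>c\<bar>"
    if "1 \<le> l" "l \<le> Suc (n (k + 2))" "c \<noteq> 0" "c *\<^sub>R p k l \<in> int_lattice" for k l and c :: real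
  proof -
    have "sym_content (block_point w N k l) \<le> G"
      using G[of "partial_sum s (k + 1) + int l - 1"] y_eq_block[OF that(1,2)] partial_sum_ge[of k] that(1)
      by simp
    then have "1 \<le> \<bar>c\<bar> * real_of_int G"
      using that p_nonzero[of k l] unfolding p_def by (intro sym_point_scale_integral) auto
    also have "\<dots> \<le> \<bar>c\<bar> * (\<bar>real_of_int G\<bar> + 1)" by (intro mult_left_mono) auto
    finally show ?thesis by (simp add: exp_minus pos_le_divide_eq field_simps)
  qed
  then show ?thesis by (intro exI[of _ "ln (\<bar>real_of_int G\<bar> + 1)"]) auto
qed

lemma u_components: "u $ 1 = 1" "u $ 2 = \<xi>" "u $ 3 = \<xi>\<^sup>2"
  by (simp_all add: u)

section \<open>Rate of convergence of the points to the direction of \<open>u\<close>\<close>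

definition q :: "nat \<Rightarrow> real^3" where "q i = sym_point (y (int i))"

lemma q_near_u:
  assumes "e > 0"
  shows "eventually (\<lambda>i. \<bar>q i $ 2 - \<xi> * q i $ 1\<bar> < e * \<bar>q i $ 1\<bar> \<and>
    \<bar>q i $ 3 - \<xi>\<^sup>2 * q i $ 1\<bar> < e * \<bar>q i $ 1\<bar>) sequentially"
proof -
  obtain M where M: "\<And>i. i \<ge> M \<Longrightarrow> \<bar>sym_point (y i) $ 2 - \<xi> * sym_point (y i) $ 1\<bar> < e * \<bar>sym_point (y i) $ 1\<bar> \<and>
      \<bar>sym_point (y i) $ 3 - \<xi>\<^sup>2 * sym_point (y i) $ 1\<bar> < e * \<bar>sym_point (y i) $ 1\<bar>"
    using limitin_proj_plane_ratio[OF limit u_components(1) assms]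
    unfolding eventually_at_top_linorder u_components by blast
  show ?thesis
    unfolding eventually_sequentially q_def
  proof (intro exI[of _ "nat M"] allI impI M)
    show "M \<le> int i" if "nat M \<le> i" for i using that by simp
  qed
qed

definition r :: "nat \<Rightarrow> real" where "r i = q i $ 2 / q i $ 1"

lemma r_lim: "r \<longlonglongrightarrow> \<xi>"
proof (rule metric_LIMSEQ_I)
  fix e :: real assume e: "e > 0"
  have "eventually (\<lambda>i. dist (r i) \<xi> < e) sequentially"
    using q_near_u[OF e]
  proof eventually_elim
    case (elim i)
    then have n0: "q i $ 1 \<noteq> 0" by auto
    have "\<bar>r i - \<xi>\<bar> * \<bar>q i $ 1\<bar> < e * \<bar>q i $ 1\<bar>"
      using elim n0 by (simp add: abs_mult[symmetric] r_def left_diff_distrib)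
    then show ?case by (simp add: dist_real_def mult_less_cancel_right)
  qed
  then show "\<exists>M. \<forall>i\<ge>M. dist (r i) \<xi> < e" by (simp add: eventually_sequentially)
qed

lemma q_eq_p:
  assumes "1 \<le> l" "l \<le> Suc (n (k + 2))" "int i = partial_sum s (k + 1) + int l - 1"
  shows "q i = p k l"
  using y_eq_block[OF assms(1,2)] by (simp add: q_def p_def assms(3))

lemma block_index_ge:
  assumes "l \<le> n (k + 2)" "int i = partial_sum s (k + 1) + int l - 1" "partial_sum s (K + 1) \<le> int i"
  shows "k \<ge> K"
proof (rule ccontr)
  assume "\<not> k \<ge> K"
  then have "partial_sum s (k + 1 + 1) \<le> partial_sum s (K + 1)" using partial_sum_mono[of "Suc k" K] by simp
  moreover have "int i < partial_sum s (k + 2)" using assms(1,2) partial_sum_Suc[of k] by simp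
  ultimately show False using assms(3) by simp
qed

definition c0 :: real where "c0 = 3 + \<bar>\<xi>\<bar> + \<xi>\<^sup>2"

lemma c0: "c0 \<ge> 1"
  by (simp add: c0_def add_nonneg_nonneg)

text \<open>As \<open>u $ 1 = 1\<close>, near the direction of \<open>u\<close> the first coordinate
  controls the other two.\<close>

lemma q_first: "eventually (\<lambda>i. norm (q i) \<le> c0 * \<bar>q i $ 1\<bar> \<and> q i $ 1 \<noteq> 0) sequentially"
  using q_near_u[OF zero_less_one]
proof eventually_elim
  case (elim i)
  have "\<bar>q i $ 2\<bar> \<le> \<bar>q i $ 2 - \<xi> * q i $ 1\<bar> + \<bar>\<xi>\<bar> * \<bar>q i $ 1\<bar>"
    "\<bar>q i $ 3\<bar> \<le> \<bar>q i $ 3 - \<xi>\<^sup>2 * q i $ 1\<bar> + \<bar>\<xi>\<^sup>2\<bar> * \<bar>q i $ 1\<bar>"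
    unfolding abs_mult[symmetric] by linarith+
  then have "norm (q i) \<le> \<bar>q i $ 1\<bar> + (1 + \<bar>\<xi>\<bar>) * \<bar>q i $ 1\<bar> + (1 + \<xi>\<^sup>2) * \<bar>q i $ 1\<bar>"
    using norm_vec3_le[of "q i"] elim by (simp add: distrib_right)
  then show ?case using elim by (auto simp: c0_def distrib_right)
qed

text \<open>Consecutive ratios differ by \<open>(q i \<times> q (i + 1)) $ 3\<close> over the product of the first coordinates,
  and these differences decrease geometrically.\<close>
lemma q_convergence:
  "\<exists>c\<ge>0. \<exists>I. \<forall>i\<ge>I. \<bar>r i - \<xi>\<bar> \<le> c * exp ((\<delta> - 2) * ln (norm (q i)))"
proof -
  obtain C1 where C1: "C1 \<ge> 0" "\<And>k l. l \<le> Suc (n (k + 2)) \<Longrightarrow> exp (x k l - C1) \<le> norm (p k l)"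
      "\<And>k l. l \<le> Suc (n (k + 2)) \<Longrightarrow> norm (p k l) \<le> exp (x k l + C1)"
    using log_norm_p by blast
  obtain C2 K2 where C2: "C2 \<ge> 0" "\<And>k l. k \<ge> K2 \<Longrightarrow> l \<le> Suc (n (k + 2)) \<Longrightarrow>
      \<bar>real_of_int (det (block_point w N k l))\<bar> \<le> exp (\<delta> * x k l + C2)"
    using log_det_block by blast
  obtain C3 where C3: "C3 \<ge> 0" "\<And>k. norm (zvec (w k)) \<le> exp (\<omega> k + C3)"
    using log_norm_zvec by blast
  obtain K1 where K1: "\<And>k. k \<ge> K1 \<Longrightarrow> \<omega> k \<ge> 2 * C1 + 1"
    using \<omega>_lim unfolding filterlim_at_top eventually_sequentially by blast
  obtain I1 where I1: "\<And>i. i \<ge> I1 \<Longrightarrow> norm (q i) \<le> c0 * \<bar>q i $ 1\<bar>" "\<And>i. i \<ge> I1 \<Longrightarrow> q i $ 1 \<noteq> 0"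
    using q_first unfolding eventually_sequentially by blast
  define K where "K = max K1 K2"
  define I where "I = max I1 (nat (partial_sum s (K + 1)))"
  define e where "e = (\<lambda>i. exp ((\<delta> - 2) * ln (norm (q i))))"
  \<comment> \<open>Of \<open>5 * C1\<close>, two come from the norms in the denominator and at most
    two more from trading \<open>x k l\<close> for the logarithm of the norm.\<close>
  define c where "c = exp (5 * C1 + C2 + C3) * c0\<^sup>2"
  have c: "c \<ge> 0" by (simp add: c_def)
  have qn: "norm (q i) > 0" if "i \<ge> I" for i
    using I1(2)[of i] that by (auto simp: I_def)
  have main: "\<bar>r (Suc i) - r i\<bar> \<le> c * e i \<and> e (Suc i) \<le> e i / 2" if i: "i \<ge> I" for i
  proof -
    obtain k l where kl: "1 \<le> l" "l \<le> n (k + 2)" "int i = partial_sum s (k + 1) + int l - 1"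
      using exists_block_index by blast
    have "partial_sum s (K + 1) \<le> int i" using i by (simp add: I_def nat_le_iff)
    then have k: "k \<ge> K" using block_index_ge[OF kl(2,3)] by blast
    have qi: "q i = p k l" using kl by (intro q_eq_p) auto
    have qSi: "q (Suc i) = p k (Suc l)" using kl by (intro q_eq_p) auto
    have l: "l \<le> Suc (n (k + 2))" "Suc l \<le> Suc (n (k + 2))" using kl by auto
    have "0 < norm (q i)" "0 < norm (q (Suc i))" using qn i by auto
    then have lnl: "x k l - C1 \<le> ln (norm (q i))" "ln (norm (q i)) \<le> x k l + C1"
      "x k (Suc l) - C1 \<le> ln (norm (q (Suc i)))"
      using C1(2)[OF l(1)] C1(3)[OF l(1)] C1(2)[OF l(2)]
      by (simp_all add: qi qSi ln_ge_iff) (metis exp_gt_zero ln_exp ln_mono less_le_trans)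
    \<comment> \<open>This makes the logarithm of the norm grow by at least 1 per step, which halves
      \<open>e\<close>.\<close>
    have om: "\<omega> (k + 1) \<ge> 2 * C1 + 1" using K1[of "k + 1"] k by (simp add: K_def)
    have "ln (norm (q i)) + 1 \<le> ln (norm (q (Suc i)))" using lnl om by (simp add: x_Suc)
    then have "(2 - \<delta>) * (ln (norm (q i)) + 1) \<le> (2 - \<delta>) * ln (norm (q (Suc i)))"
      using delta_less_1 by (intro mult_left_mono) auto
    then have "(\<delta> - 2) * ln (norm (q (Suc i))) \<le> (\<delta> - 2) * ln (norm (q i)) - 1"
      using delta_less_1 by (simp add: algebra_simps)
    then have "e (Suc i) \<le> exp ((\<delta> - 2) * ln (norm (q i)) - 1)" by (simp add: e_def)
    also have "\<dots> = e i / exp 1" by (simp add: e_def exp_diff)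
    also have "\<dots> \<le> e i / 2"
      using exp_ge_add_one_self[of "1::real"] by (intro divide_left_mono) (auto simp: e_def)
    finally have half: "e (Suc i) \<le> e i / 2" .
    have a0: "q i $ 1 \<noteq> 0" "q (Suc i) $ 1 \<noteq> 0" using I1(2) i by (auto simp: I_def)
    have "(q i \<times> q (Suc i)) $ 3 = real_of_int (det (block_point w N k l)) * zvec (w (Suc k)) $ 3"
      using block_cross[OF sturmian admissible, of k l] by (simp add: qi qSi p_def)
    then have "q i $ 1 * q (Suc i) $ 2 - q i $ 2 * q (Suc i) $ 1 =
        real_of_int (det (block_point w N k l)) * zvec (w (Suc k)) $ 3"
      by (simp add: cross3_def)
    then have "(r (Suc i) - r i) * (q i $ 1 * q (Suc i) $ 1) =
        real_of_int (det (block_point w N k l)) * zvec (w (Suc k)) $ 3"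
      using a0 by (simp add: r_def field_simps)
    then have "\<bar>r (Suc i) - r i\<bar> * (\<bar>q i $ 1\<bar> * \<bar>q (Suc i) $ 1\<bar>) =
        \<bar>real_of_int (det (block_point w N k l))\<bar> * \<bar>zvec (w (Suc k)) $ 3\<bar>"
      by (simp only: abs_mult[symmetric])
    also have "\<dots> \<le> exp (\<delta> * x k l + C2) * exp (\<omega> (k + 1) + C3)"
      using C2(2)[of k l] k l(1) order_trans[OF component_le_norm_cart C3(2)[of "k + 1"]]
      by (intro mult_mono) (auto simp: K_def)
    finally have num: "\<bar>r (Suc i) - r i\<bar> * (\<bar>q i $ 1\<bar> * \<bar>q (Suc i) $ 1\<bar>) \<le> exp (\<delta> * x k l + C2 + \<omega> (k + 1) + C3)"
      by (simp add: exp_add[symmetric] add.assoc)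
    have "exp (x k l - C1) * exp (x k (Suc l) - C1) \<le> norm (q i) * norm (q (Suc i))"
      unfolding qi qSi using C1(2) l by (intro mult_mono) auto
    also have "\<dots> \<le> (c0 * \<bar>q i $ 1\<bar>) * (c0 * \<bar>q (Suc i) $ 1\<bar>)"
      using I1(1) i c0 by (intro mult_mono) (auto simp: I_def)
    finally have den: "exp (x k l + x k (Suc l) - 2 * C1) \<le> c0\<^sup>2 * (\<bar>q i $ 1\<bar> * \<bar>q (Suc i) $ 1\<bar>)"
      by (simp add: exp_add[symmetric] power2_eq_square mult_ac algebra_simps)
    have "\<bar>r (Suc i) - r i\<bar> * exp (x k l + x k (Suc l) - 2 * C1) \<le>
        \<bar>r (Suc i) - r i\<bar> * (c0\<^sup>2 * (\<bar>q i $ 1\<bar> * \<bar>q (Suc i) $ 1\<bar>))"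
      using den by (intro mult_left_mono) auto
    also have "\<dots> = c0\<^sup>2 * (\<bar>r (Suc i) - r i\<bar> * (\<bar>q i $ 1\<bar> * \<bar>q (Suc i) $ 1\<bar>))" by simp
    also have "\<dots> \<le> c0\<^sup>2 * exp (\<delta> * x k l + C2 + \<omega> (k + 1) + C3)"
      using num by (intro mult_left_mono) auto
    finally have "\<bar>r (Suc i) - r i\<bar> \<le>
        c0\<^sup>2 * (exp (\<delta> * x k l + C2 + \<omega> (k + 1) + C3) / exp (x k l + x k (Suc l) - 2 * C1))"
      by (simp add: pos_le_divide_eq)
    also have "\<dots> = c0\<^sup>2 * exp ((\<delta> - 2) * x k l + 2 * C1 + C2 + C3)"
      unfolding exp_diff[symmetric] by (simp add: x_Suc algebra_simps)
    also have "\<dots> \<le> c0\<^sup>2 * exp ((5 * C1 + C2 + C3) + (\<delta> - 2) * ln (norm (q i)))"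
    proof -
      have "(2 - \<delta>) * ln (norm (q i)) \<le> (2 - \<delta>) * (x k l + C1)"
        using lnl(2) delta_less_1 by (intro mult_left_mono) auto
      moreover have "0 \<le> \<delta> * C1" using delta_nonneg C1(1) by simp
      ultimately show ?thesis using C1(1) by (intro mult_left_mono) (auto simp: algebra_simps)
    qed
    also have "\<dots> = c * e i" by (simp only: c_def e_def exp_add) (simp add: mult_ac)
    finally show ?thesis using half by blast
  qed
  have "\<bar>r i - \<xi>\<bar> \<le> 2 * c * e i" if "i \<ge> I" for i
    using main that by (intro geometric_telescope[OF _ _ _ c r_lim]) (auto simp: e_def)
  then show ?thesis unfolding e_def using c by (intro exI[of _ "2 * c"] conjI exI[of _ I]) auto
qed

text \<open>The second coordinate is controlled by \<open>q_convergence\<close>. The determinant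
  \<open>D\<close> expresses the third through the first two, so its error consists of the same
  difference \<open>\<rho> - \<xi>\<close> and of \<open>D / p k l $ 1\<close>; both contribute at
  most a constant times \<open>exp ((\<delta> - 1) * x k l)\<close>.\<close>

lemma p_near_u:
  "\<exists>C\<ge>0. \<exists>K. \<forall>k\<ge>K. \<forall>l. 1 \<le> l \<longrightarrow> l \<le> Suc (n (k + 2)) \<longrightarrow>
    exp (x k l - C) \<le> \<bar>p k l $ 1\<bar> \<and>
    norm (p k l - (p k l $ 1) *\<^sub>R u) \<le> exp ((\<delta> - 1) * x k l + C)"
proof -
  obtain C1 where C1: "C1 \<ge> 0" "\<And>k l. l \<le> Suc (n (k + 2)) \<Longrightarrow> exp (x k l - C1) \<le> norm (p k l)"
      "\<And>k l. l \<le> Suc (n (k + 2)) \<Longrightarrow> norm (p k l) \<le> exp (x k l + C1)"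
    using log_norm_p by blast
  obtain C2 K2 where C2: "C2 \<ge> 0" "\<And>k l. k \<ge> K2 \<Longrightarrow> l \<le> Suc (n (k + 2)) \<Longrightarrow>
      \<bar>real_of_int (det (block_point w N k l))\<bar> \<le> exp (\<delta> * x k l + C2)"
    using log_det_block by blast
  obtain c I1 where c: "c \<ge> 0" "\<And>i. i \<ge> I1 \<Longrightarrow> \<bar>r i - \<xi>\<bar> \<le> c * exp ((\<delta> - 2) * ln (norm (q i)))"
    using q_convergence by blast
  obtain I2 where I2: "\<And>i. i \<ge> I2 \<Longrightarrow> norm (q i) \<le> c0 * \<bar>q i $ 1\<bar>" "\<And>i. i \<ge> I2 \<Longrightarrow> q i $ 1 \<noteq> 0"
    using q_first unfolding eventually_sequentially by blast
  obtain I3 where I3: "\<And>i. i \<ge> I3 \<Longrightarrow> \<bar>r i - \<xi>\<bar> < 1"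
    using metric_LIMSEQ_D[OF r_lim zero_less_one] unfolding dist_real_def by blast
  define K where "K = max K2 (max I1 (max I2 I3))"
  define M where "M = c * (2 + 2 * \<bar>\<xi>\<bar>) * exp (3 * C1) + c0 * exp (C1 + C2)"
  define C where "C = C1 + \<bar>ln M\<bar> + ln c0"
  have M: "M > 0" using c(1) c0 by (auto simp: M_def intro!: add_nonneg_pos mult_nonneg_nonneg)
  have "exp (x k l - C) \<le> \<bar>p k l $ 1\<bar> \<and>
      norm (p k l - (p k l $ 1) *\<^sub>R u) \<le> exp ((\<delta> - 1) * x k l + C)"
    if k: "k \<ge> K" and l: "1 \<le> l" "l \<le> Suc (n (k + 2))" for k l
  proof -
    define i where "i = nat (partial_sum s (k + 1) + int l - 1)"
    have ii: "int i = partial_sum s (k + 1) + int l - 1" using partial_sum_ge[of k] l(1) by (simp add: i_def)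
    \<comment> \<open>The index of a point is at least that of its block, so thresholds for
      \<open>i\<close> become thresholds for \<open>k\<close>.\<close>
    have i: "i \<ge> k" using ii partial_sum_ge[of k] l(1) by linarith
    have qi: "q i = p k l" by (rule q_eq_p[OF l ii])
    define a where "a = \<bar>p k l $ 1\<bar>"
    have a0: "a > 0" using I2(2)[of i] i k by (simp add: a_def qi K_def)
    have "exp (x k l - C1) \<le> norm (p k l)" using C1(2) l by blast
    also have "\<dots> \<le> c0 * a" using I2(1)[of i] i k by (simp add: a_def qi K_def)
    finally have lo: "exp (x k l - C1) \<le> c0 * a" .
    have ec: "exp (ln c0) = c0" using c0 by simp
    have "exp (x k l - C1) / c0 \<le> a" using lo c0 by (simp add: pos_divide_le_eq mult.commute)
    moreover have "exp (x k l - C1 - ln c0) = exp (x k l - C1) / c0" by (simp only: exp_diff ec)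
    ultimately have "exp (x k l - C1 - ln c0) \<le> a" by simp
    moreover have "exp (x k l - C) \<le> exp (x k l - C1 - ln c0)" by (simp add: C_def)
    ultimately have first: "exp (x k l - C) \<le> \<bar>p k l $ 1\<bar>" unfolding a_def by linarith
    have up: "a \<le> exp (x k l + C1)"
      using order_trans[OF component_le_norm_cart C1(3)[OF l(2)]] by (simp add: a_def)
    define \<rho> where "\<rho> = p k l $ 2 / p k l $ 1"
    have \<rho>: "\<rho> = r i" by (simp add: \<rho>_def r_def qi)
    have a1: "p k l $ 1 \<noteq> 0" using a0 by (simp add: a_def)
    define D where "D = real_of_int (det (block_point w N k l))"
    have D: "D = p k l $ 1 * p k l $ 3 - (p k l $ 2)\<^sup>2"
      using block_symmetric[OF sturmian admissible, of k l]
      by (simp add: D_def p_def sym_point_def det_2 symmetric_mat_iff power2_eq_square)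
    have e2: "p k l $ 2 - \<xi> * p k l $ 1 = p k l $ 1 * (\<rho> - \<xi>)"
      using a1 by (simp add: \<rho>_def field_simps)
    have "p k l $ 3 - \<xi>\<^sup>2 * p k l $ 1 = p k l $ 1 * (\<rho>\<^sup>2 - \<xi>\<^sup>2) + D / p k l $ 1"
      using a1 unfolding D \<rho>_def by (simp add: field_simps power2_eq_square)
    also have "\<rho>\<^sup>2 - \<xi>\<^sup>2 = (\<rho> - \<xi>) * (\<rho> + \<xi>)" by (simp add: power2_eq_square algebra_simps)
    finally have e3: "p k l $ 3 - \<xi>\<^sup>2 * p k l $ 1 = p k l $ 1 * ((\<rho> - \<xi>) * (\<rho> + \<xi>)) + D / p k l $ 1" .
    have "norm (p k l - (p k l $ 1) *\<^sub>R u) \<le> \<bar>p k l $ 2 - \<xi> * p k l $ 1\<bar> + \<bar>p k l $ 3 - \<xi>\<^sup>2 * p k l $ 1\<bar>"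
      using norm_vec3_le[of "p k l - (p k l $ 1) *\<^sub>R u"] by (simp add: u_components mult.commute)
    also have "\<dots> \<le> a * \<bar>\<rho> - \<xi>\<bar> + (a * (\<bar>\<rho> - \<xi>\<bar> * \<bar>\<rho> + \<xi>\<bar>) + \<bar>D\<bar> / a)"
      unfolding e2 e3 a_def
      by (intro add_mono order_trans[OF abs_triangle_ineq]) (simp_all add: abs_mult)
    also have "\<dots> = a * \<bar>\<rho> - \<xi>\<bar> * (1 + \<bar>\<rho> + \<xi>\<bar>) + \<bar>D\<bar> / a" by (simp add: algebra_simps)
    also have "\<dots> \<le> a * \<bar>\<rho> - \<xi>\<bar> * (2 + 2 * \<bar>\<xi>\<bar>) + \<bar>D\<bar> / a"
    proof -
      have "\<bar>\<rho> - \<xi>\<bar> < 1" unfolding \<rho> using I3[of i] i k by (simp add: K_def)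
      then have "1 + \<bar>\<rho> + \<xi>\<bar> \<le> 2 + 2 * \<bar>\<xi>\<bar>" by linarith
      then show ?thesis using a0 by (intro add_right_mono mult_left_mono) auto
    qed
    also have "\<dots> \<le> c * (2 + 2 * \<bar>\<xi>\<bar>) * exp (3 * C1) * exp ((\<delta> - 1) * x k l) +
        c0 * exp (C1 + C2) * exp ((\<delta> - 1) * x k l)"
    proof (rule add_mono)
      have "x k l - C1 \<le> ln (norm (q i))"
        using C1(2)[OF l(2)] p_nonzero[of k l] by (simp add: qi ln_ge_iff)
      then have "(2 - \<delta>) * (x k l - C1) \<le> (2 - \<delta>) * ln (norm (q i))"
        using delta_less_1 by (intro mult_left_mono) auto
      moreover have "0 \<le> \<delta> * C1" using delta_nonneg C1(1) by simp
      ultimately have "(\<delta> - 2) * ln (norm (q i)) \<le> (\<delta> - 2) * x k l + 2 * C1"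
        by (simp add: algebra_simps)
      then have "c * exp ((\<delta> - 2) * ln (norm (q i))) \<le> c * exp ((\<delta> - 2) * x k l + 2 * C1)"
        using c(1) by (intro mult_left_mono) auto
      then have "\<bar>\<rho> - \<xi>\<bar> \<le> c * exp ((\<delta> - 2) * x k l + 2 * C1)"
        unfolding \<rho> using c(2)[of i] i k by (simp add: K_def)
      then have "a * \<bar>\<rho> - \<xi>\<bar> \<le> exp (x k l + C1) * (c * exp ((\<delta> - 2) * x k l + 2 * C1))"
        using up a0 by (intro mult_mono) auto
      also have "\<dots> = c * (exp (x k l + C1) * exp ((\<delta> - 2) * x k l + 2 * C1))" by simp
      also have "\<dots> = c * (exp (3 * C1) * exp ((\<delta> - 1) * x k l))"
        unfolding exp_add[symmetric] by (simp add: algebra_simps)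
      finally have "a * \<bar>\<rho> - \<xi>\<bar> * (2 + 2 * \<bar>\<xi>\<bar>) \<le> c * (exp (3 * C1) * exp ((\<delta> - 1) * x k l)) * (2 + 2 * \<bar>\<xi>\<bar>)"
        by (intro mult_right_mono) auto
      then show "a * \<bar>\<rho> - \<xi>\<bar> * (2 + 2 * \<bar>\<xi>\<bar>) \<le> c * (2 + 2 * \<bar>\<xi>\<bar>) * exp (3 * C1) * exp ((\<delta> - 1) * x k l)"
        by (simp only: mult_ac)
      have "\<bar>D\<bar> * exp (x k l - C1) \<le> exp (\<delta> * x k l + C2) * (c0 * a)"
        unfolding D_def using lo C2(2)[of k l] k l by (intro mult_mono) (auto simp: K_def)
      then have "\<bar>D\<bar> / a \<le> c0 * (exp (\<delta> * x k l + C2) / exp (x k l - C1))"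
        using a0 by (simp add: field_simps)
      also have "\<dots> = c0 * exp (C1 + C2) * exp ((\<delta> - 1) * x k l)"
        unfolding exp_diff[symmetric] mult.assoc exp_add[symmetric] by (simp add: algebra_simps)
      finally show "\<bar>D\<bar> / a \<le> c0 * exp (C1 + C2) * exp ((\<delta> - 1) * x k l)" .
    qed
    also have "\<dots> = M * exp ((\<delta> - 1) * x k l)" by (simp add: M_def distrib_right)
    also have "\<dots> = exp ((\<delta> - 1) * x k l + ln M)" using M by (simp add: exp_add)
    also have "\<dots> \<le> exp ((\<delta> - 1) * x k l + C)"
      using C1(1) ln_ge_zero[OF c0] unfolding C_def exp_le_cancel_iff by linarith
    finally show ?thesis using first by blast
  qed
  moreover have "C \<ge> 0" using C1(1) c0 by (simp add: C_def add_nonneg_nonneg)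
  ultimately show ?thesis by blast
qed

end

section \<open>Continued fractions and ratios of logarithms\<close>

lemma inverse_diff_le:
  fixes a b h :: real
  assumes "a \<ge> 1" "b \<ge> 1" "b - a \<le> h" "h \<ge> 0" shows "1 / a - 1 / b \<le> h"
proof -
  have "1 * 1 \<le> a * b" using assms by (intro mult_mono) auto
  then have "h * 1 \<le> h * (a * b)" using assms by (intro mult_left_mono) auto
  then have "b - a \<le> h * (a * b)" using assms by simp
  then have "(b - a) / (a * b) \<le> h" using assms by (simp add: pos_divide_le_eq)
  moreover have "1 / a - 1 / b = (b - a) / (a * b)" using assms by (simp add: field_simps)
  ultimately show ?thesis by simp
qed

lemma contraction_tendsto_0:
  fixes d \<epsilon> :: "nat \<Rightarrow> real"
  assumes d: "\<And>k. d k \<ge> 0" and \<theta>: "0 \<le> \<theta>" "\<theta> < 1"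
    and step: "\<And>k. k \<ge> K \<Longrightarrow> d (Suc k) \<le> \<theta> * d k + \<epsilon> k" and \<epsilon>: "\<epsilon> \<longlonglongrightarrow> 0"
  shows "d \<longlonglongrightarrow> 0"
proof (rule metric_LIMSEQ_I)
  fix e :: real assume e: "e > 0"
  \<comment> \<open>With this \<open>h\<close>, \<open>e / 2\<close> is the fixed point of
    \<open>t \<mapsto> \<theta> * t + h\<close>, so the bound below reproduces itself.\<close>
  define h where "h = (1 - \<theta>) * (e / 2)"
  have "h > 0" using e \<theta> by (simp add: h_def)
  then obtain M where M: "\<And>k. k \<ge> M \<Longrightarrow> \<bar>\<epsilon> k\<bar> < h"
    using metric_LIMSEQ_D[OF \<epsilon>] unfolding dist_real_def by (metis diff_zero)
  define k0 where "k0 = max K M"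
  have bound: "d (k0 + j) \<le> \<theta> ^ j * d k0 + e / 2" for j
  proof (induction j)
    case 0
    then show ?case using e by simp
  next
    case (Suc j)
    have "d (Suc (k0 + j)) \<le> \<theta> * d (k0 + j) + h"
    proof -
      have "K \<le> k0 + j" "M \<le> k0 + j" by (simp_all add: k0_def)
      then show ?thesis using step[of "k0 + j"] M[of "k0 + j"] by linarith
    qed
    also have "\<theta> * d (k0 + j) \<le> \<theta> * (\<theta> ^ j * d k0 + e / 2)" using Suc \<theta> by (intro mult_left_mono) auto
    also have "\<theta> * (\<theta> ^ j * d k0 + e / 2) + h = \<theta> ^ Suc j * d k0 + e / 2"
      by (simp add: h_def field_simps)
    finally show ?case by simp
  qed
  have "(\<lambda>j. \<theta> ^ j * d k0) \<longlonglongrightarrow> 0"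
    using tendsto_mult_right[OF LIMSEQ_realpow_zero[OF \<theta>], of "d k0"] by simp
  from metric_LIMSEQ_D[OF this half_gt_zero[OF e]]
  obtain J where J: "\<And>j. j \<ge> J \<Longrightarrow> \<bar>\<theta> ^ j * d k0\<bar> < e / 2"
    unfolding dist_real_def diff_zero by blast
  show "\<exists>no. \<forall>k\<ge>no. dist (d k) 0 < e"
  proof (intro exI[of _ "k0 + J"] allI impI)
    fix k assume "k \<ge> k0 + J"
    then have j: "k = k0 + (k - k0)" "k - k0 \<ge> J" by auto
    have "d (k0 + (k - k0)) < e" using bound[of "k - k0"] J[OF j(2)] by linarith
    then have "d k < e" using j(1) by simp
    then show "dist (d k) 0 < e" using d[of k] by simp
  qed
qed

lemma cfrac_Cons: "xs \<noteq> [] \<Longrightarrow> cfrac (a # xs) = of_int a + 1 / cfrac xs"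
  by (cases xs) simp_all

locale bounded_quotients =
  fixes s :: "nat \<Rightarrow> int" and \<sigma> B :: real
  assumes s_le: "\<And>k. of_int (s k) \<le> B" and s_pos: "\<And>k. k \<ge> 1 \<Longrightarrow> s k \<ge> 1"
    and \<sigma>: "\<sigma> = sturm_sigma s"
begin

definition c :: "nat \<Rightarrow> real" where "c k = cfrac (rev (map s [1..<k + 2]))"

lemma c_Suc: "c (Suc k) = of_int (s (k + 2)) + 1 / c k"
  unfolding c_def by (simp add: cfrac_Cons)

lemma B: "B \<ge> 1"
  using s_le[of 1] s_pos[of 1] by linarith

lemma c_bounds: "1 \<le> c k \<and> c k \<le> B + 1"
proof (induction k)
  case 0
  then show ?case using s_pos[of 1] s_le[of 1] by (simp add: c_def)
next
  case (Suc k)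
  have "0 < 1 / c k" "1 / c k \<le> 1" using Suc by auto
  moreover have "1 \<le> real_of_int (s (k + 2))" using s_pos[of "k + 2"] by simp
  ultimately show ?case unfolding c_Suc using s_le[of "k + 2"] by linarith
qed

text \<open>The gap above 1, obtained from the upper bound for the previous value, supplies the
  contraction factor in \<open>ratio_diff_lim\<close>.\<close>

lemma c_Suc_ge: "c (Suc k) \<ge> 1 + 1 / (B + 1)"
proof -
  have "1 / (B + 1) \<le> 1 / c k" using c_bounds[of k] by (intro divide_left_mono) auto
  moreover have "1 \<le> real_of_int (s (k + 2))" using s_pos[of "k + 2"] by simp
  ultimately show ?thesis unfolding c_Suc by linarith
qed

text \<open>The bounds on \<open>c\<close> make the upper limit finite, so
  \<open>real_of_ereal\<close> in \<open>sturm_sigma\<close> returns its true value.\<close>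

lemma limsup_c: "\<exists>R\<ge>1. limsup (\<lambda>k. ereal (c k)) = ereal R \<and> \<sigma> = 1 / R"
proof -
  have "limsup (\<lambda>k. ereal (c k)) \<le> ereal (B + 1)"
    using c_bounds by (intro Limsup_bounded) auto
  moreover have "ereal 1 \<le> limsup (\<lambda>k. ereal (c k))"
    using c_bounds by (intro le_Limsup) auto
  ultimately obtain R where R: "limsup (\<lambda>k. ereal (c k)) = ereal R"
    by (cases "limsup (\<lambda>k. ereal (c k))") auto
  moreover have "\<sigma> = 1 / R" using R unfolding \<sigma> sturm_sigma_def c_def by simp
  ultimately show ?thesis using \<open>ereal 1 \<le> _\<close> by (intro exI[of _ R]) auto
qed

lemma \<sigma>_pos: "\<sigma> > 0"
  using limsup_c by auto

end

locale log_recurrence = bounded_quotients +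
  fixes \<omega> :: "nat \<Rightarrow> real" and C :: real
  assumes \<omega>_lim: "filterlim \<omega> at_top sequentially"
    and \<omega>_rec: "\<And>k. \<bar>\<omega> (k + 2) - (of_int (s (k + 2)) * \<omega> (k + 1) + \<omega> k)\<bar> \<le> C"
begin

lemma ratio_ge_1:
  "eventually (\<lambda>k. \<omega> k > 0 \<and> \<omega> (Suc k) > 0 \<and> \<omega> (Suc k) / \<omega> k \<ge> 1) sequentially"
proof -
  have "eventually (\<lambda>k. \<omega> k \<ge> \<bar>C\<bar> + 1) sequentially"
    using \<omega>_lim by (simp add: filterlim_at_top)
  then obtain M where M: "\<And>k. k \<ge> M \<Longrightarrow> \<omega> k \<ge> \<bar>C\<bar> + 1" by (auto simp: eventually_sequentially)
  show ?thesis
    unfolding eventually_sequentially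
  proof (intro exI[of _ "Suc M"] allI impI)
    fix k assume "k \<ge> Suc M"
    then obtain m where m: "k = Suc m" "m \<ge> M" by (metis Suc_le_D Suc_le_mono)
    have pos: "\<omega> m \<ge> \<bar>C\<bar> + 1" "\<omega> k \<ge> \<bar>C\<bar> + 1" using M[of m] M[of k] m by auto
    have "1 * \<omega> k \<le> of_int (s (m + 2)) * \<omega> k"
      using s_pos[of "m + 2"] pos by (intro mult_right_mono) auto
    then have "\<omega> k \<le> \<omega> (Suc k)" using \<omega>_rec[of m] pos by (simp add: m(1))
    moreover have "\<omega> k > 0" using pos(2) abs_ge_zero[of C] by linarith
    ultimately show "\<omega> k > 0 \<and> \<omega> (Suc k) > 0 \<and> \<omega> (Suc k) / \<omega> k \<ge> 1" by simp
  qed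
qed

text \<open>Dividing the recurrence for \<open>\<omega>\<close> by \<open>\<omega> (k + 1)\<close>
  shows that the ratios obey the recursion of the continued fractions up to
  \<open>C / \<omega> (k + 1)\<close>. The inversion in that recursion shrinks differences by
  \<open>\<theta>\<close>, since the product of the two values is at least
  \<open>1 + 1 / (B + 1)\<close>.\<close>

lemma ratio_diff_lim: "(\<lambda>k. \<bar>\<omega> (Suc k) / \<omega> k - c k\<bar>) \<longlonglongrightarrow> 0"
proof -
  obtain M where M: "\<And>k. k \<ge> M \<Longrightarrow> \<omega> k > 0" "\<And>k. k \<ge> M \<Longrightarrow> \<omega> (Suc k) > 0"
      "\<And>k. k \<ge> M \<Longrightarrow> \<omega> (Suc k) / \<omega> k \<ge> 1"
    using ratio_ge_1 unfolding eventually_sequentially by blast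
  define \<theta> where "\<theta> = 1 / (1 + 1 / (B + 1))"
  define \<rho> where "\<rho> = (\<lambda>k. \<omega> (Suc k) / \<omega> k)"
  have th: "1 + 1 / (B + 1) > 1" using B by simp
  have step: "\<bar>\<rho> (Suc k) - c (Suc k)\<bar> \<le> \<theta> * \<bar>\<rho> k - c k\<bar> + \<bar>C\<bar> / \<omega> (Suc k)" if k: "k \<ge> Suc M" for k
  proof -
    have kM: "k \<ge> M" "Suc k \<ge> M" using k by auto
    have ck: "c k \<ge> 1 + 1 / (B + 1)" using c_Suc_ge[of "k - 1"] k by simp
    have rk: "\<rho> k \<ge> 1" using M(3)[OF kM(1)] by (simp add: \<rho>_def)
    have "\<rho> (Suc k) - (of_int (s (k + 2)) + 1 / \<rho> k) =
        (\<omega> (k + 2) - (of_int (s (k + 2)) * \<omega> (k + 1) + \<omega> k)) / \<omega> (Suc k)"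
      using M[OF kM(1)] by (simp add: \<rho>_def field_simps)
    then have "\<bar>\<rho> (Suc k) - (of_int (s (k + 2)) + 1 / \<rho> k)\<bar> \<le> \<bar>C\<bar> / \<omega> (Suc k)"
      using \<omega>_rec[of k] M(2)[OF kM(1)] by (simp add: abs_divide divide_right_mono)
    moreover have "\<bar>1 / \<rho> k - 1 / c k\<bar> \<le> \<theta> * \<bar>\<rho> k - c k\<bar>"
    proof -
      have c0: "c k > 0" using ck th by linarith
      have "1 / \<rho> k - 1 / c k = (c k - \<rho> k) / (\<rho> k * c k)" using rk c0 by (simp add: field_simps)
      then have "\<bar>1 / \<rho> k - 1 / c k\<bar> = \<bar>\<rho> k - c k\<bar> / (\<rho> k * c k)"
        using rk c0 by (simp add: abs_divide abs_mult abs_minus_commute)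
      also have "\<dots> \<le> \<bar>\<rho> k - c k\<bar> / (1 * (1 + 1 / (B + 1)))"
        using rk ck th c0 by (intro divide_left_mono mult_mono mult_pos_pos) linarith+
      finally show ?thesis by (simp add: \<theta>_def)
    qed
    ultimately show ?thesis unfolding c_Suc by linarith
  qed
  have lim: "(\<lambda>k. \<bar>C\<bar> / \<omega> (Suc k)) \<longlonglongrightarrow> 0"
    by (intro real_tendsto_divide_at_top[OF tendsto_const] filterlim_compose[OF \<omega>_lim filterlim_Suc])
  have \<theta>0: "0 \<le> \<theta>" unfolding \<theta>_def using th by (intro divide_nonneg_nonneg) linarith+
  have \<theta>1: "\<theta> < 1" unfolding \<theta>_def using th by (subst divide_less_eq_1_pos) linarith+
  have "(\<lambda>k. \<bar>\<rho> k - c k\<bar>) \<longlonglongrightarrow> 0"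
    by (rule contraction_tendsto_0[where d = "\<lambda>k. \<bar>\<rho> k - c k\<bar>" and K = "Suc M",
          OF abs_ge_zero \<theta>0 \<theta>1 _ lim]) (rule step)
  then show ?thesis by (simp add: \<rho>_def)
qed

text \<open>Ratios and continued fractions share the upper limit \<open>R\<close>; inversion turns
  it into the lower limit \<open>\<sigma> = 1 / R\<close>.\<close>

lemma inverse_ratio_limits:
  assumes e: "e > 0"
  shows "eventually (\<lambda>k. \<omega> k / \<omega> (Suc k) > \<sigma> - e) sequentially"
    and "frequently (\<lambda>k. \<omega> k / \<omega> (Suc k) < \<sigma> + e) sequentially"
proof -
  obtain R where R: "R \<ge> 1" "limsup (\<lambda>k. ereal (c k)) = ereal R" "\<sigma> = 1 / R" using limsup_c by blast
  have near: "eventually (\<lambda>k. \<bar>\<omega> (Suc k) / \<omega> k - c k\<bar> < e / 4) sequentially"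
    using order_tendstoD(2)[OF ratio_diff_lim, of "e / 4"] e by simp
  have "limsup (\<lambda>k. ereal (c k)) < ereal (R + e / 4)" using R e by simp
  then have up: "eventually (\<lambda>k. ereal (c k) < ereal (R + e / 4)) sequentially" by (rule Limsup_lessD)
  show "eventually (\<lambda>k. \<omega> k / \<omega> (Suc k) > \<sigma> - e) sequentially"
    using up near ratio_ge_1
  proof eventually_elim
    case (elim k)
    have "c k < R + e / 4" using elim(1) by simp
    then have "\<omega> (Suc k) / \<omega> k - R \<le> e / 2" using elim(2) e by linarith
    then have "1 / R - 1 / (\<omega> (Suc k) / \<omega> k) \<le> e / 2"
      using elim(3) R(1) e by (intro inverse_diff_le) auto
    then show ?case using e R(3) by simp
  qed
  show "frequently (\<lambda>k. \<omega> k / \<omega> (Suc k) < \<sigma> + e) sequentially"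
    unfolding frequently_def
  proof
    assume "eventually (\<lambda>k. \<not> \<omega> k / \<omega> (Suc k) < \<sigma> + e) sequentially"
    then have "eventually (\<lambda>k. ereal (c k) \<le> ereal (R - e / 4)) sequentially"
      using near ratio_ge_1
    proof eventually_elim
      case (elim k)
      show ?case
      proof (rule ccontr)
        assume "\<not> ?thesis"
        then have "c k > R - e / 4" by simp
        then have "R - \<omega> (Suc k) / \<omega> k \<le> e / 2" using elim(2) e by linarith
        then have "1 / (\<omega> (Suc k) / \<omega> k) - 1 / R \<le> e / 2"
          using elim(3) R(1) e by (intro inverse_diff_le) auto
        then have "\<omega> k / \<omega> (Suc k) - \<sigma> \<le> e / 2" by (simp add: R(3))
        then have "\<omega> k / \<omega> (Suc k) < \<sigma> + e" using e by linarith
        then show False using elim by simp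
      qed
    qed
    then have "limsup (\<lambda>k. ereal (c k)) \<le> ereal (R - e / 4)" by (rule Limsup_bounded)
    then show False using R(2) e by simp
  qed
qed

end

section \<open>The exponents\<close>

text \<open>The start moves to \<open>Suc K\<close> because the estimates for \<open>z k\<close> use
  the preceding block; \<open>D\<close> dominates all additive constants.\<close>

lemma (in sturmian_points) profile:
  assumes \<omega>_lim: "filterlim \<omega> at_top sequentially" and \<sigma>: "0 < \<sigma>"
    and mono: "\<And>k. k \<ge> K \<Longrightarrow> \<omega> k \<le> \<omega> (Suc k)"
    and \<delta>_X: "\<And>k. k \<ge> K \<Longrightarrow> \<delta> * (\<omega> k + \<omega> (Suc k)) \<le> \<omega> k"
    and t_ev: "\<And>e. e > 0 \<Longrightarrow> eventually (\<lambda>k. \<omega> k / \<omega> (Suc k) > \<sigma> - e) sequentially"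
    and t_freq: "\<And>e. e > 0 \<Longrightarrow> frequently (\<lambda>k. \<omega> k / \<omega> (Suc k) < \<sigma> + e) sequentially"
  shows "\<exists>C'. sturmian_profile (log_min u 1) (log_min u 2) (log_min u 3) \<omega> n \<delta> C' \<sigma> (Suc K)"
proof -
  obtain C1 where C1: "C1 \<ge> 0"
      "\<And>q. q \<ge> 0 \<Longrightarrow> \<bar>log_min u 1 q + log_min u 2 q + log_min u 3 q - q\<bar> \<le> C1"
    using log_min_sum by blast
  define D where "D = C1 + 5 * C + 1"
  have ln_lam_mono: "log_min u j q \<le> log_min u j' q'"
    if "0 < j" "j \<le> 3" "0 < j'" "j' \<le> 3" "lam u j q \<le> lam u j' q'" for j j' q q'
    using that lam_ge_1[of j u q] lam_ge_1[of j' u q'] by (simp add: log_min_eq ln_mono)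
  have "sturmian_profile (log_min u 1) (log_min u 2) (log_min u 3) \<omega> n \<delta> D \<sigma> (Suc K)"
  proof
    show "D \<ge> 0" "0 \<le> \<delta>" "\<delta> < 1" "0 < \<sigma>" using C C1 \<delta> \<sigma> by (auto simp: D_def)
    show "filterlim \<omega> at_top sequentially" by fact
    show "log_min u 1 q \<le> log_min u 2 q" "log_min u 2 q \<le> log_min u 3 q" for q
      using lam_Suc[of 1 u q] lam_Suc[of 2 u q] by (auto intro!: ln_lam_mono simp: numeral_2_eq_2 numeral_3_eq_3)
    show "\<bar>log_min u 1 q + log_min u 2 q + log_min u 3 q - q\<bar> \<le> D" if "q \<ge> 0" for q
      using C1(2)[OF that] C by (simp add: D_def)
    show "log_min u 2 p \<le> log_min u 2 q" "log_min u 3 p \<le> log_min u 3 q" if "p \<le> q" for p q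
      using that by (auto intro!: ln_lam_mono lam_mono)
    show "\<forall>\<^sub>F k in sequentially. \<sigma> - e < \<omega> k / \<omega> (Suc k)" if "e > 0" for e using t_ev[OF that] .
    show "\<exists>\<^sub>F k in sequentially. \<omega> k / \<omega> (Suc k) < \<sigma> + e" if "e > 0" for e using t_freq[OF that] .
    fix k assume k: "Suc K \<le> k"
    then have k': "K \<le> k" by simp
    show "0 < \<omega> k" using \<omega>_pos[OF k'] .
    show "\<omega> k \<le> \<omega> (Suc k)" using mono[OF k'] .
    show "\<delta> * (\<omega> k + \<omega> (Suc k)) \<le> \<omega> k" using \<delta>_X[OF k'] .
    show "1 \<le> n k" using n_pos[OF k'] .
    show "\<bar>\<omega> (k + 2) - (real (n (k + 2)) * \<omega> (k + 1) + \<omega> k)\<bar> \<le> D"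
      using \<omega>_rec[OF k'] C1 C by (simp add: x_def D_def)
    fix q :: real
    show "log_min u 1 q \<le> max (\<omega> k) (q + \<omega> k - (2 - \<delta>) * (\<omega> k + \<omega> (Suc k))) + D"
      using log_min_1_le[OF k, of q] C C1 by (simp add: traj_def D_def)
    show "log_min u 2 q \<le> max (max (\<omega> k) (q + \<omega> k - (2 - \<delta>) * (\<omega> k + \<omega> (Suc k))))
        (max (\<omega> (k + 1)) (q + \<omega> (k + 1) - (2 - \<delta>) * (\<omega> (k + 1) + \<omega> (k + 2)))) + D"
      using log_min_2_le[OF k, of q] C C1 by (simp add: traj_def D_def)
    show "min (min ((1 - \<delta>) * (\<omega> k + \<omega> (Suc k))) (q - (\<omega> k + \<omega> (Suc k))))
        (min (\<omega> (k + 1)) (max (\<omega> k) (q + \<omega> k - (2 - \<delta>) * (\<omega> k + \<omega> (Suc k))))) - D \<le> log_min u 1 q"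
      using log_min_1_ge[OF k, of q] C C1 unfolding traj_def D_def by linarith
    show "min ((1 - \<delta>) * (\<omega> k + \<omega> (Suc k))) (q - (\<omega> k + \<omega> (Suc k))) - D \<le> log_min u 3 q"
      using log_min_3_ge[OF k', of q] C C1 unfolding x_1 D_def by linarith
    fix l :: nat and y :: real assume l: "1 \<le> l" "l \<le> n (k + 2)" and "y = real l * \<omega> (k + 1) + \<omega> k"
    then have y: "y = x k l" by (simp add: x_def)
    show "min ((1 - \<delta>) * y) (min (q - y) (\<delta> * y + q - y - \<omega> (k + 1))) - D \<le> log_min u 2 q"
      using log_min_2_ge1[OF k' l, of q] C C1 unfolding y D_def by linarith
    show "min y (min (q - y - \<omega> (k + 1)) ((1 - \<delta>) * (y + \<omega> (k + 1)))) - D \<le> log_min u 2 q"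
      using log_min_2_ge2[OF k' l, of q] C C1 unfolding y D_def by linarith
  qed
  then show ?thesis by blast
qed

text \<open>The common constant \<open>C\<close> has to be fixed before \<open>K0\<close>, since
  \<open>\<omega> k \<ge> 4 * C + 1\<close> must hold from there on.\<close>

lemma (in sturmian_data) points:
  "\<exists>C\<ge>0. \<exists>K0. \<forall>K\<ge>K0. \<exists>z p d \<kappa> x. sturmian_points u \<omega> n \<delta> C K z p d \<kappa> x"
proof -
  obtain C1 where C1: "C1 \<ge> 0" "\<And>k. \<bar>\<omega> (k + 2) - x k (n (k + 2))\<bar> \<le> C1" using \<omega>_rec by blast
  obtain C2 where C2: "C2 \<ge> 0" "\<And>k l. l \<le> Suc (n (k + 2)) \<Longrightarrow> exp (x k l - C2) \<le> norm (p k l)"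
      "\<And>k l. l \<le> Suc (n (k + 2)) \<Longrightarrow> norm (p k l) \<le> exp (x k l + C2)"
    using log_norm_p by blast
  obtain C3 K3 where C3: "C3 \<ge> 0"
      "\<And>k l. k \<ge> K3 \<Longrightarrow> l \<le> Suc (n (k + 2)) \<Longrightarrow> exp (\<delta> * x k l - C3) \<le> \<bar>real_of_int (det (block_point w N k l))\<bar>"
      "\<And>k l. k \<ge> K3 \<Longrightarrow> l \<le> Suc (n (k + 2)) \<Longrightarrow> \<bar>real_of_int (det (block_point w N k l))\<bar> \<le> exp (\<delta> * x k l + C3)"
    using log_det_block by blast
  obtain C4 where C4: "C4 \<ge> 0" "\<And>k. norm (zvec (w k)) \<le> exp (\<omega> k + C4)" using log_norm_zvec by blast
  obtain C5 \<kappa> where C5: "C5 \<ge> 0" "\<And>k. exp (- C5) \<le> \<bar>\<kappa> k\<bar>" "\<And>k. \<bar>\<kappa> k\<bar> \<le> exp C5"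
      "\<And>k. zvec (w (k + 1)) \<times> zvec (w (k + 2)) = \<kappa> k *\<^sub>R p (k + 1) 1"
    using zvec_cross_p by blast
  obtain C6 where C6: "C6 \<ge> 0" "\<And>k l c. 1 \<le> l \<Longrightarrow> l \<le> Suc (n (k + 2)) \<Longrightarrow> c \<noteq> 0 \<Longrightarrow>
      c *\<^sub>R p k l \<in> int_lattice \<Longrightarrow> exp (- C6) \<le> \<bar>c\<bar>"
    using content_p by blast
  obtain C7 K7 where C7: "C7 \<ge> 0"
      "\<And>k l. k \<ge> K7 \<Longrightarrow> 1 \<le> l \<Longrightarrow> l \<le> Suc (n (k + 2)) \<Longrightarrow> exp (x k l - C7) \<le> \<bar>p k l $ 1\<bar>"
      "\<And>k l. k \<ge> K7 \<Longrightarrow> 1 \<le> l \<Longrightarrow> l \<le> Suc (n (k + 2)) \<Longrightarrow>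
        norm (p k l - (p k l $ 1) *\<^sub>R u) \<le> exp ((\<delta> - 1) * x k l + C7)"
    using p_near_u by blast
  define C where "C = C1 + C2 + C3 + C4 + C5 + C6 + C7"
  have le: "C1 \<le> C" "C2 \<le> C" "C3 \<le> C" "C4 \<le> C" "C5 \<le> C" "C6 \<le> C" "C7 \<le> C" "0 \<le> C"
    using C1(1) C2(1) C3(1) C4(1) C5(1) C6(1) C7(1) by (auto simp: C_def)
  obtain K8 where K8: "\<And>k. k \<ge> K8 \<Longrightarrow> \<omega> k \<ge> 4 * C + 1"
    using \<omega>_lim unfolding filterlim_at_top eventually_sequentially by blast
  have weaken: "exp (a - c) \<le> t \<Longrightarrow> exp (a - C) \<le> t" "t \<le> exp (a + c) \<Longrightarrow> t \<le> exp (a + C)"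
    "exp (- c) \<le> t \<Longrightarrow> exp (- C) \<le> t" "t \<le> exp c \<Longrightarrow> t \<le> exp C"
    if "c \<le> C" for a c t :: real
    using that by (auto elim: order_trans[rotated] order_trans)
  have "sturmian_points u \<omega> n \<delta> C K (\<lambda>k. zvec (w k)) p
      (\<lambda>k l. real_of_int (det (block_point w N k l))) \<kappa> x"
    if K: "K \<ge> max 1 (max K3 (max K7 K8))" for K
  proof
    show "u $ 1 = 1" by (rule u_components)
    show "0 \<le> C" "0 \<le> \<delta>" "\<delta> < 1" using le delta_nonneg delta_less_1 by auto
    show "x k l = real l * \<omega> (k + 1) + \<omega> k" for k l by (rule x_def)
    fix k assume "k \<ge> K"
    then have k: "k \<ge> 1" "k \<ge> K3" "k \<ge> K7" "k \<ge> K8" using K by auto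
    show "4 * C + 1 \<le> \<omega> k" by (rule K8[OF k(4)])
    show "1 \<le> n k" by (rule n_pos[OF k(1)])
    show "\<bar>\<omega> (k + 2) - x k (n (k + 2))\<bar> \<le> C" using C1(2)[of k] le by linarith
    show "zvec (w k) \<in> int_lattice" by (rule zvec_int_lattice)
    show "norm (zvec (w k)) \<le> exp (\<omega> k + C)" by (rule weaken(2)[OF le(4) C4(2)])
    show "p k l \<in> int_lattice" for l unfolding p_def by (rule sym_point_int_lattice)
    show "zvec (w (k + 1)) \<bullet> p k l = 0" for l
      using block_zvec_orthogonal[OF sturmian admissible, of k l] by (simp add: p_def)
    show "p k l \<times> p k (Suc l) = real_of_int (det (block_point w N k l)) *\<^sub>R zvec (w (k + 1))" for l
      using block_cross[OF sturmian admissible, of k l] by (simp add: p_def)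
    show "p k (Suc (n (k + 2))) = p (k + 1) 1"
      using block_link[OF sturmian admissible, of k] by (simp add: p_def n_def)
    show "zvec (w (k + 1)) \<times> zvec (w (k + 2)) = \<kappa> k *\<^sub>R p (k + 1) 1" by (rule C5(4))
    show "exp (- C) \<le> \<bar>\<kappa> k\<bar>" by (rule weaken(3)[OF le(5) C5(2)])
    show "\<bar>\<kappa> k\<bar> \<le> exp C" by (rule weaken(4)[OF le(5) C5(3)])
    fix l :: nat assume l: "1 \<le> l"
    show "exp (\<delta> * x k l - C) \<le> \<bar>real_of_int (det (block_point w N k l))\<bar>" if "l \<le> n (k + 2)"
      using weaken(1)[OF le(3) C3(2)[OF k(2)]] that by simp
    show "\<bar>real_of_int (det (block_point w N k l))\<bar> \<le> exp (\<delta> * x k l + C)" if "l \<le> n (k + 2)"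
      using weaken(2)[OF le(3) C3(3)[OF k(2)]] that by simp
    assume l': "l \<le> Suc (n (k + 2))"
    show "exp (x k l - C) \<le> norm (p k l)" by (rule weaken(1)[OF le(2) C2(2)[OF l']])
    show "norm (p k l) \<le> exp (x k l + C)" by (rule weaken(2)[OF le(2) C2(3)[OF l']])
    show "exp (x k l - C) \<le> \<bar>p k l $ 1\<bar>" by (rule weaken(1)[OF le(7) C7(2)[OF k(3) l l']])
    show "norm (p k l - (p k l $ 1) *\<^sub>R u) \<le> exp ((\<delta> - 1) * x k l + C)"
      by (rule weaken(2)[OF le(7) C7(3)[OF k(3) l l']])
    show "exp (- C) \<le> \<bar>c\<bar>" if "c \<noteq> 0" "c *\<^sub>R p k l \<in> int_lattice" for c
      by (rule weaken(3)[OF le(6) C6(2)[OF l l' that]])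
  qed
  then show ?thesis using le(8) by blast
qed

lemma (in sturmian_data) exists_profile:
  assumes delta_less: "\<delta> < \<sigma> / (1 + \<sigma>)" and sigma: "\<sigma> = sturm_sigma s"
  shows "\<sigma> > 0 \<and> (\<exists>C K. sturmian_profile (log_min u 1) (log_min u 2) (log_min u 3) \<omega> n \<delta> C \<sigma> K)"
proof -
  obtain B where B: "\<And>k. \<bar>s k\<bar> \<le> B" using s_bounded by blast
  obtain C1 where C1: "\<And>k. \<bar>\<omega> (k + 2) - x k (n (k + 2))\<bar> \<le> C1" using \<omega>_rec by blast
  have rec: "\<bar>\<omega> (k + 2) - (real_of_int (s (k + 2)) * \<omega> (k + 1) + \<omega> k)\<bar> \<le> C1" for k
  proof -
    have "real (n (k + 2)) = real_of_int (s (k + 2))"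
      using int_n[of "k + 2"] by (metis le_add2 of_int_of_nat_eq one_le_numeral order_trans)
    then show ?thesis using C1[of k] by (simp only: x_def)
  qed
  interpret log_recurrence s \<sigma> "real_of_int B" \<omega> C1
  proof
    show "real_of_int (s k) \<le> real_of_int B" for k using B[of k] by simp
    show "1 \<le> s k" if "1 \<le> k" for k using s_pos that by blast
  qed (fact \<omega>_lim rec sigma)+
  obtain C K0 where K0: "\<And>K. K \<ge> K0 \<Longrightarrow> \<exists>z p d \<kappa> x. sturmian_points u \<omega> n \<delta> C K z p d \<kappa> x"
    using points by blast
  \<comment> \<open>In the form \<open>\<delta> / (1 - \<delta>) < \<sigma>\<close> the hypothesis
    is eventually inherited by the ratios \<open>\<omega> k / \<omega> (Suc k)\<close>, which is the
    condition \<open>\<delta>_X\<close>.\<close>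
  have "\<delta> * (1 + \<sigma>) < \<sigma>" using delta_less \<sigma>_pos by (simp add: field_simps)
  then have "\<delta> / (1 - \<delta>) < \<sigma>" using delta_less_1 by (simp add: field_simps)
  then have "eventually (\<lambda>k. \<omega> k / \<omega> (Suc k) > \<delta> / (1 - \<delta>)) sequentially"
    using inverse_ratio_limits(1)[of "\<sigma> - \<delta> / (1 - \<delta>)"] by simp
  then have "eventually (\<lambda>k. \<omega> k \<le> \<omega> (Suc k) \<and> \<delta> * (\<omega> k + \<omega> (Suc k)) \<le> \<omega> k) sequentially"
    using ratio_ge_1
  proof eventually_elim
    case (elim k)
    then have pos: "\<omega> k > 0" "\<omega> (Suc k) > 0" "1 - \<delta> > 0" using delta_less_1 by auto
    then have "\<delta> * \<omega> (Suc k) < \<omega> k * (1 - \<delta>)" using elim(1) by (simp add: divide_less_eq field_simps)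
    moreover have "\<omega> k \<le> \<omega> (Suc k)" using elim pos by (simp add: le_divide_eq)
    ultimately show ?case by (simp add: algebra_simps)
  qed
  then obtain K1 where K1: "\<And>k. k \<ge> K1 \<Longrightarrow> \<omega> k \<le> \<omega> (Suc k)"
      "\<And>k. k \<ge> K1 \<Longrightarrow> \<delta> * (\<omega> k + \<omega> (Suc k)) \<le> \<omega> k"
    unfolding eventually_sequentially by blast
  define K where "K = max K0 K1"
  obtain z p d \<kappa> x where "sturmian_points u \<omega> n \<delta> C K z p d \<kappa> x" using K0[of K] by (auto simp: K_def)
  then interpret pts: sturmian_points u \<omega> n \<delta> C K z p d \<kappa> x .
  have "\<exists>C'. sturmian_profile (log_min u 1) (log_min u 2) (log_min u 3) \<omega> n \<delta> C' \<sigma> (Suc K)"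
    using K1 by (intro pts.profile \<omega>_lim \<sigma>_pos inverse_ratio_limits) (auto simp: K_def)
  then show ?thesis using \<sigma>_pos by blast
qed

text \<open>With the root isolated, the squares of the two sides differ by
  \<open>\<sigma> / (1 + \<sigma>)^2\<close>, which is positive.\<close>

lemma h_fun_bound:
  assumes "\<sigma> > 0" shows "h_fun \<sigma> \<le> \<sigma> / (1 + \<sigma>)"
proof -
  define r where "r = sqrt ((\<sigma> / 2)\<^sup>2 + 1)"
  have "\<sigma> / 2 + 1 - \<sigma> / (1 + \<sigma>) \<le> r"
    unfolding r_def
  proof (rule real_le_rsqrt)
    have "(\<sigma> / 2 + 1 - \<sigma> / (1 + \<sigma>))\<^sup>2 = (\<sigma> / 2)\<^sup>2 + 1 - \<sigma> / (1 + \<sigma>)\<^sup>2"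
      using assms by (simp add: power2_eq_square divide_simps) (simp add: algebra_simps)
    then show "(\<sigma> / 2 + 1 - \<sigma> / (1 + \<sigma>))\<^sup>2 \<le> (\<sigma> / 2)\<^sup>2 + 1" using assms by simp
  qed
  then show ?thesis by (simp add: h_fun_def r_def)
qed

text \<open>The comparison of the two quotients amounts to
  \<open>\<delta>^2 - (2 + \<sigma>) * \<delta> + \<sigma> \<ge> 0\<close>, and
  \<open>h_fun \<sigma>\<close> is the smaller root of this quadratic.\<close>

lemma max_eq_of_le_h_fun:
  assumes "\<sigma> > 0" "\<delta> < 1" "\<delta> \<le> h_fun \<sigma>"
  shows "max ((1 - \<delta>) / (2 - \<delta>)) (1 / (2 - \<delta> + \<sigma>)) = (1 - \<delta>) / (2 - \<delta>)"
proof -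
  define r where "r = sqrt ((\<sigma> / 2)\<^sup>2 + 1)"
  have "r\<^sup>2 = (\<sigma> / 2)\<^sup>2 + 1" by (simp add: r_def)
  have r0: "r \<ge> 0" by (simp add: r_def)
  have "r \<le> \<sigma> / 2 + 1 - \<delta>" using assms(3) by (simp add: h_fun_def r_def)
  then have "r\<^sup>2 \<le> (\<sigma> / 2 + 1 - \<delta>)\<^sup>2" using r0 by (intro power_mono) auto
  then have "2 - \<delta> \<le> (1 - \<delta>) * (2 - \<delta> + \<sigma>)"
    unfolding \<open>r\<^sup>2 = _\<close> by (simp add: power2_eq_square algebra_simps)
  then have "1 / (2 - \<delta> + \<sigma>) \<le> (1 - \<delta>) / (2 - \<delta>)"
    using assms by (simp add: pos_divide_le_eq pos_le_divide_eq mult.commute)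
  then show ?thesis by simp
qed

theorem theorem7p3:
  fixes s :: "nat \<Rightarrow> int"
    and w :: "nat \<Rightarrow> int^2^2"
    and N :: "int^2^2"
    and y :: "int \<Rightarrow> int^2^2"
    and \<sigma> \<delta> \<xi> :: real
    and u :: "real^3"
  assumes s_bounded: "\<exists>B. \<forall>k. \<bar>s k\<bar> \<le> B"
    and s_0: "s 0 = -1"
    and s_1: "s 1 = 1"
    and s_pos: "\<forall>k\<ge>1. s k \<ge> 1"
    and sigma: "\<sigma> = sturm_sigma s"
    and sturmian: "sturmian_seq s w"
    and admissible: "admissible_with w N"
    and N_nonsym: "\<not> symmetric_mat N"
    and growth: "mult_growth s w"
    and unbounded: "filterlim (\<lambda>i. max_norm (w i)) at_top sequentially"
    and y_seq: "symmetric_seq s w N y"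
    and delta_nonneg: "\<delta> \<ge> 0"
    and delta: "(\<lambda>i. real_of_int \<bar>det (w i)\<bar>) \<in> \<Theta>(\<lambda>i. real_of_int (max_norm (w i)) powr \<delta>)"
    and delta_less: "\<delta> < \<sigma> / (1 + \<sigma>)"
    and content_bounded: "\<exists>C. \<forall>i\<ge>-2. sym_content (y i) \<le> C"
    and u: "u = vector [1, \<xi>, \<xi>\<^sup>2]"
    and limit: "limitin proj_plane (\<lambda>i. proj_class (sym_point (y i))) (proj_class u) at_top"
  shows "psi_lower u 1 = ereal (\<sigma> / ((2 - \<delta>) * (1 + \<sigma>))) \<and>
    psi_upper u 1 = ereal (1 / ((1 - \<delta>) * (1 + \<sigma>) + 2)) \<and>
    psi_upper u 2 = ereal (1 / (2 + \<sigma>)) \<and>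
    psi_lower u 3 = ereal ((1 - \<delta>) * (1 + \<sigma>) / (1 + 2 * (1 - \<delta>) * (1 + \<sigma>))) \<and>
    ereal ((1 - \<delta>) / (2 - \<delta>)) \<le> psi_upper u 3 \<and>
    psi_upper u 3 \<le> ereal (max ((1 - \<delta>) / (2 - \<delta>)) (1 / (2 - \<delta> + \<sigma>))) \<and>
    h_fun \<sigma> \<le> \<sigma> / (1 + \<sigma>) \<and>
    (\<delta> \<le> h_fun \<sigma> \<longrightarrow> psi_upper u 3 = ereal ((1 - \<delta>) / (2 - \<delta>)))"
proof -
  obtain B where B: "\<And>k. \<bar>s k\<bar> \<le> B" using s_bounded by blast
  interpret bounded_quotients s \<sigma> "real_of_int B"
  proof
    show "real_of_int (s k) \<le> real_of_int B" for k using B[of k] by simp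
    show "1 \<le> s k" if "1 \<le> k" for k using s_pos that by blast
  qed (fact sigma)
  \<comment> \<open>Positivity of \<open>\<sigma>\<close> is available from the continued fractions
    alone, and gives the \<open>\<delta> < 1\<close> that \<open>sturmian_data\<close> asks
    for.\<close>
  have "\<sigma> / (1 + \<sigma>) < 1" using \<sigma>_pos by simp
  then have \<delta>1: "\<delta> < 1" using delta_less by simp
  interpret data: sturmian_data s w N y \<delta> \<xi> u
    by unfold_locales (fact assms \<delta>1)+
  obtain C K where "sturmian_profile (log_min u 1) (log_min u 2) (log_min u 3) data.\<omega> data.n \<delta> C \<sigma> K"
    using data.exists_profile[OF delta_less sigma] by blast
  then interpret profile: sturmian_profile "log_min u 1" "log_min u 2" "log_min u 3" data.\<omega> data.n \<delta> C \<sigma> K .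
  have "psi_upper u 3 = ereal ((1 - \<delta>) / (2 - \<delta>))" if "\<delta> \<le> h_fun \<sigma>"
    using profile.limsup_L3_ge profile.limsup_L3_le max_eq_of_le_h_fun[OF \<sigma>_pos \<delta>1 that]
    unfolding psi_upper_def by (intro antisym) simp_all
  then show ?thesis
    using profile.liminf_L1 profile.limsup_L1 profile.limsup_L2 profile.liminf_L3
      profile.limsup_L3_ge profile.limsup_L3_le h_fun_bound[OF \<sigma>_pos]
    unfolding psi_upper_def psi_lower_def by blast
qed

end
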